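(* Let $\Omega$ be a bounded connected domain of $\mathbb{R}^N$. For all $\beta>\lambda_1$, let $$\alpha_\beta=\inf\left\{ \int_\Omega |Du^-|^2dx\ :\ u\in H^1_0(\Omega),\ \|u^+\|_{L^2(\Omega)}=\|u^-\|_{L^2(\Omega)}=1,\ \int_\Omega |Du^+|^2dx=\beta\right\}.$$ Then, for $N\ge3$ we have $$\lim_{\beta\to+\infty}\beta^{\frac{N-2}{2}}(\alpha_\beta-\lambda_1)=0,$$ while, for $N=2$, $$\lim_{\beta\to+\infty}(\log\beta)\,(\alpha_\beta-\lambda_1)=0.$$
   Context: Notation: $u^\pm=\max\{\pm u,0\}$, so $u=u^+-u^-$; $Du$ is the gradient; $\lambda_1$ is the first eigenvalue of $-\Delta$ in $H^1_0(\Omega)$. *)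

theory Defs
  imports "HOL-Analysis.Analysis"
begin

text \<open>
  Functions on an open set \<open>\<Omega>\<close> are represented by total functions; only their values on \<open>\<Omega>\<close>
  (up to null sets) matter.  \<open>lebesgue_on \<Omega>\<close> is the completed Lebesgue measure on \<open>\<Omega>\<close>.
\<close>

fun C_k :: "nat \<Rightarrow> ('a::euclidean_space \<Rightarrow> real) \<Rightarrow> bool" where
  "C_k 0 f \<longleftrightarrow> continuous_on UNIV f"
| "C_k (Suc k) f \<longleftrightarrow> (\<forall>x. f differentiable (at x)) \<and>
     (\<forall>i\<in>Basis. C_k k (\<lambda>x. frechet_derivative f (at x) i))"

definition gradient :: "('a::euclidean_space \<Rightarrow> real) \<Rightarrow> 'a \<Rightarrow> 'a" where
  "gradient f x = (\<Sum>i\<in>Basis. frechet_derivative f (at x) i *\<^sub>R i)"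

text \<open>An element of \<open>C\<^sub>c\<^sup>\<infinity>(\<Omega>)\<close> is identified with its extension by zero, which is smooth
  on the whole space.\<close>

definition test_function :: "'a::euclidean_space set \<Rightarrow> ('a \<Rightarrow> real) \<Rightarrow> bool" where
  "test_function \<Omega> \<phi> \<longleftrightarrow> (\<forall>k. C_k k \<phi>) \<and>
     compact (closure {x. \<phi> x \<noteq> 0}) \<and> closure {x. \<phi> x \<noteq> 0} \<subseteq> \<Omega>"

definition locally_integrable ::
    "'a::euclidean_space set \<Rightarrow> ('a \<Rightarrow> 'b::euclidean_space) \<Rightarrow> bool" where
  "locally_integrable \<Omega> f \<longleftrightarrow> (\<forall>K. compact K \<and> K \<subseteq> \<Omega> \<longrightarrow> set_integrable lebesgue K f)"

definition has_weak_gradient ::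
    "'a::euclidean_space set \<Rightarrow> ('a \<Rightarrow> real) \<Rightarrow> ('a \<Rightarrow> 'a) \<Rightarrow> bool" where
  "has_weak_gradient \<Omega> u g \<longleftrightarrow> locally_integrable \<Omega> u \<and> locally_integrable \<Omega> g \<and>
     (\<forall>\<phi>. test_function \<Omega> \<phi> \<longrightarrow>
       (\<integral>x. u x *\<^sub>R gradient \<phi> x \<partial>lebesgue_on \<Omega>) = - (\<integral>x. \<phi> x *\<^sub>R g x \<partial>lebesgue_on \<Omega>))"

text \<open>On an open \<open>\<Omega>\<close> the weak gradient is unique up to null sets, so integrals of the chosen
  representative do not depend on the choice.  The value is meaningful only where a weak gradient
  exists, in particular for all elements of \<open>H10 \<Omega>\<close> below and their positive and negative parts.\<close>

definition weak_grad :: "'a::euclidean_space set \<Rightarrow> ('a \<Rightarrow> real) \<Rightarrow> 'a \<Rightarrow> 'a" where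
  "weak_grad \<Omega> u = (SOME g. has_weak_gradient \<Omega> u g)"

definition L2_on ::
    "'a::euclidean_space set \<Rightarrow> ('a \<Rightarrow> 'b::euclidean_space) \<Rightarrow> bool" where
  "L2_on \<Omega> f \<longleftrightarrow> f \<in> borel_measurable (lebesgue_on \<Omega>) \<and>
     integrable (lebesgue_on \<Omega>) (\<lambda>x. (norm (f x))\<^sup>2)"

definition L2_norm_on ::
    "'a::euclidean_space set \<Rightarrow> ('a \<Rightarrow> 'b::euclidean_space) \<Rightarrow> real" where
  "L2_norm_on \<Omega> f = sqrt (\<integral>x. (norm (f x))\<^sup>2 \<partial>lebesgue_on \<Omega>)"

definition H1 :: "'a::euclidean_space set \<Rightarrow> ('a \<Rightarrow> real) set" where
  "H1 \<Omega> = {u. L2_on \<Omega> u \<and> (\<exists>g. has_weak_gradient \<Omega> u g \<and> L2_on \<Omega> g)}"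

text \<open>The closure of \<open>C\<^sub>c\<^sup>\<infinity>(\<Omega>)\<close> in the norm of \<open>H\<^sup>1(\<Omega>)\<close>.\<close>

definition H10 :: "'a::euclidean_space set \<Rightarrow> ('a \<Rightarrow> real) set" where
  "H10 \<Omega> = {u \<in> H1 \<Omega>. \<exists>\<phi>. (\<forall>n::nat. test_function \<Omega> (\<phi> n)) \<and>
     (\<lambda>n. L2_norm_on \<Omega> (\<lambda>x. \<phi> n x - u x)) \<longlonglongrightarrow> 0 \<and>
     (\<lambda>n. L2_norm_on \<Omega> (\<lambda>x. gradient (\<phi> n) x - weak_grad \<Omega> u x)) \<longlonglongrightarrow> 0}"

definition dirichlet_energy :: "'a::euclidean_space set \<Rightarrow> ('a \<Rightarrow> real) \<Rightarrow> real" where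
  "dirichlet_energy \<Omega> u = (\<integral>x. (norm (weak_grad \<Omega> u x))\<^sup>2 \<partial>lebesgue_on \<Omega>)"

text \<open>\<open>- \<Delta> u = \<mu> u\<close> in the weak sense, with \<open>u\<close> a nonzero element of \<open>H10 \<Omega>\<close>.\<close>

definition dirichlet_eigenvalue :: "'a::euclidean_space set \<Rightarrow> real \<Rightarrow> bool" where
  "dirichlet_eigenvalue \<Omega> \<mu> \<longleftrightarrow>
     (\<exists>u\<in>H10 \<Omega>. \<not> (AE x in lebesgue_on \<Omega>. u x = 0) \<and>
       (\<forall>v\<in>H10 \<Omega>. (\<integral>x. weak_grad \<Omega> u x \<bullet> weak_grad \<Omega> v x \<partial>lebesgue_on \<Omega>)
                   = \<mu> * (\<integral>x. u x * v x \<partial>lebesgue_on \<Omega>)))"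

definition lambda1 :: "'a::euclidean_space set \<Rightarrow> real" where
  "lambda1 \<Omega> = (LEAST \<mu>. dirichlet_eigenvalue \<Omega> \<mu>)"

definition pos_part :: "('a \<Rightarrow> real) \<Rightarrow> 'a \<Rightarrow> real" where
  "pos_part u x = max (u x) 0"

definition neg_part :: "('a \<Rightarrow> real) \<Rightarrow> 'a \<Rightarrow> real" where
  "neg_part u x = max (- u x) 0"

definition alpha :: "'a::euclidean_space set \<Rightarrow> real \<Rightarrow> real" where
  "alpha \<Omega> \<beta> = Inf {dirichlet_energy \<Omega> (neg_part u) | u. u \<in> H10 \<Omega> \<and>
     L2_norm_on \<Omega> (pos_part u) = 1 \<and> L2_norm_on \<Omega> (neg_part u) = 1 \<and>
     dirichlet_energy \<Omega> (pos_part u) = \<beta>}"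

end

theory Submission
  imports Defs "HOL-Complex_Analysis.Great_Picard" "HOL-Library.Diagonal_Subsequence"
begin

text \<open>
  \<open>\<lambda>\<^sub>1\<close> is the minimum of the Rayleigh quotient, which gives \<open>\<alpha>\<^sub>\<beta> \<ge> \<lambda>\<^sub>1\<close>.  For the upper bound take a nonnegative
  minimiser \<open>u\<close>, cut it off by a function \<open>\<eta>\<close> vanishing on a small ball around \<open>x\<^sub>0\<close> of radius \<open>r\<close>, and
  let \<open>u\<^sup>+\<close> be a bump in that ball, of energy \<open>\<beta>\<close> proportional to \<open>1/r\<^sup>2\<close>.  The eigenvalue equation tested
  with \<open>\<eta>\<^sup>2 u\<close> gives \<open>\<integral>\<bar>D(\<eta> u)\<bar>\<^sup>2 = \<lambda>\<^sub>1 \<integral> \<eta>\<^sup>2 u\<^sup>2 + \<integral> u\<^sup>2 \<bar>D\<eta>\<bar>\<^sup>2\<close>, so \<open>\<alpha>\<^sub>\<beta> - \<lambda>\<^sub>1\<close> is at most a constant times \<open>u(x\<^sub>0)\<^sup>2\<close> times the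
  capacity of the ball, which is of order \<open>r\<^sup>N\<^sup>-\<^sup>2\<close>, or \<open>1 / log (1/r)\<close> if \<open>N = 2\<close>.  No regularity of \<open>u\<close> is used:
  \<open>u\<close> is not bounded away from 0, and averaging over \<open>x\<^sub>0\<close> in a compact set where \<open>u\<close> is small finds a
  centre at which \<open>\<integral> u\<^sup>2 \<bar>D\<eta>\<bar>\<^sup>2\<close> is as small as the pointwise heuristics predicts.
\<close>

subsection \<open>Square-integrable functions\<close>

text \<open>The limit is 0, and not just finite, because the bound carries a factor
  \<open>s\<^sup>2\<close> with \<open>s > 0\<close> arbitrary: for every \<open>s\<close> the set
  where \<open>u < s\<close> has positive measure, as no element of \<open>H10 \<Omega>\<close>
  stays above a positive constant almost everywhere. The compact set and the admissible radii depend
  on \<open>s\<close> alone, while the centre is chosen anew for each radius. Cutting off also costs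
  mass, and this loss has to be controlled at the same centre; so one weight, the sum of the
  normalised \<open>|D\<eta>|\<^sup>2\<close> and of the normalised indicator of a ball, is
  averaged. The energy \<open>\<beta>\<close> is hit exactly by choosing \<open>r\<close>: the bump
  and the cut-off minimiser are disjoint, hence are the two parts of their difference. The
  definitions dictate the groundwork. \<open>weak_grad\<close> is an arbitrary choice, so weak
  gradients must be unique; \<open>lambda1\<close> is a least eigenvalue, so the Rayleigh infimum
  must be attained, which takes Rellich compactness; \<open>H10 \<Omega>\<close> is a closure, so
  estimates are proved for test functions and passed to the limit. The translation estimate for test
  functions serves compactness, the small values of \<open>u\<close> and the choice of the centre
  alike.\<close>

definition l2 :: "'a measure \<Rightarrow> ('a \<Rightarrow> 'b::euclidean_space) \<Rightarrow> bool" where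
  "l2 M f \<longleftrightarrow> f \<in> borel_measurable M \<and> integrable M (\<lambda>x. (norm (f x))\<^sup>2)"

definition n2 :: "'a measure \<Rightarrow> ('a \<Rightarrow> 'b::euclidean_space) \<Rightarrow> real" where
  "n2 M f = sqrt (\<integral>x. (norm (f x))\<^sup>2 \<partial>M)"

text \<open>The work is done over a general measure because the estimates alternate between
  \<open>lebesgue_on \<Omega>\<close> and \<open>lborel\<close>.\<close>

lemma L2_on_eq: "L2_on \<Omega> = l2 (lebesgue_on \<Omega>)"
  by (auto simp: fun_eq_iff L2_on_def l2_def)

lemma L2_norm_on_eq: "L2_norm_on \<Omega> = n2 (lebesgue_on \<Omega>)"
  by (auto simp: fun_eq_iff L2_norm_on_def n2_def)

lemma l2_measurable [measurable_dest]: "l2 M f \<Longrightarrow> f \<in> borel_measurable M"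
  by (simp add: l2_def)

lemma l2_integrable_sq: "l2 M f \<Longrightarrow> integrable M (\<lambda>x. (norm (f x))\<^sup>2)"
  by (simp add: l2_def)

lemma n2_nonneg [simp]: "n2 M f \<ge> 0"
  by (simp add: n2_def)

lemma n2_power2: "(n2 M f)\<^sup>2 = (\<integral>x. (norm (f x))\<^sup>2 \<partial>M)"
  by (simp add: n2_def)

lemma l2_boundI:
  fixes f :: "'a \<Rightarrow> 'b::euclidean_space" and g :: "'a \<Rightarrow> 'c::euclidean_space"
  assumes "l2 M f" "g \<in> borel_measurable M" "AE x in M. norm (g x) \<le> C * norm (f x)"
  shows "l2 M g"
proof -
  have "integrable M (\<lambda>x. C\<^sup>2 * (norm (f x))\<^sup>2)"
    using assms(1) by (simp add: l2_def)
  then have "integrable M (\<lambda>x. (norm (g x))\<^sup>2)"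
  proof (rule Bochner_Integration.integrable_bound)
    show "(\<lambda>x. (norm (g x))\<^sup>2) \<in> borel_measurable M" using assms(2) by measurable
    show "AE x in M. norm ((norm (g x))\<^sup>2) \<le> norm (C\<^sup>2 * (norm (f x))\<^sup>2)"
      using assms(3)
    proof eventually_elim
      case (elim x)
      have "(norm (g x))\<^sup>2 \<le> (C * norm (f x))\<^sup>2"
        using elim by (intro power_mono) auto
      then show ?case by (simp add: power_mult_distrib)
    qed
  qed
  then show ?thesis using assms(2) by (simp add: l2_def)
qed

lemma l2_zero [simp]: "l2 M (\<lambda>x. 0)"
  by (simp add: l2_def)

lemma l2_scaleR: "l2 M f \<Longrightarrow> l2 M (\<lambda>x. c *\<^sub>R f x)"
  by (rule l2_boundI[where C="\<bar>c\<bar>" and f=f]) (auto dest: l2_measurable)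

lemma l2_uminus: "l2 M f \<Longrightarrow> l2 M (\<lambda>x. - f x)"
  using l2_scaleR[of M f "-1"] by simp

lemma l2_norm: "l2 M f \<Longrightarrow> l2 M (\<lambda>x. norm (f x))"
  by (auto simp: l2_def)

lemma l2_add:
  assumes "l2 M f" "l2 M g" shows "l2 M (\<lambda>x. f x + g x)"
proof -
  have m [measurable]: "f \<in> borel_measurable M" "g \<in> borel_measurable M"
    using assms by (auto simp: l2_def)
  have "integrable M (\<lambda>x. 2 * (norm (f x))\<^sup>2 + 2 * (norm (g x))\<^sup>2)"
    using assms by (simp add: l2_def)
  then have "integrable M (\<lambda>x. (norm (f x + g x))\<^sup>2)"
  proof (rule Bochner_Integration.integrable_bound)
    show "AE x in M. norm ((norm (f x + g x))\<^sup>2) \<le> norm (2 * (norm (f x))\<^sup>2 + 2 * (norm (g x))\<^sup>2)"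
    proof (rule AE_I2)
      fix x
      have "(norm (f x + g x))\<^sup>2 \<le> (norm (f x) + norm (g x))\<^sup>2"
        by (intro power_mono norm_triangle_ineq) auto
      also have "\<dots> \<le> 2 * (norm (f x))\<^sup>2 + 2 * (norm (g x))\<^sup>2"
        using sum_squares_bound[of "norm (f x)" "norm (g x)"] by (simp add: power2_sum)
      finally show "norm ((norm (f x + g x))\<^sup>2) \<le> norm (2 * (norm (f x))\<^sup>2 + 2 * (norm (g x))\<^sup>2)"
        by simp
    qed
  qed measurable
  then show ?thesis by (simp add: l2_def)
qed

lemma l2_diff: "l2 M f \<Longrightarrow> l2 M g \<Longrightarrow> l2 M (\<lambda>x. f x - g x)"
  using l2_add[of M f "\<lambda>x. - g x"] l2_uminus[of M g] by simp

lemma l2_inner_integrable: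
  assumes "l2 M f" "l2 M g" shows "integrable M (\<lambda>x. f x \<bullet> g x)"
proof -
  have m [measurable]: "f \<in> borel_measurable M" "g \<in> borel_measurable M"
    using assms by (auto simp: l2_def)
  have "integrable M (\<lambda>x. (norm (f x))\<^sup>2 + (norm (g x))\<^sup>2)"
    using assms by (simp add: l2_def)
  then show ?thesis
  proof (rule Bochner_Integration.integrable_bound)
    show "AE x in M. norm (f x \<bullet> g x) \<le> norm ((norm (f x))\<^sup>2 + (norm (g x))\<^sup>2)"
    proof (rule AE_I2)
      fix x
      have "\<bar>f x \<bullet> g x\<bar> \<le> norm (f x) * norm (g x)" by (rule Cauchy_Schwarz_ineq2)
      also have "\<dots> \<le> (norm (f x))\<^sup>2 + (norm (g x))\<^sup>2"
        using sum_squares_bound[of "norm (f x)" "norm (g x)"]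
          zero_le_power2[of "norm (f x)"] zero_le_power2[of "norm (g x)"] by argo
      finally show "norm (f x \<bullet> g x) \<le> norm ((norm (f x))\<^sup>2 + (norm (g x))\<^sup>2)"
        by simp
    qed
  qed measurable
qed

lemma l2_mult_integrable:
  fixes f g :: "'a \<Rightarrow> real"
  assumes "l2 M f" "l2 M g" shows "integrable M (\<lambda>x. f x * g x)"
  using l2_inner_integrable[OF assms] by simp

lemma l2_scaleR_integrable:
  fixes f :: "'a \<Rightarrow> real" and g :: "'a \<Rightarrow> 'b::euclidean_space"
  assumes "l2 M f" "l2 M g" shows "integrable M (\<lambda>x. f x *\<^sub>R g x)"
proof -
  have m [measurable]: "f \<in> borel_measurable M" "g \<in> borel_measurable M"
    using assms by (auto simp: l2_def)
  have "integrable M (\<lambda>x. norm (f x) * norm (g x))"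
    using l2_mult_integrable[OF l2_norm l2_norm, OF assms] .
  then show ?thesis
    by (rule Bochner_Integration.integrable_bound) auto
qed

lemma n2_add_power2:
  assumes "l2 M f" "l2 M g"
  shows "(n2 M (\<lambda>x. f x + g x))\<^sup>2 = (n2 M f)\<^sup>2 + 2 * (\<integral>x. f x \<bullet> g x \<partial>M) + (n2 M g)\<^sup>2"
proof -
  have "(\<integral>x. (norm (f x + g x))\<^sup>2 \<partial>M)
      = (\<integral>x. (norm (f x))\<^sup>2 + 2 * (f x \<bullet> g x) + (norm (g x))\<^sup>2 \<partial>M)"
    by (rule Bochner_Integration.integral_cong) (auto simp: power2_norm_eq_inner inner_add inner_commute)
  also have "\<dots> = (\<integral>x. (norm (f x))\<^sup>2 \<partial>M) + 2 * (\<integral>x. f x \<bullet> g x \<partial>M) + (\<integral>x. (norm (g x))\<^sup>2 \<partial>M)"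
    using l2_inner_integrable[OF assms] assms by (simp add: l2_def)
  finally show ?thesis by (simp add: n2_power2)
qed

lemma n2_scaleR: "n2 M (\<lambda>x. c *\<^sub>R f x) = \<bar>c\<bar> * n2 M f"
  by (simp add: n2_def power_mult_distrib real_sqrt_mult)

lemma n2_uminus: "n2 M (\<lambda>x. - f x) = n2 M f"
  by (simp add: n2_def)

lemma n2_norm: "n2 M (\<lambda>x. norm (f x)) = n2 M f"
  by (simp add: n2_def)

lemma n2_commute: "n2 M (\<lambda>x. f x - g x) = n2 M (\<lambda>x. g x - f x)"
  by (simp add: n2_def norm_minus_commute)

text \<open>Discriminant argument: the norm square of \<open>f + t g\<close> is a nonnegative
  quadratic polynomial in \<open>t\<close>. If it degenerates to a linear one
  (\<open>c = 0\<close>), its slope must vanish.\<close>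

lemma l2_Cauchy_Schwarz:
  assumes "l2 M f" "l2 M g"
  shows "\<bar>\<integral>x. f x \<bullet> g x \<partial>M\<bar> \<le> n2 M f * n2 M g"
proof -
  define a b c where "a = (n2 M f)\<^sup>2" and "b = (\<integral>x. f x \<bullet> g x \<partial>M)" and "c = (n2 M g)\<^sup>2"
  have q: "0 \<le> a + 2 * (t * b) + t\<^sup>2 * c" for t
  proof -
    have "(\<integral>x. f x \<bullet> (t *\<^sub>R g x) \<partial>M) = t * b"
      using l2_inner_integrable[OF assms] by (simp add: b_def)
    then have "(n2 M (\<lambda>x. f x + t *\<^sub>R g x))\<^sup>2 = a + 2 * (t * b) + t\<^sup>2 * c"
      using n2_add_power2[OF assms(1) l2_scaleR[OF assms(2), of t]]
      by (simp add: a_def c_def n2_scaleR power_mult_distrib)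
    then show ?thesis by (metis zero_le_power2)
  qed
  have "b\<^sup>2 \<le> a * c"
  proof (cases "c = 0")
    case True
    have "b = 0"
    proof (rule ccontr)
      assume "b \<noteq> 0"
      then show False using q[of "-(a+1) / (2 * b)"] True by (simp add: field_simps)
    qed
    then show ?thesis using True by simp
  next
    case False
    then have "c > 0" using zero_le_power2[of "n2 M g"] by (simp add: c_def)
    have "0 \<le> c * (a + 2 * ((- b / c) * b) + (- b / c)\<^sup>2 * c)"
      using q[of "- b / c"] \<open>c > 0\<close> by (intro mult_nonneg_nonneg) auto
    also have "\<dots> = a * c - b\<^sup>2"
      using \<open>c > 0\<close> by (simp add: field_simps power2_eq_square)
    finally show ?thesis by simp
  qed
  then have "\<bar>b\<bar>\<^sup>2 \<le> (n2 M f * n2 M g)\<^sup>2" by (simp add: a_def c_def power_mult_distrib)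
  then show ?thesis unfolding b_def by (rule power2_le_imp_le) simp
qed

lemma l2_Cauchy_Schwarz_norm:
  fixes f :: "'a \<Rightarrow> 'b::euclidean_space" and g :: "'a \<Rightarrow> 'c::euclidean_space"
  assumes "l2 M f" "l2 M g"
  shows "(\<integral>x. norm (f x) * norm (g x) \<partial>M) \<le> n2 M f * n2 M g"
  using l2_Cauchy_Schwarz[OF l2_norm l2_norm, OF assms] by (simp add: n2_norm)

lemma l2_Cauchy_Schwarz_scaleR:
  fixes f :: "'a \<Rightarrow> real" and g :: "'a \<Rightarrow> 'b::euclidean_space"
  assumes "l2 M f" "l2 M g"
  shows "norm (\<integral>x. f x *\<^sub>R g x \<partial>M) \<le> n2 M f * n2 M g"
proof -
  have "norm (\<integral>x. f x *\<^sub>R g x \<partial>M) \<le> (\<integral>x. norm (f x *\<^sub>R g x) \<partial>M)"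
    by (rule integral_norm_bound)
  also have "\<dots> \<le> n2 M f * n2 M g"
    using l2_Cauchy_Schwarz_norm[OF assms] by simp
  finally show ?thesis .
qed

lemma n2_triangle:
  assumes "l2 M f" "l2 M g"
  shows "n2 M (\<lambda>x. f x + g x) \<le> n2 M f + n2 M g"
proof (rule power2_le_imp_le)
  show "(n2 M (\<lambda>x. f x + g x))\<^sup>2 \<le> (n2 M f + n2 M g)\<^sup>2"
    using n2_add_power2[OF assms] l2_Cauchy_Schwarz[OF assms] by (simp add: power2_sum)
qed simp

lemma n2_triangle_diff:
  assumes "l2 M f" "l2 M g" "l2 M h"
  shows "n2 M (\<lambda>x. f x - h x) \<le> n2 M (\<lambda>x. f x - g x) + n2 M (\<lambda>x. g x - h x)"
  using n2_triangle[OF l2_diff[OF assms(1,2)] l2_diff[OF assms(2,3)]] by simp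

lemma n2_diff_le:
  assumes "l2 M f" "l2 M g"
  shows "\<bar>n2 M f - n2 M g\<bar> \<le> n2 M (\<lambda>x. f x - g x)"
  using n2_triangle[OF l2_diff[OF assms] assms(2)] n2_triangle[OF l2_diff[OF assms(2,1)] assms(1)]
  by (simp add: n2_commute[of M g f] abs_le_iff)

lemma n2_mono:
  fixes f :: "'a \<Rightarrow> 'b::euclidean_space" and g :: "'a \<Rightarrow> 'c::euclidean_space"
  assumes "l2 M f" "AE x in M. norm (g x) \<le> norm (f x)"
  shows "n2 M g \<le> n2 M f"
  unfolding n2_def real_sqrt_le_iff
  using assms by (intro integral_mono_AE') (auto simp: l2_def elim!: eventually_mono intro!: power_mono)

lemma n2_cong_AE:
  assumes "AE x in M. f x = g x" "f \<in> borel_measurable M" "g \<in> borel_measurable M"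
  shows "n2 M f = n2 M g"
  unfolding n2_def
  using assms by (intro arg_cong[where f=sqrt] integral_cong_AE) (auto elim!: eventually_mono)

lemma l2_cong_AE:
  assumes "AE x in M. f x = g x" "l2 M f" "g \<in> borel_measurable M"
  shows "l2 M g"
  by (rule l2_boundI[OF assms(2,3), of 1]) (use assms(1) in \<open>auto elim!: eventually_mono\<close>)

lemma n2_eq_0_AE:
  assumes "l2 M f" "n2 M f = 0" shows "AE x in M. f x = 0"
proof -
  have "(\<integral>x. (norm (f x))\<^sup>2 \<partial>M) = 0"
    using assms(2) by (simp add: n2_def)
  then have "AE x in M. (norm (f x))\<^sup>2 = 0"
    using integral_nonneg_eq_0_iff_AE[of M "\<lambda>x. (norm (f x))\<^sup>2"] assms(1) by (simp add: l2_def)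
  then show ?thesis by simp
qed

lemma n2_tendsto:
  assumes "\<And>n. l2 M (f n)" "l2 M F" "(\<lambda>n. n2 M (\<lambda>x. f n x - F x)) \<longlonglongrightarrow> 0"
  shows "(\<lambda>n. n2 M (f n)) \<longlonglongrightarrow> n2 M F"
proof -
  have "(\<lambda>n. n2 M (f n) - n2 M F) \<longlonglongrightarrow> 0"
    by (rule Lim_null_comparison[OF _ assms(3)]) (use n2_diff_le[OF assms(1,2)] in auto)
  then show ?thesis by (simp add: LIM_zero_iff)
qed

lemma l2_conv_add:
  assumes "\<And>n. l2 M (f n)" "l2 M F" "(\<lambda>n. n2 M (\<lambda>x. f n x - F x)) \<longlonglongrightarrow> 0"
    and "\<And>n. l2 M (g n)" "l2 M G" "(\<lambda>n. n2 M (\<lambda>x. g n x - G x)) \<longlonglongrightarrow> 0"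
  shows "(\<lambda>n. n2 M (\<lambda>x. (f n x + g n x) - (F x + G x))) \<longlonglongrightarrow> 0"
proof (rule Lim_null_comparison)
  show "(\<lambda>n. n2 M (\<lambda>x. f n x - F x) + n2 M (\<lambda>x. g n x - G x)) \<longlonglongrightarrow> 0"
    using tendsto_add[OF assms(3,6)] by simp
  have "n2 M (\<lambda>x. (f n x + g n x) - (F x + G x)) \<le> n2 M (\<lambda>x. f n x - F x) + n2 M (\<lambda>x. g n x - G x)" for n
    using n2_triangle[OF l2_diff[OF assms(1,2), of n] l2_diff[OF assms(4,5), of n]]
    by (simp add: algebra_simps)
  then show "\<forall>\<^sub>F n in sequentially. norm (n2 M (\<lambda>x. (f n x + g n x) - (F x + G x)))
      \<le> n2 M (\<lambda>x. f n x - F x) + n2 M (\<lambda>x. g n x - G x)"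
    by simp
qed

lemma l2_tendsto_scaleR:
  fixes f :: "nat \<Rightarrow> 'a \<Rightarrow> 'b::euclidean_space" and g :: "'a \<Rightarrow> real"
  assumes "\<And>n. l2 M (f n)" "l2 M F" "(\<lambda>n. n2 M (\<lambda>x. f n x - F x)) \<longlonglongrightarrow> 0"
    and "l2 M g"
  shows "(\<lambda>n. \<integral>x. g x *\<^sub>R f n x \<partial>M) \<longlonglongrightarrow> (\<integral>x. g x *\<^sub>R F x \<partial>M)"
proof -
  have "(\<lambda>n. (\<integral>x. g x *\<^sub>R f n x \<partial>M) - (\<integral>x. g x *\<^sub>R F x \<partial>M)) \<longlonglongrightarrow> 0"
  proof (rule Lim_null_comparison)
    show "(\<lambda>n. n2 M g * n2 M (\<lambda>x. f n x - F x)) \<longlonglongrightarrow> 0"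
      using tendsto_mult_right_zero[OF assms(3)] .
    have "(\<integral>x. g x *\<^sub>R f n x \<partial>M) - (\<integral>x. g x *\<^sub>R F x \<partial>M) = (\<integral>x. g x *\<^sub>R (f n x - F x) \<partial>M)" for n
      using l2_scaleR_integrable[OF assms(4,1), of n] l2_scaleR_integrable[OF assms(4,2)]
      by (simp add: scaleR_diff_right)
    then show "\<forall>\<^sub>F n in sequentially. norm ((\<integral>x. g x *\<^sub>R f n x \<partial>M) - (\<integral>x. g x *\<^sub>R F x \<partial>M))
        \<le> n2 M g * n2 M (\<lambda>x. f n x - F x)"
      using l2_Cauchy_Schwarz_scaleR[OF assms(4) l2_diff[OF assms(1,2)]] by simp
  qed
  then show ?thesis by (simp add: LIM_zero_iff)
qed

text \<open>The limit inherits the bound by \<open>G\<close>, so \<open>4 |G|\<^sup>2\<close> is an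
  integrable majorant of the squared differences.\<close>

lemma l2_dominated:
  fixes f :: "nat \<Rightarrow> 'a \<Rightarrow> 'b::euclidean_space" and G :: "'a \<Rightarrow> 'c::euclidean_space"
  assumes "\<And>n. f n \<in> borel_measurable M" "F \<in> borel_measurable M" "l2 M G"
    and lim: "AE x in M. (\<lambda>n. f n x) \<longlonglongrightarrow> F x"
    and bnd: "\<And>n. AE x in M. norm (f n x) \<le> norm (G x)"
  shows "l2 M F" "\<And>n. l2 M (f n)" "(\<lambda>n. n2 M (\<lambda>x. f n x - F x)) \<longlonglongrightarrow> 0"
proof -
  have "AE x in M. \<forall>n. norm (f n x) \<le> norm (G x)"
    using bnd by (simp add: AE_all_countable)
  with lim have FG: "AE x in M. norm (F x) \<le> norm (G x)"
    by eventually_elim (auto intro!: tendsto_upperbound[OF tendsto_norm])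
  show lF: "l2 M F" by (rule l2_boundI[OF assms(3,2), of 1]) (use FG in simp)
  show lf: "l2 M (f n)" for n by (rule l2_boundI[OF assms(3,1), where C=1]) (use bnd in simp)
  have "(\<lambda>n. \<integral>x. (norm (f n x - F x))\<^sup>2 \<partial>M) \<longlonglongrightarrow> (\<integral>x. 0 \<partial>M)"
  proof (rule integral_dominated_convergence[where w="\<lambda>x. 4 * (norm (G x))\<^sup>2"])
    show "integrable M (\<lambda>x. 4 * (norm (G x))\<^sup>2)"
      using assms(3) by (simp add: l2_def)
    show "AE x in M. (\<lambda>n. (norm (f n x - F x))\<^sup>2) \<longlonglongrightarrow> 0"
      using lim
    proof eventually_elim
      case (elim x)
      have "(\<lambda>n. norm (f n x - F x)) \<longlonglongrightarrow> 0"
        using elim by (simp add: tendsto_norm_zero_iff LIM_zero)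
      then show ?case by (auto dest: tendsto_power[where n=2])
    qed
    show "AE x in M. norm ((norm (f n x - F x))\<^sup>2) \<le> 4 * (norm (G x))\<^sup>2" for n
      using FG bnd[of n]
    proof eventually_elim
      case (elim x)
      have "norm (f n x - F x) \<le> 2 * norm (G x)"
        using norm_triangle_ineq4[of "f n x" "F x"] elim by linarith
      then have "(norm (f n x - F x))\<^sup>2 \<le> (2 * norm (G x))\<^sup>2" by (intro power_mono) auto
      then show ?case by (simp add: power_mult_distrib)
    qed
  qed (use assms(1,2) in measurable)
  then show "(\<lambda>n. n2 M (\<lambda>x. f n x - F x)) \<longlonglongrightarrow> 0"
    unfolding n2_def using tendsto_real_sqrt by fastforce
qed

text \<open>Supplies the pointwise convergence needed when a nonlinear function is applied to a
  sequence that converges only in norm.\<close>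

lemma l2_conv_AE_subseq:
  assumes "\<And>n. l2 M (f n)" "l2 M F" "(\<lambda>n. n2 M (\<lambda>x. f n x - F x)) \<longlonglongrightarrow> 0"
  obtains r where "strict_mono (r :: nat \<Rightarrow> nat)" "AE x in M. (\<lambda>n. f (r n) x) \<longlonglongrightarrow> F x"
proof -
  have "(\<lambda>n. (n2 M (\<lambda>x. f n x - F x))\<^sup>2) \<longlonglongrightarrow> 0"
    using tendsto_power[OF assms(3), of 2] by simp
  then have "(\<lambda>n. \<integral>x. norm ((norm (f n x - F x))\<^sup>2) \<partial>M) \<longlonglongrightarrow> 0"
    by (simp add: n2_power2)
  moreover have "integrable M (\<lambda>x. (norm (f n x - F x))\<^sup>2)" for n
    using l2_diff[OF assms(1,2)] by (simp add: l2_def)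
  ultimately obtain r where r: "strict_mono r" "AE x in M. (\<lambda>n. (norm (f (r n) x - F x))\<^sup>2) \<longlonglongrightarrow> 0"
    using tendsto_L1_AE_subseq[of M "\<lambda>n x. (norm (f n x - F x))\<^sup>2"] by blast
  have "AE x in M. (\<lambda>n. f (r n) x) \<longlonglongrightarrow> F x"
    using r(2)
  proof eventually_elim
    case (elim x)
    have "(\<lambda>n. norm (f (r n) x - F x)) \<longlonglongrightarrow> 0"
      using tendsto_real_sqrt[OF elim] by simp
    then show ?case by (simp add: tendsto_norm_zero_iff LIM_zero_iff)
  qed
  with r(1) that show ?thesis by blast
qed

text \<open>Along a subsequence with \<open>\<parallel>f (k+1) - f k\<parallel>\<^sup>2 \<le> 4\<^sup>-\<^sup>k\<close> the weighted series
  \<open>\<Sum>k. 2\<^sup>k \<bar>f (k+1) - f k\<bar>\<^sup>2\<close> is integrable, which forces pointwise convergence.\<close>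

lemma l2_complete:
  fixes f :: "nat \<Rightarrow> 'a \<Rightarrow> 'b::euclidean_space"
  assumes l: "\<And>n. l2 M (f n)"
    and C: "\<And>e. e > 0 \<Longrightarrow> \<exists>N. \<forall>m\<ge>N. \<forall>n\<ge>N. n2 M (\<lambda>x. f m x - f n x) < e"
  obtains F where "l2 M F" "(\<lambda>n. n2 M (\<lambda>x. f n x - F x)) \<longlonglongrightarrow> 0"
proof -
  have mf [measurable]: "f n \<in> borel_measurable M" for n using l by (simp add: l2_def)
  define N where "N k = (SOME N. \<forall>m\<ge>N. \<forall>n\<ge>N. n2 M (\<lambda>x. f m x - f n x) < 1 / 2 ^ k)" for k :: nat
  have N: "n2 M (\<lambda>x. f m x - f n x) < 1 / 2 ^ k" if "m \<ge> N k" "n \<ge> N k" for m n k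
    using someI_ex[OF C[of "1 / 2 ^ k"]] that unfolding N_def by auto
  \<comment> \<open>Summing the \<open>N j\<close> makes the indices nondecreasing in
    \<open>k\<close> while keeping them at least \<open>N k\<close>.\<close>
  define s where "s k = (\<Sum>j\<le>k. N j) + k" for k
  have sN: "s k \<ge> N k" for k unfolding s_def by (simp add: trans_le_add1 member_le_sum)
  have ss: "s (Suc k) \<ge> s k" for k unfolding s_def by simp
  define d where "d k x = 2 ^ k * (norm (f (s (Suc k)) x - f (s k) x))\<^sup>2" for k x
  have [measurable]: "d k \<in> borel_measurable M" for k unfolding d_def by measurable
  have dI: "integrable M (d k)" for k
    using l2_diff[OF l l, of "s (Suc k)" "s k"] unfolding d_def l2_def by simp
  have dnn: "d k x \<ge> 0" for k x by (simp add: d_def)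
  have dint: "(\<integral>x. d k x \<partial>M) \<le> (1/2) ^ k" for k
  proof -
    have "n2 M (\<lambda>x. f (s (Suc k)) x - f (s k) x) \<le> 1 / 2 ^ k"
      using N[of k "s (Suc k)" "s k"] sN[of k] ss[of k] by (simp add: less_imp_le)
    then have "(n2 M (\<lambda>x. f (s (Suc k)) x - f (s k) x))\<^sup>2 \<le> (1 / 2 ^ k)\<^sup>2"
      by (intro power_mono) auto
    then have "2 ^ k * (n2 M (\<lambda>x. f (s (Suc k)) x - f (s k) x))\<^sup>2 \<le> 2 ^ k * (1 / 2 ^ k)\<^sup>2"
      by (intro mult_left_mono) auto
    also have "\<dots> = (1/2) ^ k" by (simp add: power2_eq_square field_simps)
    finally have "2 ^ k * (\<integral>x. (norm (f (s (Suc k)) x - f (s k) x))\<^sup>2 \<partial>M) \<le> (1/2) ^ k"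
      by (simp only: n2_power2)
    then have "(\<integral>x. 2 ^ k * (norm (f (s (Suc k)) x - f (s k) x))\<^sup>2 \<partial>M) \<le> (1/2) ^ k" by simp
    then show ?thesis by (simp only: d_def[symmetric])
  qed
  have "(\<integral>\<^sup>+x. (\<Sum>k. ennreal (d k x)) \<partial>M) = (\<Sum>k. \<integral>\<^sup>+x. ennreal (d k x) \<partial>M)"
    by (rule nn_integral_suminf) measurable
  also have "\<dots> \<le> (\<Sum>k. ennreal ((1/2) ^ k))"
  proof (rule suminf_le)
    show "(\<integral>\<^sup>+x. ennreal (d k x) \<partial>M) \<le> ennreal ((1/2) ^ k)" for k
      using dint[of k] by (subst nn_integral_eq_integral[OF dI]) (simp_all add: dnn ennreal_leI)
  qed auto
  also have "\<dots> = ennreal (\<Sum>k. (1/2) ^ k)" by (rule suminf_ennreal2) auto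
  also have "\<dots> < \<infinity>" by simp
  finally have "AE x in M. (\<Sum>k. ennreal (d k x)) \<noteq> \<infinity>"
    by (intro nn_integral_PInf_AE) auto
  then have AEc: "AE x in M. convergent (\<lambda>k. f (s k) x)"
  proof eventually_elim
    case (elim x)
    have sd: "summable (\<lambda>k. d k x)"
      by (rule summable_suminf_not_top) (use elim in \<open>auto simp: d_def\<close>)
    define S where "S = (\<Sum>k. d k x)"
    have dS: "d k x \<le> S" for k
      using sum_le_suminf[OF sd, of "{k}"] by (auto simp: S_def d_def)
    have b: "norm (f (s (Suc k)) x - f (s k) x) \<le> sqrt S * (sqrt (1/2)) ^ k" for k
    proof -
      have "(norm (f (s (Suc k)) x - f (s k) x))\<^sup>2 \<le> S * (1/2) ^ k"
        using dS[of k] by (simp add: d_def field_simps)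
      then have "sqrt ((norm (f (s (Suc k)) x - f (s k) x))\<^sup>2) \<le> sqrt (S * (1/2) ^ k)"
        by (rule real_sqrt_le_mono)
      then show ?thesis by (simp add: real_sqrt_mult real_sqrt_power)
    qed
    have "summable (\<lambda>k. norm (f (s (Suc k)) x - f (s k) x))"
    proof (rule summable_comparison_test')
      show "summable (\<lambda>k. sqrt S * (sqrt (1/2)) ^ k)"
        by (intro summable_mult summable_geometric) (auto simp: real_less_lsqrt)
    qed (use b in auto)
    then have "summable (\<lambda>k. f (s (Suc k)) x - f (s k) x)" by (rule summable_norm_cancel)
    then have "convergent (\<lambda>n. \<Sum>k<n. f (s (Suc k)) x - f (s k) x)" by (simp add: summable_iff_convergent)
    then have "convergent (\<lambda>n. f (s n) x - f (s 0) x)"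
      by (simp add: sum_lessThan_telescope[of "\<lambda>k. f (s k) x"])
    then have "convergent (\<lambda>n. (f (s n) x - f (s 0) x) + f (s 0) x)"
      by (intro convergent_add convergent_const)
    then show ?case by simp
  qed
  define F where "F x = lim (\<lambda>k. f (s k) x)" for x
  have mF [measurable]: "F \<in> borel_measurable M"
    unfolding F_def[abs_def] by (rule borel_measurable_lim_metric) measurable
  have lim: "AE x in M. (\<lambda>k. f (s k) x) \<longlonglongrightarrow> F x"
    using AEc by eventually_elim (simp add: F_def convergent_LIMSEQ_iff)
  \<comment> \<open>Fatou's lemma along the subsequence turns the Cauchy bound into a bound on the
    distance to \<open>F\<close>. With \<open>n = N 0\<close> it also shows that \<open>F\<close>
    itself is square-integrable.\<close>
  have key: "l2 M (\<lambda>x. f n x - F x) \<and> n2 M (\<lambda>x. f n x - F x) \<le> 1 / 2 ^ k" if "n \<ge> N k" for n k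
  proof -
    have "(\<integral>\<^sup>+x. ennreal ((norm (f n x - F x))\<^sup>2) \<partial>M)
        = (\<integral>\<^sup>+x. liminf (\<lambda>j. ennreal ((norm (f n x - f (s j) x))\<^sup>2)) \<partial>M)"
    proof (rule nn_integral_cong_AE)
      show "AE x in M. ennreal ((norm (f n x - F x))\<^sup>2) = liminf (\<lambda>j. ennreal ((norm (f n x - f (s j) x))\<^sup>2))"
        using lim
      proof eventually_elim
        case (elim x)
        have "(\<lambda>j. ennreal ((norm (f n x - f (s j) x))\<^sup>2)) \<longlonglongrightarrow> ennreal ((norm (f n x - F x))\<^sup>2)"
          by (intro tendsto_ennrealI tendsto_intros elim)
        then show ?case by (rule lim_imp_Liminf[OF trivial_limit_sequentially, symmetric])
      qed
    qed
    also have "\<dots> \<le> liminf (\<lambda>j. \<integral>\<^sup>+x. ennreal ((norm (f n x - f (s j) x))\<^sup>2) \<partial>M)"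
      by (rule nn_integral_liminf) measurable
    also have "\<dots> \<le> ennreal ((1 / 2 ^ k)\<^sup>2)"
    proof -
      have "(\<integral>\<^sup>+x. ennreal ((norm (f n x - f (s j) x))\<^sup>2) \<partial>M) \<le> ennreal ((1 / 2 ^ k)\<^sup>2)" if "j \<ge> k" for j
      proof -
        have "s j \<ge> N k" using sN[of k] lift_Suc_mono_le[of s, OF ss that] by linarith
        then have "n2 M (\<lambda>x. f n x - f (s j) x) \<le> 1 / 2 ^ k"
          using N[OF \<open>n \<ge> N k\<close>, of "s j"] by simp
        then have "(n2 M (\<lambda>x. f n x - f (s j) x))\<^sup>2 \<le> (1 / 2 ^ k)\<^sup>2"
          by (intro power_mono) auto
        then show ?thesis
          using l2_diff[OF l l, of n "s j"] unfolding n2_power2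
          by (subst nn_integral_eq_integral) (auto simp: l2_def)
      qed
      then have "\<forall>\<^sub>F j in sequentially. (\<integral>\<^sup>+x. ennreal ((norm (f n x - f (s j) x))\<^sup>2) \<partial>M) \<le> ennreal ((1 / 2 ^ k)\<^sup>2)"
        by (auto simp: eventually_sequentially)
      then have "limsup (\<lambda>j. \<integral>\<^sup>+x. ennreal ((norm (f n x - f (s j) x))\<^sup>2) \<partial>M) \<le> ennreal ((1 / 2 ^ k)\<^sup>2)"
        by (rule Limsup_bounded)
      then show ?thesis
        using Liminf_le_Limsup[of sequentially] by (meson order_trans trivial_limit_sequentially)
    qed
    finally have le: "(\<integral>\<^sup>+x. ennreal ((norm (f n x - F x))\<^sup>2) \<partial>M) \<le> ennreal ((1 / 2 ^ k)\<^sup>2)" .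
    have int: "integrable M (\<lambda>x. (norm (f n x - F x))\<^sup>2)"
      by (rule integrableI_bounded) (use le in \<open>auto intro: le_less_trans\<close>)
    then have "(\<integral>x. (norm (f n x - F x))\<^sup>2 \<partial>M) \<le> (1 / 2 ^ k)\<^sup>2"
      using le by (subst (asm) nn_integral_eq_integral) auto
    then have "(n2 M (\<lambda>x. f n x - F x))\<^sup>2 \<le> (1 / 2 ^ k)\<^sup>2" by (simp add: n2_power2)
    then have "n2 M (\<lambda>x. f n x - F x) \<le> 1 / 2 ^ k" by (rule power2_le_imp_le) simp
    then show ?thesis using int by (simp add: l2_def)
  qed
  have "l2 M F"
    using l2_diff[OF l[of "N 0"] conjunct1[OF key[of 0 "N 0"]]] by simp
  moreover have "(\<lambda>n. n2 M (\<lambda>x. f n x - F x)) \<longlonglongrightarrow> 0"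
  proof (rule LIMSEQ_I)
    fix e :: real assume "e > 0"
    then obtain k where "(1/2) ^ k < e" using real_arch_pow_inv[of e "1/2"] by auto
    then have "\<forall>n\<ge>N k. norm (n2 M (\<lambda>x. f n x - F x) - 0) < e"
      using key[of k] by (force simp: power_divide)
    then show "\<exists>no. \<forall>n\<ge>no. norm (n2 M (\<lambda>x. f n x - F x) - 0) < e" by blast
  qed
  ultimately show ?thesis using that by blast
qed

subsection \<open>Smooth functions\<close>

lemma C_k_SucI:
  assumes "\<And>x. (f has_derivative D x) (at x)" "\<And>i. i \<in> Basis \<Longrightarrow> C_k k (\<lambda>x. D x i)"
  shows "C_k (Suc k) f"
proof -
  have "frechet_derivative f (at x) = D x" for x
    using frechet_derivative_at[OF assms(1)] by simp
  then show ?thesis using assms by (auto simp: differentiable_def)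
qed

lemma C_k_SucD:
  assumes "C_k (Suc k) f"
  shows "(f has_derivative frechet_derivative f (at x)) (at x)"
    and "i \<in> Basis \<Longrightarrow> C_k k (\<lambda>x. frechet_derivative f (at x) i)"
  using assms frechet_derivative_works by auto

lemma C_k_Suc_imp: "C_k (Suc k) f \<Longrightarrow> C_k k f"
proof (induction k arbitrary: f)
  case 0
  then have "\<And>x. isCont f x"
    using C_k_SucD(1)[OF 0] has_derivative_continuous by blast
  then show ?case by (simp add: continuous_at_imp_continuous_on)
next
  case (Suc k)
  show ?case
    by (rule C_k_SucI[OF C_k_SucD(1)[OF Suc.prems]]) (use Suc.IH C_k_SucD(2)[OF Suc.prems] in blast)
qed

lemma C_k_const: "C_k k (\<lambda>x. c)"
proof (induction k arbitrary: c)
  case (Suc k)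
  show ?case by (rule C_k_SucI[where D="\<lambda>x h. 0"]) (use Suc in \<open>auto simp del: C_k.simps\<close>)
qed simp

lemma C_k_add: "C_k k f \<Longrightarrow> C_k k g \<Longrightarrow> C_k k (\<lambda>x. f x + g x)"
proof (induction k arbitrary: f g)
  case 0 then show ?case by (auto intro: continuous_intros)
next
  case (Suc k)
  show ?case
    by (rule C_k_SucI[OF has_derivative_add[OF C_k_SucD(1)[OF Suc.prems(1)] C_k_SucD(1)[OF Suc.prems(2)]]])
      (use Suc.IH C_k_SucD(2)[OF Suc.prems(1)] C_k_SucD(2)[OF Suc.prems(2)] in blast)
qed

lemma C_k_mult: "C_k k f \<Longrightarrow> C_k k g \<Longrightarrow> C_k k (\<lambda>x. f x * g x)"
proof (induction k arbitrary: f g)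
  case 0 then show ?case by (auto intro: continuous_intros)
next
  case (Suc k)
  show ?case
  proof (rule C_k_SucI[OF has_derivative_mult[OF C_k_SucD(1)[OF Suc.prems(1)] C_k_SucD(1)[OF Suc.prems(2)]]])
    fix i :: 'a assume i: "i \<in> Basis"
    show "C_k k (\<lambda>x. f x * frechet_derivative g (at x) i + frechet_derivative f (at x) i * g x)"
      by (intro C_k_add Suc.IH C_k_SucD(2)[OF Suc.prems(1) i] C_k_SucD(2)[OF Suc.prems(2) i]
            C_k_Suc_imp[OF Suc.prems(1)] C_k_Suc_imp[OF Suc.prems(2)])
  qed
qed

lemma C_k_cmult: "C_k k f \<Longrightarrow> C_k k (\<lambda>x. c * f x)"
  by (rule C_k_mult[OF C_k_const])

lemma C_k_sum: "(\<And>j. j \<in> I \<Longrightarrow> C_k k (f j)) \<Longrightarrow> C_k k (\<lambda>x. \<Sum>j\<in>I. f j x)"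
  by (induction I rule: infinite_finite_induct) (auto intro: C_k_add C_k_const)

lemma C_k_prod: "(\<And>j. j \<in> I \<Longrightarrow> C_k k (f j)) \<Longrightarrow> C_k k (\<lambda>x. \<Prod>j\<in>I. f j x)"
  by (induction I rule: infinite_finite_induct) (auto intro: C_k_mult C_k_const)

lemma C_k_inner: "C_k k (\<lambda>x. x \<bullet> b)"
proof (cases k)
  case 0 then show ?thesis by (auto intro: continuous_intros)
next
  case (Suc j)
  show ?thesis unfolding Suc
    by (rule C_k_SucI[where D="\<lambda>x h. h \<bullet> b"]) (auto intro!: derivative_eq_intros C_k_const)
qed

lemma C_k_norm_sq: "C_k k (\<lambda>x::'a::euclidean_space. (norm x)\<^sup>2)"
proof -
  have "(norm x)\<^sup>2 = (\<Sum>i\<in>Basis. (x \<bullet> i) * (x \<bullet> i))" for x :: 'a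
    by (subst euclidean_inner[symmetric]) (simp add: power2_norm_eq_inner)
  then show ?thesis
    by (simp add: C_k_sum C_k_mult C_k_inner)
qed

lemma C_k_comp:
  fixes h :: "real \<Rightarrow> real"
  shows "C_k k h \<Longrightarrow> C_k k f \<Longrightarrow> C_k k (\<lambda>x. h (f x))"
proof (induction k arbitrary: h f)
  case 0 then show ?case by (auto intro: continuous_on_compose2[of UNIV h])
next
  case (Suc k)
  \<comment> \<open>A linear map of the reals is multiplication by its value at 1; this writes the
    chain rule as a product of two functions, to which \<open>C_k_mult\<close> and the induction
    hypothesis apply.\<close>
  have lin: "frechet_derivative h (at t) v = frechet_derivative h (at t) 1 * v" for t v
    using linear_cmul[OF has_derivative_linear[OF C_k_SucD(1)[OF Suc.prems(1)]], of t v 1]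
    by (simp add: mult.commute[of v])
  have "((\<lambda>x. h (f x)) has_derivative
      (\<lambda>v. frechet_derivative h (at (f x)) 1 * frechet_derivative f (at x) v)) (at x)" for x
    using has_derivative_compose[OF C_k_SucD(1)[OF Suc.prems(2)] C_k_SucD(1)[OF Suc.prems(1)]]
    by (subst (asm) lin)
  then show ?case
  proof (rule C_k_SucI)
    fix i :: 'a assume i: "i \<in> Basis"
    show "C_k k (\<lambda>x. frechet_derivative h (at (f x)) 1 * frechet_derivative f (at x) i)"
      by (intro C_k_mult Suc.IH[of "\<lambda>t. frechet_derivative h (at t) 1" f] C_k_SucD(2)[OF Suc.prems(1)]
          C_k_SucD(2)[OF Suc.prems(2) i] C_k_Suc_imp[OF Suc.prems(2)]) auto
  qed
qed

lemma C_k_affine: "C_k k f \<Longrightarrow> C_k k (\<lambda>x. f (c *\<^sub>R x + a))"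
proof (induction k arbitrary: f)
  case 0 then show ?case by (auto intro!: continuous_on_compose2[of UNIV f] continuous_intros)
next
  case (Suc k)
  have "((\<lambda>x. f (c *\<^sub>R x + a)) has_derivative (\<lambda>v. c * frechet_derivative f (at (c *\<^sub>R x + a)) v)) (at x)" for x
  proof -
    have "((\<lambda>x. c *\<^sub>R x + a) has_derivative (\<lambda>v. c *\<^sub>R v)) (at x)"
      by (auto intro!: derivative_eq_intros)
    from has_derivative_compose[OF this C_k_SucD(1)[OF Suc.prems]]
    show ?thesis
      by (simp add: linear_cmul[OF has_derivative_linear[OF C_k_SucD(1)[OF Suc.prems]]])
  qed
  then show ?case
    by (rule C_k_SucI) (intro C_k_cmult Suc.IH[of "\<lambda>x. frechet_derivative f (at x) i" for i] C_k_SucD(2)[OF Suc.prems])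
qed

lemma C_k_primitive:
  fixes B b :: "real \<Rightarrow> real"
  assumes "\<And>t. (B has_real_derivative b t) (at t)" "\<And>k. C_k k b"
  shows "C_k k B"
proof -
  have "C_k (Suc k) B"
    by (rule C_k_SucI[where D="\<lambda>t v. b t * v"])
      (use assms in \<open>auto simp: has_field_derivative_def intro!: C_k_mult C_k_const\<close>)
  then show ?thesis by (rule C_k_Suc_imp)
qed

subsection \<open>Gradients\<close>

lemma gradient_inner:
  assumes "f differentiable (at x)"
  shows "gradient f x \<bullet> v = frechet_derivative f (at x) v"
proof -
  interpret linear "frechet_derivative f (at x)"
    using linear_frechet_derivative[OF assms] .
  have "frechet_derivative f (at x) v = frechet_derivative f (at x) (\<Sum>i\<in>Basis. (v \<bullet> i) *\<^sub>R i)"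
    by (simp add: euclidean_representation)
  also have "\<dots> = (\<Sum>i\<in>Basis. (v \<bullet> i) * frechet_derivative f (at x) i)"
    by (simp add: sum scale)
  also have "\<dots> = gradient f x \<bullet> v"
    by (simp add: gradient_def inner_sum_left inner_commute[of v] mult.commute)
  finally show ?thesis by simp
qed

lemma has_derivative_gradient:
  assumes "f differentiable (at x)"
  shows "(f has_derivative (\<lambda>v. gradient f x \<bullet> v)) (at x)"
  using assms frechet_derivative_works[of f "at x"] by (simp add: gradient_inner)

lemma gradient_eqI:
  assumes "(f has_derivative (\<lambda>v. g \<bullet> v)) (at x)"
  shows "gradient f x = g"
proof -
  have "frechet_derivative f (at x) = (\<lambda>v. g \<bullet> v)"
    using frechet_derivative_at[OF assms] by simp
  then show ?thesis by (simp add: gradient_def euclidean_representation)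
qed

lemma C_1_differentiable: "C_k 1 f \<Longrightarrow> f differentiable (at x)"
  by simp

lemma gradient_zero: "gradient (\<lambda>x. 0) x = 0"
  by (rule gradient_eqI) simp

lemma gradient_add:
  assumes "f differentiable (at x)" "g differentiable (at x)"
  shows "gradient (\<lambda>x. f x + g x) x = gradient f x + gradient g x"
  by (rule gradient_eqI)
    (use has_derivative_add[OF assms[THEN has_derivative_gradient]] in \<open>simp add: inner_add_left\<close>)

lemma gradient_cmult:
  assumes "f differentiable (at x)"
  shows "gradient (\<lambda>x. c * f x) x = c *\<^sub>R gradient f x"
  by (rule gradient_eqI)
    (use has_derivative_mult_right[OF has_derivative_gradient[OF assms], of c] in simp)

lemma gradient_sum:
  assumes "\<And>j. j \<in> I \<Longrightarrow> f j differentiable (at x)"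
  shows "gradient (\<lambda>x. \<Sum>j\<in>I. f j x) x = (\<Sum>j\<in>I. gradient (f j) x)"
  by (rule gradient_eqI)
    (use has_derivative_sum[of I f "\<lambda>j v. gradient (f j) x \<bullet> v" "at x"] has_derivative_gradient[OF assms]
      in \<open>simp add: inner_sum_left\<close>)

lemma gradient_mult:
  assumes "f differentiable (at x)" "g differentiable (at x)"
  shows "gradient (\<lambda>x. f x * g x) x = f x *\<^sub>R gradient g x + g x *\<^sub>R gradient f x"
  by (rule gradient_eqI)
    (use has_derivative_mult[OF assms[THEN has_derivative_gradient]] in \<open>simp add: inner_add_left mult.commute\<close>)

lemma gradient_comp:
  assumes "f differentiable (at x)" "(h has_real_derivative d) (at (f x))"
  shows "gradient (\<lambda>x. h (f x)) x = d *\<^sub>R gradient f x"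
  by (rule gradient_eqI)
    (use has_derivative_compose[OF has_derivative_gradient[OF assms(1)]
        assms(2)[unfolded has_field_derivative_def]] in simp)

lemma gradient_affine:
  assumes "f differentiable (at (c *\<^sub>R x + a))"
  shows "gradient (\<lambda>x. f (c *\<^sub>R x + a)) x = c *\<^sub>R gradient f (c *\<^sub>R x + a)"
proof (rule gradient_eqI)
  have "((\<lambda>x. c *\<^sub>R x + a) has_derivative (\<lambda>v. c *\<^sub>R v)) (at x)"
    by (auto intro!: derivative_eq_intros)
  from has_derivative_compose[OF this has_derivative_gradient[OF assms]]
  show "((\<lambda>x. f (c *\<^sub>R x + a)) has_derivative (\<lambda>v. (c *\<^sub>R gradient f (c *\<^sub>R x + a)) \<bullet> v)) (at x)"
    by simp
qed

lemma gradient_norm_sq: "gradient (\<lambda>x. (norm x)\<^sup>2) x = 2 *\<^sub>R x"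
  by (rule gradient_eqI)
    (auto simp: power2_norm_eq_inner intro!: derivative_eq_intros simp: inner_commute)

lemma continuous_gradient:
  assumes "C_k 1 f" shows "continuous_on UNIV (gradient f)"
  unfolding gradient_def[abs_def] using assms by (auto intro!: continuous_intros)

lemma gradient_cong_open:
  assumes "open S" "x \<in> S" "\<And>y. y \<in> S \<Longrightarrow> f y = g y"
  shows "gradient f x = gradient g x"
proof -
  have "(f has_derivative D) (at x) \<longleftrightarrow> (g has_derivative D) (at x)" for D
    using assms has_derivative_transform_within_open[of _ _ x UNIV S] by metis
  then show ?thesis by (simp add: gradient_def frechet_derivative_def)
qed

subsection \<open>A smooth step\<close>

text \<open>The functions \<open>exp (- 1 / t) / t ^ m\<close>, extended by 0. All exponents
  \<open>m\<close> are treated at once because the derivative of \<open>flat m\<close> is a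
  combination of \<open>flat (m + 1)\<close> and \<open>flat (m + 2)\<close>, which makes the
  induction on the order of smoothness close.\<close>

definition flat :: "nat \<Rightarrow> real \<Rightarrow> real" where
  "flat m t = (if t \<le> 0 then 0 else exp (- (1 / t)) / t ^ m)"

lemma power_le_fact_exp: "x \<ge> 0 \<Longrightarrow> x ^ n \<le> fact n * exp (x::real)"
proof -
  assume "x \<ge> 0"
  have "(\<Sum>k\<in>{n}. x ^ k /\<^sub>R fact k) \<le> (\<Sum>k. x ^ k /\<^sub>R fact k)"
    using \<open>x \<ge> 0\<close> by (intro sum_le_suminf summable_exp_generic) auto
  then show ?thesis by (simp add: exp_def field_simps)
qed

text \<open>The exponential beats every power, by one term of its series at \<open>1 / t\<close>. A
  quadratic bound is what makes the difference quotient at 0 vanish.\<close>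

lemma flat_le: "t \<ge> 0 \<Longrightarrow> \<bar>flat m t\<bar> \<le> fact (m + 2) * t\<^sup>2"
proof (cases "t = 0")
  case False
  assume "t \<ge> 0"
  with False have t: "t > 0" by simp
  have "(1/t) ^ (m + 2) \<le> fact (m + 2) * exp (1 / t)"
    using power_le_fact_exp[of "1/t" "m+2"] t by simp
  then have "1 \<le> fact (m + 2) * exp (1 / t) * t ^ (m + 2)"
    using t by (simp add: field_simps power_divide)
  then show ?thesis using t by (simp add: flat_def exp_minus field_simps power_add power2_eq_square)
qed (simp add: flat_def)

lemma flat_deriv: "(flat m has_real_derivative (flat (m + 2) t - m * flat (m + 1) t)) (at t)"
proof (cases "t = 0")
  case True
  have "((\<lambda>s. (flat m s - flat m 0) / (s - 0)) \<longlongrightarrow> 0) (at 0)"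
  proof (rule Lim_null_comparison)
    show "((\<lambda>s::real. fact (m + 2) * \<bar>s\<bar>) \<longlongrightarrow> 0) (at 0)"
      by (rule tendsto_eq_intros refl | simp del: fact_Suc)+
    have "norm ((flat m s - flat m 0) / (s - 0)) \<le> fact (m + 2) * \<bar>s\<bar>" for s :: real
    proof (cases "s > 0")
      case True
      then show ?thesis using flat_le[of s m]
        by (simp add: flat_def[of m 0] field_simps power2_eq_square)
    next
      case False
      then have "norm ((flat m s - flat m 0) / (s - 0)) = 0" by (simp add: flat_def)
      also have "0 \<le> fact (m + 2) * \<bar>s\<bar>" by (intro mult_nonneg_nonneg) auto
      finally show ?thesis .
    qed
    then show "\<forall>\<^sub>F s in at 0. norm ((flat m s - flat m 0) / (s - 0)) \<le> fact (m + 2) * \<bar>s\<bar>"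
      by simp
  qed
  then show ?thesis using True by (simp add: has_field_derivative_iff flat_def)
next
  case False
  show ?thesis
  proof (cases "t > 0")
    case True
    have "((\<lambda>t. exp (- (1 / t)) / t ^ m) has_real_derivative (flat (m + 2) t - m * flat (m + 1) t)) (at t)"
    proof -
      have e: "((\<lambda>t. exp (- (1 / t))) has_real_derivative exp (- (1 / t)) * (1 / t\<^sup>2)) (at t)"
        using True by (auto intro!: derivative_eq_intros simp: power2_eq_square)
      have p: "((\<lambda>t. t ^ m) has_real_derivative m * t ^ (m - 1)) (at t)"
        using DERIV_pow[of m t] by simp
      have "(exp (- (1 / t)) * (1 / t\<^sup>2) * t ^ m - exp (- (1 / t)) * (m * t ^ (m - 1))) / (t ^ m * t ^ m)
          = flat (m + 2) t - m * flat (m + 1) t"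
        using True by (cases m) (simp_all add: flat_def divide_simps power2_eq_square, simp_all add: algebra_simps)
      with DERIV_divide[OF e p] True show ?thesis by simp
    qed
    then show ?thesis
      by (rule has_field_derivative_transform_within_open[where S="{0<..}"]) (use True in \<open>auto simp: flat_def\<close>)
  next
    case False
    with \<open>t \<noteq> 0\<close> have "t < 0" by simp
    have "((\<lambda>t. 0) has_real_derivative 0) (at t)" by simp
    then have "(flat m has_real_derivative 0) (at t)"
      by (rule has_field_derivative_transform_within_open[where S="{..<0}"]) (use \<open>t < 0\<close> in \<open>auto simp: flat_def\<close>)
    then show ?thesis using \<open>t < 0\<close> by (simp add: flat_def)
  qed
qed

lemma C_k_flat: "C_k k (flat m)"
proof (induction k arbitrary: m)
  case 0
  then show ?case using DERIV_isCont[OF flat_deriv] by (simp add: continuous_at_imp_continuous_on)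
next
  case (Suc k)
  show ?case
  proof (rule C_k_SucI)
    show "(flat m has_derivative (\<lambda>v. (flat (m + 2) t - m * flat (m + 1) t) * v)) (at t)" for t
      using flat_deriv by (simp add: has_field_derivative_def)
    show "C_k k (\<lambda>t. (flat (m + 2) t - m * flat (m + 1) t) * i)" if "i \<in> Basis" for i :: real
      using C_k_mult[OF C_k_add[OF Suc.IH C_k_cmult[OF Suc.IH, of "- real m"]] C_k_const[of k i]]
      by simp
  qed
qed

lemma flat_pos: "t > 0 \<Longrightarrow> flat m t > 0"
  and flat_nonneg: "flat m t \<ge> 0"
  by (simp_all add: flat_def)

lemma primitive_exists:
  fixes b :: "real \<Rightarrow> real"
  assumes b: "continuous_on UNIV b" "\<And>t. t \<le> 0 \<Longrightarrow> b t = 0"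
  obtains B where "\<And>t. (B has_real_derivative b t) (at t)" "\<And>t. t \<le> 0 \<Longrightarrow> B t = 0"
proof
  \<comment> \<open>The base point -1 puts every \<open>t \<ge> 0\<close> in the interior of
    \<open>{-1..t+1}\<close>, so that the one-sided derivative of the integral becomes two-sided.
    For \<open>t < 0\<close> the primitive is locally 0.\<close>
  define B where "B t = integral {-1..t} b" for t
  show B0: "B t = 0" if "t \<le> 0" for t
    unfolding B_def using that b(2) by (intro integral_unique has_integral_is_0) auto
  show "(B has_real_derivative b t) (at t)" for t
  proof (cases "t < 0")
    case True
    have "((\<lambda>t. 0) has_real_derivative 0) (at t)" by simp
    then have "(B has_real_derivative 0) (at t)"
      by (rule has_field_derivative_transform_within_open[where S="{..<0}"]) (use True B0 in auto)
    then show ?thesis using True b by simp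
  next
    case False
    have "(B has_real_derivative b t) (at t within {-1..t+1})"
      unfolding B_def[abs_def]
      by (rule integral_has_real_derivative) (use False continuous_on_subset[OF b(1)] in auto)
    moreover have "t \<in> interior {-1..t+1}" using False by (simp add: interior_atLeastAtMost_real)
    ultimately show ?thesis by (simp only: at_within_interior)
  qed
qed

lemma smooth_step_exists:
  obtains h :: "real \<Rightarrow> real" where "\<And>k. C_k k h" "\<And>t. 0 \<le> h t" "\<And>t. h t \<le> 1"
    "\<And>t. t \<le> 0 \<Longrightarrow> h t = 0" "\<And>t. t \<ge> 1 \<Longrightarrow> h t = 1"
proof -
  \<comment> \<open>A smooth bump that is positive exactly on the open unit interval; the step is
    its primitive divided by its total mass \<open>B 1\<close>.\<close>
  define b where "b t = flat 0 t * flat 0 (1 - t)" for t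
  have bs: "C_k k b" for k
  proof -
    have "C_k k (\<lambda>t. flat 0 ((-1) *\<^sub>R t + 1))" by (rule C_k_affine[OF C_k_flat])
    moreover have "(\<lambda>t. flat 0 ((-1) *\<^sub>R t + 1)) = (\<lambda>t. flat 0 (1 - t))"
      by (simp add: fun_eq_iff)
    ultimately have "C_k k (\<lambda>t. flat 0 (1 - t))" by simp
    from C_k_mult[OF C_k_flat[of k 0] this] show ?thesis by (simp add: b_def[abs_def])
  qed
  have b0: "b t = 0" if "t \<le> 0 \<or> t \<ge> 1" for t using that by (auto simp: b_def flat_def)
  have bnn: "b t \<ge> 0" for t by (simp add: b_def flat_nonneg)
  obtain B where B: "\<And>t. (B has_real_derivative b t) (at t)" "\<And>t. t \<le> 0 \<Longrightarrow> B t = 0"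
    using primitive_exists[of b] bs[of 0] b0 by auto
  have Bm: "B s \<le> B t" if "s \<le> t" for s t
    by (rule DERIV_nonneg_imp_nondecreasing[OF that, where f=B]) (use B bnn in blast)
  have bpos: "0 < b t" if "0 < t" "t < 1" for t using that by (simp add: b_def flat_pos)
  have "B 0 < B 1"
  proof (rule DERIV_pos_imp_increasing_open[of 0 1 B])
    show "continuous_on {0..1} B"
      using DERIV_isCont[OF B(1)] by (simp add: continuous_at_imp_continuous_on)
  qed (use B(1) bpos in auto)
  then have B1: "B 1 > 0" using B(2)[of 0] by simp
  have Bc: "B t = B 1" if "t \<ge> 1" for t
  proof (rule antisym)
    show "B t \<le> B 1"
      by (rule DERIV_nonpos_imp_nonincreasing[OF that, where f=B]) (use B(1) b0 in force)
  qed (rule Bm[OF that])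
  define h where "h t = inverse (B 1) * B t" for t
  have "C_k k h" for k
    unfolding h_def[abs_def] by (intro C_k_cmult C_k_primitive[OF B(1) bs])
  moreover have "0 \<le> h t" for t
    using Bm[of 0 t] B(2)[of 0] B(2)[of t] B1 by (cases "t \<le> 0") (auto simp: h_def)
  moreover have "h t \<le> 1" for t
    using Bm[of t 1] Bc[of t] B1 by (cases "t \<le> 1") (auto simp: h_def field_simps)
  moreover have "h t = 0" if "t \<le> 0" for t
    using B(2)[OF that] by (simp add: h_def)
  moreover have "h t = 1" if "t \<ge> 1" for t
    using Bc[OF that] B1 by (simp add: h_def)
  ultimately show ?thesis by (rule that)
qed

definition step :: "real \<Rightarrow> real" where
  "step = (SOME h. (\<forall>k. C_k k h) \<and> (\<forall>t. 0 \<le> h t \<and> h t \<le> 1) \<and> (\<forall>t\<le>0. h t = 0) \<and> (\<forall>t\<ge>1. h t = 1))"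

lemma step_props: "(\<forall>k. C_k k step) \<and> (\<forall>t. 0 \<le> step t \<and> step t \<le> 1) \<and> (\<forall>t\<le>0. step t = 0) \<and> (\<forall>t\<ge>1. step t = 1)"
proof -
  obtain h :: "real \<Rightarrow> real" where h: "\<And>k. C_k k h" "\<And>t. 0 \<le> h t" "\<And>t. h t \<le> 1"
    "\<And>t. t \<le> 0 \<Longrightarrow> h t = 0" "\<And>t. t \<ge> 1 \<Longrightarrow> h t = 1"
    by (rule smooth_step_exists) blast
  have "(\<forall>k. C_k k h) \<and> (\<forall>t. 0 \<le> h t \<and> h t \<le> 1) \<and> (\<forall>t\<le>0. h t = 0) \<and> (\<forall>t\<ge>1. h t = 1)"
    using h by simp
  from someI[of "\<lambda>h. (\<forall>k. C_k k h) \<and> (\<forall>t. 0 \<le> h t \<and> h t \<le> 1) \<and> (\<forall>t\<le>0. h t = 0) \<and> (\<forall>t\<ge>1. h t = 1)", OF this]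
  show ?thesis unfolding step_def .
qed

lemma C_k_step: "C_k k step"
  and step_nonneg: "0 \<le> step t" and step_le_1: "step t \<le> 1"
  and step_0: "t \<le> 0 \<Longrightarrow> step t = 0" and step_1: "t \<ge> 1 \<Longrightarrow> step t = 1"
  using step_props by auto

text \<open>A smooth positive part. The rescaled functions \<open>ramp (c * t) / c\<close> tend to
  \<open>max t 0\<close> as \<open>c\<close> grows, and their derivative \<open>step (c * t)\<close>
  stays between 0 and 1.\<close>

definition ramp :: "real \<Rightarrow> real" where
  "ramp = (SOME R. (\<forall>t. (R has_real_derivative step t) (at t)) \<and> (\<forall>t\<le>0. R t = 0))"

lemma ramp_props: "(\<forall>t. (ramp has_real_derivative step t) (at t)) \<and> (\<forall>t\<le>0. ramp t = 0)"
proof -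
  have c: "continuous_on UNIV step" using C_k_step[of 0] by simp
  obtain R where R: "\<And>t. (R has_real_derivative step t) (at t)" "\<And>t. t \<le> 0 \<Longrightarrow> R t = 0"
    by (rule primitive_exists[OF c step_0]) blast+
  then have "(\<forall>t. (R has_real_derivative step t) (at t)) \<and> (\<forall>t\<le>0. R t = 0)" by blast
  from someI[of "\<lambda>R. (\<forall>t. (R has_real_derivative step t) (at t)) \<and> (\<forall>t\<le>0. R t = 0)", OF this]
  show ?thesis unfolding ramp_def .
qed

lemma ramp_deriv: "(ramp has_real_derivative step t) (at t)"
  and ramp_0: "t \<le> 0 \<Longrightarrow> ramp t = 0"
  using ramp_props by auto

lemma C_k_ramp: "C_k k ramp"
  by (rule C_k_primitive[OF ramp_deriv C_k_step])

lemma ramp_mono: "s \<le> t \<Longrightarrow> ramp s \<le> ramp t"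
  by (rule DERIV_nonneg_imp_nondecreasing[where f=ramp]) (use ramp_deriv step_nonneg in blast)+

lemma ramp_diff_mono: "s \<le> t \<Longrightarrow> s - ramp s \<le> t - ramp t"
proof (rule DERIV_nonneg_imp_nondecreasing[where f="\<lambda>t. t - ramp t"])
  fix x
  show "\<exists>y. ((\<lambda>t. t - ramp t) has_real_derivative y) (at x) \<and> 0 \<le> y"
    using DERIV_diff[OF DERIV_ident ramp_deriv, of x] step_le_1[of x]
    by (intro exI[of _ "1 - step x"]) simp
qed

lemma ramp_lipschitz: "\<bar>ramp s - ramp t\<bar> \<le> \<bar>s - t\<bar>"
  using ramp_mono[of s t] ramp_diff_mono[of s t] ramp_mono[of t s] ramp_diff_mono[of t s]
  by (cases "s \<le> t") auto

text \<open>The gap \<open>t - ramp t\<close> lies between 0 and 1 on the unit interval and is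
  constant from 1 on, where \<open>step\<close> is 1. After rescaling by \<open>c\<close> the error
  is at most \<open>1 / c\<close>, uniformly in \<open>t\<close>.\<close>

lemma ramp_approx: "\<bar>ramp t - max t 0\<bar> \<le> 1"
proof -
  have r0: "ramp 0 = 0" by (simp add: ramp_0)
  consider "t \<le> 0" | "0 < t" "t \<le> 1" | "1 < t" by linarith
  then show ?thesis
  proof cases
    case 1
    then show ?thesis by (simp add: ramp_0)
  next
    case 2
    then show ?thesis using r0 ramp_mono[of 0 t] ramp_diff_mono[of 0 t] by (simp add: abs_le_iff)
  next
    case 3
    have "t - ramp t \<le> 1 - ramp 1"
    proof (rule DERIV_nonpos_imp_nonincreasing[where f="\<lambda>t. t - ramp t"])
      fix x :: real assume "1 \<le> x"
      then have "((\<lambda>t. t - ramp t) has_real_derivative 0) (at x)"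
        using DERIV_diff[OF DERIV_ident ramp_deriv, of x] by (simp add: step_1)
      then show "\<exists>y. ((\<lambda>t. t - ramp t) has_real_derivative y) (at x) \<and> y \<le> 0"
        by blast
    qed (use 3 in simp)
    then show ?thesis using 3 r0 ramp_mono[of 0 1] ramp_diff_mono[of 0 t] by (simp add: abs_le_iff)
  qed
qed

subsection \<open>Test functions\<close>

lemma test_functionI:
  assumes "\<And>k. C_k k \<phi>" "compact K" "K \<subseteq> \<Omega>" "\<And>x. x \<notin> K \<Longrightarrow> \<phi> x = 0"
  shows "test_function \<Omega> \<phi>"
proof -
  have sub: "closure {x. \<phi> x \<noteq> 0} \<subseteq> K"
    using assms(2,4) by (intro closure_minimal) (auto intro: compact_imp_closed)
  then have "compact (closure {x. \<phi> x \<noteq> 0})"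
    using compact_Int_closed[OF assms(2) closed_closure, of "{x. \<phi> x \<noteq> 0}"] by (simp add: inf.absorb2)
  then show ?thesis using assms sub by (auto simp: test_function_def)
qed

lemma test_function_smooth: "test_function \<Omega> \<phi> \<Longrightarrow> C_k k \<phi>"
  by (simp add: test_function_def)

lemma test_function_support:
  assumes "test_function \<Omega> \<phi>"
  obtains K where "compact K" "K \<subseteq> \<Omega>" "\<And>x. x \<notin> K \<Longrightarrow> \<phi> x = 0" "\<And>x. x \<notin> K \<Longrightarrow> gradient \<phi> x = 0"
proof
  let ?K = "closure {x. \<phi> x \<noteq> 0}"
  show "compact ?K" "?K \<subseteq> \<Omega>" using assms by (auto simp: test_function_def)
  show z: "\<phi> x = 0" if "x \<notin> ?K" for x
    using that closure_subset[of "{x. \<phi> x \<noteq> 0}"] by auto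
  show "gradient \<phi> x = 0" if "x \<notin> ?K" for x
  proof -
    have "gradient \<phi> x = gradient (\<lambda>x. 0) x"
    proof (rule gradient_cong_open[of "- ?K"])
      show "open (- ?K)" by (simp add: open_Compl)
      show "x \<in> - ?K" using that by simp
      show "\<phi> y = 0" if "y \<in> - ?K" for y using that by (intro z) simp
    qed
    then show ?thesis by (simp add: gradient_zero)
  qed
qed

lemma test_function_outside:
  assumes "test_function \<Omega> \<phi>" "x \<notin> \<Omega>"
  shows "\<phi> x = 0" "gradient \<phi> x = 0"
  using assms by (auto elim!: test_function_support)

lemma test_function_differentiable: "test_function \<Omega> \<phi> \<Longrightarrow> \<phi> differentiable (at x)"
  using test_function_smooth[of \<Omega> \<phi> 1] by (rule C_1_differentiable)

lemma test_function_continuous: "test_function \<Omega> \<phi> \<Longrightarrow> continuous_on UNIV \<phi>"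
  using test_function_smooth[of \<Omega> \<phi> 0] by simp

lemma test_function_continuous_gradient: "test_function \<Omega> \<phi> \<Longrightarrow> continuous_on UNIV (gradient \<phi>)"
  using test_function_smooth[of \<Omega> \<phi> 1] by (rule continuous_gradient)

lemma test_function_mult:
  assumes "test_function \<Omega> \<phi>" "\<And>k. C_k k \<eta>"
  shows "test_function \<Omega> (\<lambda>x. \<eta> x * \<phi> x)"
proof -
  obtain K where "compact K" "K \<subseteq> \<Omega>" "\<And>x. x \<notin> K \<Longrightarrow> \<phi> x = 0"
    using assms(1) by (rule test_function_support) blast
  then show ?thesis
    by (intro test_functionI[where K=K] C_k_mult assms(2) test_function_smooth[OF assms(1)]) auto
qed

lemma test_function_cmult: "test_function \<Omega> \<phi> \<Longrightarrow> test_function \<Omega> (\<lambda>x. c * \<phi> x)"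
  by (rule test_function_mult) (auto intro: C_k_const)

lemma test_function_add:
  assumes "test_function \<Omega> \<phi>" "test_function \<Omega> \<psi>"
  shows "test_function \<Omega> (\<lambda>x. \<phi> x + \<psi> x)"
proof -
  obtain K where K: "compact K" "K \<subseteq> \<Omega>" "\<And>x. x \<notin> K \<Longrightarrow> \<phi> x = 0"
    using assms(1) by (rule test_function_support) blast
  obtain L where L: "compact L" "L \<subseteq> \<Omega>" "\<And>x. x \<notin> L \<Longrightarrow> \<psi> x = 0"
    using assms(2) by (rule test_function_support) blast
  show ?thesis
    by (rule test_functionI[where K="K \<union> L"])
      (use K L in \<open>auto intro!: C_k_add test_function_smooth[OF assms(1)] test_function_smooth[OF assms(2)]\<close>)
qed

lemma test_function_comp:
  assumes "test_function \<Omega> \<phi>" "\<And>k. C_k k h" "h 0 = 0"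
  shows "test_function \<Omega> (\<lambda>x. h (\<phi> x))"
proof -
  obtain K where "compact K" "K \<subseteq> \<Omega>" "\<And>x. x \<notin> K \<Longrightarrow> \<phi> x = 0"
    using assms(1) by (rule test_function_support) blast
  then show ?thesis
    by (intro test_functionI[where K=K] C_k_comp[where f=\<phi> and h=h, OF assms(2) test_function_smooth[OF assms(1)]])
      (auto simp: assms(3))
qed

subsection \<open>Integrals of compactly supported functions\<close>

lemma compact_support_bounded:
  fixes f :: "'a::euclidean_space \<Rightarrow> 'b::euclidean_space"
  assumes "continuous_on UNIV f" "compact K" "\<And>x. x \<notin> K \<Longrightarrow> f x = 0"
  obtains B where "B > 0" "\<And>x. norm (f x) \<le> B"
proof -
  have "compact (f ` K)"
    using assms by (intro compact_continuous_image continuous_on_subset[OF assms(1)]) auto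
  then obtain B where B: "B > 0" "\<And>y. y \<in> f ` K \<Longrightarrow> norm y \<le> B"
    using compact_imp_bounded bounded_pos by metis
  show ?thesis
  proof (rule that[OF B(1)])
    show "norm (f x) \<le> B" for x using B assms(3)[of x] by (cases "x \<in> K") auto
  qed
qed

lemma compact_support_integrable:
  fixes f :: "'a::euclidean_space \<Rightarrow> 'b::euclidean_space"
  assumes "continuous_on UNIV f" "compact K" "\<And>x. x \<notin> K \<Longrightarrow> f x = 0"
  shows "integrable lborel f" "l2 lborel f"
proof -
  have i: "integrable lborel (\<lambda>x. indicator K x *\<^sub>R g x)" if "continuous_on UNIV g" for g :: "'a \<Rightarrow> 'c::{banach, second_countable_topology}"
    by (rule borel_integrable_compact) (use assms that continuous_on_subset in blast)+
  have "(\<lambda>x. indicator K x *\<^sub>R f x) = f"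
    by (rule ext) (use assms(3) in \<open>auto simp: indicator_def\<close>)
  with i[OF assms(1)] show "integrable lborel f" by simp
  have "(\<lambda>x. indicator K x *\<^sub>R (norm (f x))\<^sup>2) = (\<lambda>x. (norm (f x))\<^sup>2)"
    by (rule ext) (use assms(3) in \<open>auto simp: indicator_def\<close>)
  moreover have "continuous_on UNIV (\<lambda>x. (norm (f x))\<^sup>2)"
    using assms(1) by (intro continuous_intros)
  ultimately have "integrable lborel (\<lambda>x. (norm (f x))\<^sup>2)" using i by metis
  then show "l2 lborel f"
    using borel_measurable_continuous_onI[OF assms(1)] by (simp add: l2_def)
qed

lemma borel_measurable_lebesgue_on:
  "f \<in> borel_measurable borel \<Longrightarrow> f \<in> borel_measurable (lebesgue_on \<Omega>)"
  by (intro measurable_restrict_space1 measurable_completion) simp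

text \<open>The bridge to \<open>lborel\<close>, where translation invariance and Fubini are
  available; Borel functions that vanish off \<open>\<Omega>\<close> have the same integrals on both
  sides.\<close>

lemma lebesgue_on_eq_lborel:
  fixes f :: "'a::euclidean_space \<Rightarrow> 'b::{banach, second_countable_topology}"
  assumes "open \<Omega>" "f \<in> borel_measurable borel" "\<And>x. x \<notin> \<Omega> \<Longrightarrow> f x = 0"
  shows "(\<integral>x. f x \<partial>lebesgue_on \<Omega>) = (\<integral>x. f x \<partial>lborel)"
    and "integrable (lebesgue_on \<Omega>) f \<longleftrightarrow> integrable lborel f"
proof -
  have \<Omega>: "\<Omega> \<inter> space lebesgue \<in> sets lebesgue" using assms(1) by simp
  have "(\<lambda>x. indicator \<Omega> x *\<^sub>R f x) = f"
    by (rule ext) (use assms(3) in \<open>auto simp: indicator_def\<close>)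
  moreover have "f \<in> borel_measurable lborel" using assms(2) by simp
  ultimately show "(\<integral>x. f x \<partial>lebesgue_on \<Omega>) = (\<integral>x. f x \<partial>lborel)"
    "integrable (lebesgue_on \<Omega>) f \<longleftrightarrow> integrable lborel f"
    by (simp_all only: integral_restrict_space[OF \<Omega>] integrable_restrict_space[OF \<Omega>]
      integral_completion integrable_completion)
qed

lemma l2_lebesgue_on_eq_lborel:
  fixes f :: "'a::euclidean_space \<Rightarrow> 'b::euclidean_space"
  assumes "open \<Omega>" "f \<in> borel_measurable borel" "\<And>x. x \<notin> \<Omega> \<Longrightarrow> f x = 0"
  shows "l2 (lebesgue_on \<Omega>) f \<longleftrightarrow> l2 lborel f" "n2 (lebesgue_on \<Omega>) f = n2 lborel f"
proof -
  have m: "(\<lambda>x. (norm (f x))\<^sup>2) \<in> borel_measurable borel" using assms(2) by measurable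
  show "l2 (lebesgue_on \<Omega>) f \<longleftrightarrow> l2 lborel f"
    using lebesgue_on_eq_lborel(2)[OF assms(1) m] assms(2,3) borel_measurable_lebesgue_on[OF assms(2)]
    by (simp add: l2_def)
  show "n2 (lebesgue_on \<Omega>) f = n2 lborel f"
    using lebesgue_on_eq_lborel(1)[OF assms(1) m] assms(3) by (simp add: n2_def)
qed

lemma test_function_measurable:
  assumes "test_function \<Omega> \<phi>"
  shows "\<phi> \<in> borel_measurable borel" "gradient \<phi> \<in> borel_measurable borel"
  using borel_measurable_continuous_onI test_function_continuous[OF assms]
    test_function_continuous_gradient[OF assms] by auto

lemma test_function_l2_lborel:
  assumes "test_function \<Omega> \<phi>"
  shows "l2 lborel \<phi>" "l2 lborel (gradient \<phi>)" "integrable lborel \<phi>"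
proof -
  obtain K where K: "compact K" "\<And>x. x \<notin> K \<Longrightarrow> \<phi> x = 0" "\<And>x. x \<notin> K \<Longrightarrow> gradient \<phi> x = 0"
    using assms by (rule test_function_support) blast
  show "l2 lborel \<phi>" "l2 lborel (gradient \<phi>)" "integrable lborel \<phi>"
    using compact_support_integrable[OF test_function_continuous[OF assms] K(1,2)]
      compact_support_integrable[OF test_function_continuous_gradient[OF assms] K(1,3)] by auto
qed

lemma test_function_l2:
  assumes "open \<Omega>" "test_function \<Omega> \<phi>"
  shows "l2 (lebesgue_on \<Omega>) \<phi>" "l2 (lebesgue_on \<Omega>) (gradient \<phi>)"
    "n2 (lebesgue_on \<Omega>) \<phi> = n2 lborel \<phi>" "n2 (lebesgue_on \<Omega>) (gradient \<phi>) = n2 lborel (gradient \<phi>)"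
  using l2_lebesgue_on_eq_lborel[OF assms(1) test_function_measurable(1)[OF assms(2)]]
    l2_lebesgue_on_eq_lborel[OF assms(1) test_function_measurable(2)[OF assms(2)]]
    test_function_outside[OF assms(2)] test_function_l2_lborel[OF assms(2)] by auto

section \<open>Translation invariance of Lebesgue measure\<close>

lemma nn_integral_lborel_translate:
  fixes f :: "'a::euclidean_space \<Rightarrow> ennreal"
  assumes [measurable]: "f \<in> borel_measurable borel"
  shows "(\<integral>\<^sup>+x. f (x + h) \<partial>lborel) = (\<integral>\<^sup>+x. f x \<partial>lborel)"
proof -
  have "(\<integral>\<^sup>+x. f x \<partial>lborel) = (\<integral>\<^sup>+x. f x \<partial>distr lborel borel ((+) h))" by (simp add: lborel_distr_plus)
  also have "\<dots> = (\<integral>\<^sup>+x. f (h + x) \<partial>lborel)" by (rule nn_integral_distr) measurable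
  finally show ?thesis by (simp add: add.commute)
qed

lemma integral_lborel_translate:
  fixes f :: "'a::euclidean_space \<Rightarrow> 'b::{banach, second_countable_topology}"
  assumes [measurable]: "f \<in> borel_measurable borel"
  shows "(\<integral>x. f (x + h) \<partial>lborel) = (\<integral>x. f x \<partial>lborel)"
    and "integrable lborel (\<lambda>x. f (x + h)) \<longleftrightarrow> integrable lborel f"
proof -
  have e: "distr lborel borel ((+) h) = lborel" by (rule lborel_distr_plus)
  have "(\<integral>x. f x \<partial>distr lborel borel ((+) h)) = (\<integral>x. f (h + x) \<partial>lborel)" by (rule integral_distr) measurable
  then show "(\<integral>x. f (x + h) \<partial>lborel) = (\<integral>x. f x \<partial>lborel)" by (simp add: e add.commute)
  have "integrable (distr lborel borel ((+) h)) f \<longleftrightarrow> integrable lborel (\<lambda>x. f (h + x))"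
    by (rule integrable_distr_eq) measurable
  then show "integrable lborel (\<lambda>x. f (x + h)) \<longleftrightarrow> integrable lborel f" by (simp add: e add.commute)
qed

lemma l2_lborel_translate:
  fixes f :: "'a::euclidean_space \<Rightarrow> 'b::euclidean_space"
  assumes "l2 lborel f"
  shows "l2 lborel (\<lambda>x. f (x + h))" "n2 lborel (\<lambda>x. f (x + h)) = n2 lborel f"
proof -
  have [measurable]: "f \<in> borel_measurable borel" using assms by (simp add: l2_def)
  have m: "(\<lambda>x. (norm (f x))\<^sup>2) \<in> borel_measurable borel" by measurable
  show "l2 lborel (\<lambda>x. f (x + h))"
    using assms integral_lborel_translate(2)[OF m, of h] by (simp add: l2_def)
  show "n2 lborel (\<lambda>x. f (x + h)) = n2 lborel f"
    using integral_lborel_translate(1)[OF m, of h] by (simp add: n2_def)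
qed

subsection \<open>Difference quotients\<close>

lemma gradient_bound_lipschitz:
  fixes \<phi> :: "'a::euclidean_space \<Rightarrow> real"
  assumes "\<And>x. \<phi> differentiable (at x)" "\<And>x. norm (gradient \<phi> x) \<le> B"
  shows "\<bar>\<phi> y - \<phi> x\<bar> \<le> B * norm (y - x)"
proof -
  have "norm (\<phi> y - \<phi> x) \<le> B * norm (y - x)"
  proof (rule differentiable_bound[of UNIV])
    show "(\<phi> has_derivative (\<lambda>v. gradient \<phi> x \<bullet> v)) (at x within UNIV)" for x
      using has_derivative_gradient[OF assms(1)] by simp
    show "onorm (\<lambda>v. gradient \<phi> x \<bullet> v) \<le> B" for x
    proof (rule onorm_bound)
      show "norm (gradient \<phi> x \<bullet> v) \<le> B * norm v" for v
        using Cauchy_Schwarz_ineq2[of "gradient \<phi> x" v] mult_right_mono[OF assms(2)[of x], of "norm v"] by simp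
      show "0 \<le> B" using assms(2)[of x] norm_ge_zero[of "gradient \<phi> x"] by linarith
    qed
  qed auto
  then show ?thesis by simp
qed

lemma difference_quotient_tendsto:
  fixes \<phi> :: "'a::euclidean_space \<Rightarrow> real"
  assumes "\<phi> differentiable (at x)"
  shows "(\<lambda>n. real (Suc n) * (\<phi> (x + (1 / real (Suc n)) *\<^sub>R h) - \<phi> x)) \<longlonglongrightarrow> gradient \<phi> x \<bullet> h"
proof -
  have "((\<lambda>t. x + t *\<^sub>R h) has_derivative (\<lambda>t. t *\<^sub>R h)) (at 0)"
    by (auto intro!: derivative_eq_intros)
  then have "((\<lambda>t. \<phi> (x + t *\<^sub>R h)) has_derivative (\<lambda>t. gradient \<phi> x \<bullet> (t *\<^sub>R h))) (at 0)"
    using has_derivative_compose[of "\<lambda>t. x + t *\<^sub>R h" _ 0 UNIV \<phi> "\<lambda>v. gradient \<phi> x \<bullet> v"]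
      has_derivative_gradient[OF assms] by (simp only: scaleR_zero_left add_0_right)
  moreover have "(\<lambda>t. gradient \<phi> x \<bullet> (t *\<^sub>R h)) = (*) (gradient \<phi> x \<bullet> h)"
    by (simp add: fun_eq_iff)
  ultimately have "((\<lambda>t. \<phi> (x + t *\<^sub>R h)) has_real_derivative (gradient \<phi> x \<bullet> h)) (at 0)"
    by (simp only: has_field_derivative_def)
  then have l: "((\<lambda>t. (\<phi> (x + t *\<^sub>R h) - \<phi> x) / t) \<longlongrightarrow> gradient \<phi> x \<bullet> h) (at 0)"
    by (simp add: has_field_derivative_iff)
  have "filterlim (\<lambda>n. 1 / real (Suc n)) (at 0) sequentially"
    unfolding filterlim_at using LIMSEQ_inverse_real_of_nat by (simp add: inverse_eq_divide)
  from filterlim_compose[OF l this] show ?thesis by (simp add: mult.commute)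
qed

text \<open>A majorant for dominated convergence, uniform in \<open>n\<close>: the quotients are
  bounded by the Lipschitz constant times \<open>norm h\<close>, and as the shifts are at most
  \<open>norm h\<close> long they vanish off the support enlarged by that length.\<close>

lemma test_function_difference_quotient:
  fixes \<phi> :: "'a::euclidean_space \<Rightarrow> real"
  assumes "test_function \<Omega> \<phi>"
  obtains C R where "C > 0" "R > 0"
    "\<And>n x. \<bar>real (Suc n) * (\<phi> (x + (1 / real (Suc n)) *\<^sub>R h) - \<phi> x)\<bar> \<le> C * indicator (cball 0 R) x"
proof -
  obtain K where K: "compact K" "\<And>x. x \<notin> K \<Longrightarrow> \<phi> x = 0" "\<And>x. x \<notin> K \<Longrightarrow> gradient \<phi> x = 0"
    using assms by (rule test_function_support) blast
  obtain B where B: "B > 0" "\<And>x. norm (gradient \<phi> x) \<le> B"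
    using compact_support_bounded[OF test_function_continuous_gradient[OF assms] K(1,3)] by blast
  obtain r where r: "r > 0" "K \<subseteq> cball 0 r"
    using bounded_subset_ballD[OF compact_imp_bounded[OF K(1)], of 0] ball_subset_cball by blast
  show ?thesis
  \<comment> \<open>The \<open>+ 1\<close> keeps the constant positive when
    \<open>h = 0\<close>.\<close>
  proof (rule that[of "B * norm h + 1" "r + norm h"])
    show "B * norm h + 1 > 0" "r + norm h > 0" using B r by (auto intro: add_nonneg_pos add_pos_nonneg)
    fix n x
    define t where "t = 1 / real (Suc n)"
    have t: "0 < t" "t \<le> 1" by (auto simp: t_def)
    show "\<bar>real (Suc n) * (\<phi> (x + (1 / real (Suc n)) *\<^sub>R h) - \<phi> x)\<bar> \<le> (B * norm h + 1) * indicator (cball 0 (r + norm h)) x"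
    proof (cases "x \<in> cball 0 (r + norm h)")
      case True
      have "\<bar>\<phi> (x + t *\<^sub>R h) - \<phi> x\<bar> \<le> B * norm (x + t *\<^sub>R h - x)"
        by (rule gradient_bound_lipschitz[OF test_function_differentiable[OF assms] B(2)])
      then have "\<bar>\<phi> (x + t *\<^sub>R h) - \<phi> x\<bar> \<le> B * (t * norm h)" using t by simp
      then have "real (Suc n) * \<bar>\<phi> (x + t *\<^sub>R h) - \<phi> x\<bar> \<le> real (Suc n) * (B * (t * norm h))"
        by (rule mult_left_mono) simp
      also have "\<dots> = B * norm h" by (simp add: t_def)
      finally show ?thesis using True by (simp add: t_def abs_mult)
    next
      case False
      have "norm (t *\<^sub>R h) \<le> norm h" using t mult_right_mono[of t 1 "norm h"] by simp
      then have "norm (x + t *\<^sub>R h) > r"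
        using False norm_diff_ineq[of x "t *\<^sub>R h"] by simp
      moreover have "norm x > r" using False norm_ge_zero[of h] by (simp del: norm_ge_zero)
      ultimately have "x \<notin> K" "x + t *\<^sub>R h \<notin> K" using r(2) by auto
      then show ?thesis using K(2) False by (simp add: t_def indicator_def)
    qed
  qed
qed

text \<open>Every difference quotient has integral 0 by translation invariance, and dominated
  convergence carries this over to all directional derivatives.\<close>

lemma integral_gradient_eq_0:
  fixes \<phi> :: "'a::euclidean_space \<Rightarrow> real"
  assumes "test_function \<Omega> \<phi>"
  shows "(\<integral>x. gradient \<phi> x \<partial>lborel) = 0"
proof -
  obtain K where K: "compact K" "\<And>x. x \<notin> K \<Longrightarrow> gradient \<phi> x = 0"
    using assms by (rule test_function_support) blast
  have gi: "integrable lborel (gradient \<phi>)"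
    by (rule compact_support_integrable(1)[OF test_function_continuous_gradient[OF assms] K])
  note [measurable] = test_function_measurable[OF assms]
  have "(\<integral>x. gradient \<phi> x \<bullet> h \<partial>lborel) = 0" for h
  proof -
    obtain C R where CR: "C > 0" "R > 0"
      "\<And>n x. \<bar>real (Suc n) * (\<phi> (x + (1 / real (Suc n)) *\<^sub>R h) - \<phi> x)\<bar> \<le> C * indicator (cball 0 R) x"
      using test_function_difference_quotient[OF assms] by metis
    have "(\<lambda>n. \<integral>x. real (Suc n) * (\<phi> (x + (1 / real (Suc n)) *\<^sub>R h) - \<phi> x) \<partial>lborel)
        \<longlonglongrightarrow> (\<integral>x. gradient \<phi> x \<bullet> h \<partial>lborel)"
    proof (rule integral_dominated_convergence[where w="\<lambda>x. C * indicator (cball 0 R) x"])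
      show "integrable lborel (\<lambda>x. C * indicator (cball 0 R) x :: real)"
        using emeasure_bounded_finite[OF bounded_cball] by (intro integrable_mult_right integrable_real_indicator) auto
    qed (use CR difference_quotient_tendsto[OF test_function_differentiable[OF assms]] in auto)
    moreover have "(\<integral>x. real (Suc n) * (\<phi> (x + (1 / real (Suc n)) *\<^sub>R h) - \<phi> x) \<partial>lborel) = 0" for n
      using integral_lborel_translate[of \<phi> "(1 / real (Suc n)) *\<^sub>R h"] test_function_l2_lborel(3)[OF assms]
        test_function_measurable[OF assms] by simp
    ultimately show ?thesis by (simp add: LIMSEQ_const_iff)
  qed
  then have "(\<integral>x. gradient \<phi> x \<partial>lborel) \<bullet> h = 0" for h
    using gi by (simp flip: integral_inner_left)
  then show ?thesis using inner_eq_zero_iff by blast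
qed

lemma test_function_integration_by_parts:
  assumes "test_function \<Omega> \<phi>" "test_function \<Omega> \<psi>"
  shows "(\<integral>x. \<psi> x *\<^sub>R gradient \<phi> x \<partial>lborel) = - (\<integral>x. \<phi> x *\<^sub>R gradient \<psi> x \<partial>lborel)"
proof -
  have t: "test_function \<Omega> (\<lambda>x. \<psi> x * \<phi> x)"
    by (rule test_function_mult[OF assms(1) test_function_smooth[OF assms(2)]])
  have "gradient (\<lambda>x. \<psi> x * \<phi> x) = (\<lambda>x. \<psi> x *\<^sub>R gradient \<phi> x + \<phi> x *\<^sub>R gradient \<psi> x)"
    by (rule ext, rule gradient_mult) (use assms test_function_differentiable in auto)
  with integral_gradient_eq_0[OF t]
  have "(\<integral>x. \<psi> x *\<^sub>R gradient \<phi> x + \<phi> x *\<^sub>R gradient \<psi> x \<partial>lborel) = 0" by simp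
  moreover have "integrable lborel (\<lambda>x. \<psi> x *\<^sub>R gradient \<phi> x)" "integrable lborel (\<lambda>x. \<phi> x *\<^sub>R gradient \<psi> x)"
    by (intro l2_scaleR_integrable test_function_l2_lborel[OF assms(1)] test_function_l2_lborel[OF assms(2)])+
  ultimately show ?thesis by (simp add: eq_neg_iff_add_eq_0)
qed

text \<open>Splitting the shift by \<open>h\<close> into \<open>n + 1\<close> equal shifts and using
  translation invariance bounds the left side by the norm of the difference quotient
  \<open>D n\<close>; these quotients converge in norm to the derivative in direction
  \<open>h\<close>.\<close>

lemma test_function_translation:
  fixes \<phi> :: "'a::euclidean_space \<Rightarrow> real"
  assumes "test_function \<Omega> \<phi>"
  shows "n2 lborel (\<lambda>x. \<phi> (x + h) - \<phi> x) \<le> norm h * n2 lborel (gradient \<phi>)"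
proof -
  note l = test_function_l2_lborel[OF assms]
  note lt = l2_lborel_translate[OF l(1)]
  note [measurable] = test_function_measurable[OF assms]
  have sub: "n2 lborel (\<lambda>x. \<phi> (x + real j *\<^sub>R a) - \<phi> x) \<le> real j * n2 lborel (\<lambda>x. \<phi> (x + a) - \<phi> x)" for a j
  proof (induction j)
    case 0 show ?case by (simp add: n2_def)
  next
    case (Suc j)
    have "n2 lborel (\<lambda>x. \<phi> (x + real (Suc j) *\<^sub>R a) - \<phi> x)
      \<le> n2 lborel (\<lambda>x. \<phi> (x + real (Suc j) *\<^sub>R a) - \<phi> (x + a)) + n2 lborel (\<lambda>x. \<phi> (x + a) - \<phi> x)"
      by (rule n2_triangle_diff) (use lt l in auto)
    also have "n2 lborel (\<lambda>x. \<phi> (x + real (Suc j) *\<^sub>R a) - \<phi> (x + a)) = n2 lborel (\<lambda>x. \<phi> (x + real j *\<^sub>R a) - \<phi> x)"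
      using l2_lborel_translate(2)[OF l2_diff[OF lt(1)[of "real j *\<^sub>R a"] l(1)], of a]
      by (simp add: algebra_simps)
    finally show ?case using Suc by (simp add: algebra_simps)
  qed
  obtain C R where CR: "C > 0" "R > 0"
    "\<And>n x. \<bar>real (Suc n) * (\<phi> (x + (1 / real (Suc n)) *\<^sub>R h) - \<phi> x)\<bar> \<le> C * indicator (cball 0 R) x"
    using test_function_difference_quotient[OF assms] by metis
  define D where "D n x = real (Suc n) * (\<phi> (x + (1 / real (Suc n)) *\<^sub>R h) - \<phi> x)" for n x
  have w: "l2 lborel (\<lambda>x. C * indicator (cball 0 R) x :: real)"
  proof -
    have m: "(\<lambda>x. C * indicator (cball 0 R) x :: real) \<in> borel_measurable lborel"
      by (intro borel_measurable_times borel_measurable_const borel_measurable_indicator) auto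
    have "integrable lborel (\<lambda>x. C\<^sup>2 * indicator (cball 0 R) x :: real)"
      using emeasure_bounded_finite[OF bounded_cball] by (intro integrable_mult_right integrable_real_indicator) auto
    also have "(\<lambda>x. C\<^sup>2 * indicator (cball 0 R) x) = (\<lambda>x. (norm (C * indicator (cball 0 R) x :: real))\<^sup>2)"
      by (auto simp: indicator_def fun_eq_iff)
    finally show ?thesis using m unfolding l2_def by blast
  qed
  have Dm: "D n \<in> borel_measurable lborel" for n unfolding D_def[abs_def] by measurable
  have gm: "(\<lambda>x. gradient \<phi> x \<bullet> h) \<in> borel_measurable lborel" by measurable
  have Dl: "AE x in lborel. (\<lambda>n. D n x) \<longlonglongrightarrow> gradient \<phi> x \<bullet> h"
    unfolding D_def using difference_quotient_tendsto[OF test_function_differentiable[OF assms]] by (intro AE_I2)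
  have Db: "AE x in lborel. norm (D n x) \<le> norm (C * indicator (cball 0 R) x)" for n
    using CR(1,3) by (intro AE_I2) (simp add: D_def abs_mult)
  note D = l2_dominated[OF Dm gm w Dl Db]
  have "n2 lborel (\<lambda>x. \<phi> (x + h) - \<phi> x) \<le> n2 lborel (\<lambda>x. gradient \<phi> x \<bullet> h)"
  proof (rule LIMSEQ_le_const[OF n2_tendsto[OF D(2,1,3)]], intro exI allI impI)
    fix n
    have "n2 lborel (\<lambda>x. \<phi> (x + h) - \<phi> x) \<le> real (Suc n) * n2 lborel (\<lambda>x. \<phi> (x + (1 / real (Suc n)) *\<^sub>R h) - \<phi> x)"
      using sub[of "Suc n" "(1 / real (Suc n)) *\<^sub>R h"] by (simp del: of_nat_Suc)
    also have "\<dots> = n2 lborel (D n)"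
      using n2_scaleR[of lborel "real (Suc n)" "\<lambda>x. \<phi> (x + (1 / real (Suc n)) *\<^sub>R h) - \<phi> x"]
      by (simp add: D_def[abs_def])
    finally show "n2 lborel (\<lambda>x. \<phi> (x + h) - \<phi> x) \<le> n2 lborel (D n)" .
  qed
  also have "\<dots> \<le> n2 lborel (\<lambda>x. norm h *\<^sub>R gradient \<phi> x)"
    by (rule n2_mono[OF l2_scaleR[OF l(2)]])
      (auto simp: mult.commute[of "norm h"] intro: Cauchy_Schwarz_ineq2)
  also have "\<dots> = norm h * n2 lborel (gradient \<phi>)" by (simp add: n2_scaleR)
  finally show ?thesis .
qed

subsection \<open>Uniqueness of weak gradients\<close>

text \<open>Test functions between 0 and 1 that converge to the indicator of the open box: the
  factor \<open>n\<close> steepens the one-dimensional steps at all faces.\<close>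

definition box_bump :: "'a::euclidean_space \<Rightarrow> 'a \<Rightarrow> nat \<Rightarrow> 'a \<Rightarrow> real" where
  "box_bump a b n x = (\<Prod>i\<in>Basis. step (real n * (x \<bullet> i - a \<bullet> i)) * step (real n * (b \<bullet> i - x \<bullet> i)))"

lemma C_k_step_inner: "C_k k (\<lambda>x::'a::euclidean_space. step (c * (x \<bullet> i) + d))"
  by (rule C_k_comp[OF C_k_step C_k_add[OF C_k_cmult[OF C_k_inner] C_k_const]])

lemma box_bump_outside: "x \<notin> box a b \<Longrightarrow> box_bump a b n x = 0"
proof -
  assume "x \<notin> box a b"
  then obtain i where i: "i \<in> Basis" "x \<bullet> i \<le> a \<bullet> i \<or> b \<bullet> i \<le> x \<bullet> i"
    by (auto simp: mem_box not_less)
  then have "step (real n * (x \<bullet> i - a \<bullet> i)) * step (real n * (b \<bullet> i - x \<bullet> i)) = 0"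
    by (auto simp: step_0 mult_nonneg_nonpos)
  then show ?thesis using i(1) unfolding box_bump_def by (intro prod_zero) auto
qed

lemma box_bump_range: "0 \<le> box_bump a b n x" "box_bump a b n x \<le> 1"
  unfolding box_bump_def by (auto intro!: prod_nonneg prod_le_1 mult_le_one step_nonneg step_le_1 mult_nonneg_nonneg)

lemma box_bump_test_function:
  assumes "cbox a b \<subseteq> \<Omega>" shows "test_function \<Omega> (box_bump a b n)"
proof (rule test_functionI[where K="cbox a b"])
  fix k
  have "C_k k (\<lambda>x. \<Prod>i\<in>Basis. step (real n * (x \<bullet> i) + - (real n * (a \<bullet> i))) * step (- real n * (x \<bullet> i) + real n * (b \<bullet> i)))"
    by (rule C_k_prod, rule C_k_mult) (rule C_k_step_inner)+
  then show "C_k k (box_bump a b n)"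
    by (simp add: box_bump_def[abs_def] algebra_simps)
  show "box_bump a b n x = 0" if "x \<notin> cbox a b" for x
    using that box_subset_cbox by (intro box_bump_outside) blast
qed (use assms in auto)

lemma box_bump_tendsto: "(\<lambda>n. box_bump a b n x) \<longlonglongrightarrow> indicator (box a b) x"
proof (cases "x \<in> box a b")
  case False then show ?thesis by (simp add: box_bump_outside)
next
  case True
  have ev: "\<forall>\<^sub>F n in sequentially. step (real n * t) = 1" if "t > 0" for t
  proof -
    have "\<forall>\<^sub>F n in sequentially. 1 / t \<le> real n"
      using eventually_ge_at_top real_nat_ceiling_ge by (auto intro: eventually_sequentiallyI[of "nat \<lceil>1/t\<rceil>"] simp: nat_le_iff ceiling_le_iff)
    then show ?thesis by eventually_elim (use that in \<open>simp add: step_1 field_simps\<close>)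
  qed
  have "\<forall>\<^sub>F n in sequentially. \<forall>i\<in>Basis. step (real n * (x \<bullet> i - a \<bullet> i)) = 1 \<and> step (real n * (b \<bullet> i - x \<bullet> i)) = 1"
    using True by (intro eventually_ball_finite ballI eventually_conj ev) (auto simp: mem_box)
  then have "\<forall>\<^sub>F n in sequentially. box_bump a b n x = indicator (box a b) x"
    by eventually_elim (use True in \<open>simp add: box_bump_def\<close>)
  then show ?thesis by (rule tendsto_eventually)
qed

lemma locally_integrable_test_integrable:
  fixes d :: "'a::euclidean_space \<Rightarrow> 'b::euclidean_space"
  assumes "open \<Omega>" "locally_integrable \<Omega> d" "test_function \<Omega> \<phi>"
  shows "integrable (lebesgue_on \<Omega>) (\<lambda>x. \<phi> x *\<^sub>R d x)"
proof -
  obtain K where K: "compact K" "K \<subseteq> \<Omega>" "\<And>x. x \<notin> K \<Longrightarrow> \<phi> x = 0"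
    using assms(3) by (rule test_function_support) blast
  obtain B where B: "\<And>x. norm (\<phi> x) \<le> B"
    using compact_support_bounded[OF test_function_continuous[OF assms(3)] K(1,3)] by blast
  have i: "integrable lebesgue (\<lambda>x. indicator K x *\<^sub>R d x)"
    using assms(2) K(1,2) by (auto simp: locally_integrable_def set_integrable_def)
  have [measurable]: "\<phi> \<in> borel_measurable lebesgue"
    using test_function_measurable(1)[OF assms(3)] by (intro measurable_completion) simp
  have "integrable lebesgue (\<lambda>x. \<phi> x *\<^sub>R (indicator K x *\<^sub>R d x))"
  proof (rule Bochner_Integration.integrable_bound[OF integrable_scaleR_right[OF i, of B]])
    show "AE x in lebesgue. norm (\<phi> x *\<^sub>R (indicator K x *\<^sub>R d x)) \<le> norm (B *\<^sub>R (indicator K x *\<^sub>R d x))"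
      unfolding norm_scaleR real_norm_def
      by (intro AE_I2 mult_right_mono order_trans[OF B[unfolded real_norm_def] abs_ge_self]) simp_all
    show "(\<lambda>x. \<phi> x *\<^sub>R (indicator K x *\<^sub>R d x)) \<in> borel_measurable lebesgue"
      using i by (intro borel_measurable_scaleR[of \<phi>]) auto
  qed
  also have "(\<lambda>x. \<phi> x *\<^sub>R (indicator K x *\<^sub>R d x)) = (\<lambda>x. indicator \<Omega> x *\<^sub>R (\<phi> x *\<^sub>R d x))"
    using K(2,3) by (auto simp: indicator_def fun_eq_iff)
  finally show ?thesis
    using assms(1) by (subst integrable_restrict_space) auto
qed

text \<open>Bumps approximating the indicators of boxes show that the integral of \<open>d\<close>
  over every closed box in \<open>\<Omega>\<close> is 0; Lebesgue differentiation along shrinking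
  cubes then gives \<open>d = 0\<close> a.e. on each box, and countably many boxes cover
  \<open>\<Omega>\<close>.\<close>

lemma fundamental_lemma:
  fixes d :: "'a::euclidean_space \<Rightarrow> 'b::euclidean_space"
  assumes "open \<Omega>" "locally_integrable \<Omega> d"
    and z: "\<And>\<phi>. test_function \<Omega> \<phi> \<Longrightarrow> (\<integral>x. \<phi> x *\<^sub>R d x \<partial>lebesgue_on \<Omega>) = 0"
  shows "AE x in lebesgue_on \<Omega>. d x = 0"
proof -
  have si: "integrable lebesgue (\<lambda>x. indicator K x *\<^sub>R d x)" if "compact K" "K \<subseteq> \<Omega>" for K
    using assms(2) that by (auto simp: locally_integrable_def set_integrable_def)
  have \<Omega>: "\<Omega> \<inter> space lebesgue \<in> sets lebesgue" using assms(1) by simp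
  have box0: "(\<integral>x. indicator (cbox a b) x *\<^sub>R d x \<partial>lebesgue) = 0" if ab: "cbox a b \<subseteq> \<Omega>" for a b
  proof -
    note i = si[OF compact_cbox ab]
    have bm: "box_bump a b n \<in> borel_measurable lebesgue" for n
      using test_function_measurable(1)[OF box_bump_test_function[OF ab]] by (intro measurable_completion) simp
    have dm: "(\<lambda>x. indicator (cbox a b) x *\<^sub>R d x) \<in> borel_measurable lebesgue" using i by auto
    have "(\<lambda>n. \<integral>x. box_bump a b n x *\<^sub>R (indicator (cbox a b) x *\<^sub>R d x) \<partial>lebesgue)
      \<longlonglongrightarrow> (\<integral>x. indicator (box a b) x *\<^sub>R (indicator (cbox a b) x *\<^sub>R d x) \<partial>lebesgue)"
    proof (rule integral_dominated_convergence[OF _ _ integrable_norm[OF i]])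
      show "(\<lambda>x. indicator (box a b) x *\<^sub>R (indicator (cbox a b) x *\<^sub>R d x)) \<in> borel_measurable lebesgue"
        by (intro borel_measurable_scaleR[OF _ dm] borel_measurable_indicator) auto
      show "(\<lambda>x. box_bump a b n x *\<^sub>R (indicator (cbox a b) x *\<^sub>R d x)) \<in> borel_measurable lebesgue" for n
        by (rule borel_measurable_scaleR[OF bm dm])
      show "AE x in lebesgue. (\<lambda>n. box_bump a b n x *\<^sub>R (indicator (cbox a b) x *\<^sub>R d x))
          \<longlonglongrightarrow> indicator (box a b) x *\<^sub>R (indicator (cbox a b) x *\<^sub>R d x)"
        by (intro AE_I2 tendsto_scaleR box_bump_tendsto tendsto_const)
      show "AE x in lebesgue. norm (box_bump a b n x *\<^sub>R (indicator (cbox a b) x *\<^sub>R d x)) \<le> norm (indicator (cbox a b) x *\<^sub>R d x)" for n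
        using box_bump_range by (intro AE_I2) (auto simp: indicator_def box_bump_range abs_of_nonneg intro!: mult_left_le_one_le)
    qed
    moreover have "(\<integral>x. box_bump a b n x *\<^sub>R (indicator (cbox a b) x *\<^sub>R d x) \<partial>lebesgue) = 0" for n
    proof -
      have "(\<lambda>x. box_bump a b n x *\<^sub>R (indicator (cbox a b) x *\<^sub>R d x)) = (\<lambda>x. indicator \<Omega> x *\<^sub>R (box_bump a b n x *\<^sub>R d x))"
      proof
        fix x
        show "box_bump a b n x *\<^sub>R (indicator (cbox a b) x *\<^sub>R d x) = indicator \<Omega> x *\<^sub>R (box_bump a b n x *\<^sub>R d x)"
          using box_bump_outside[of x a b n] box_subset_cbox[of a b] ab
          by (cases "x \<in> box a b") (auto simp: indicator_def)
      qed
      then show ?thesis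
        using z[OF box_bump_test_function[OF ab, of n]] by (simp add: integral_restrict_space[OF \<Omega>])
    qed
    ultimately have "(\<integral>x. indicator (box a b) x *\<^sub>R (indicator (cbox a b) x *\<^sub>R d x) \<partial>lebesgue) = 0"
      by (simp add: LIMSEQ_const_iff)
    moreover have "(\<integral>x. indicator (cbox a b) x *\<^sub>R d x \<partial>lebesgue)
        = (\<integral>x. indicator (box a b) x *\<^sub>R (indicator (cbox a b) x *\<^sub>R d x) \<partial>lebesgue)"
    \<comment> \<open>The bumps see only the open box, but its faces are a null set.\<close>
    proof (rule integral_cong_AE)
      have "AE x in lebesgue. x \<notin> cbox a b - box a b"
        using negligible_frontier_interval[of a b] by (intro AE_not_in) (simp add: negligible_iff_null_sets)
      then show "AE x in lebesgue. indicator (cbox a b) x *\<^sub>R d x = indicator (box a b) x *\<^sub>R (indicator (cbox a b) x *\<^sub>R d x)"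
        by eventually_elim (auto simp: indicator_def)
      show "(\<lambda>x. indicator (box a b) x *\<^sub>R (indicator (cbox a b) x *\<^sub>R d x)) \<in> borel_measurable lebesgue"
        by (intro borel_measurable_scaleR[OF _ dm] borel_measurable_indicator) auto
    qed (rule dm)
    ultimately show ?thesis by simp
  qed
  have loc: "AE x in lebesgue. x \<in> cbox p q \<longrightarrow> d x = 0" if pq: "cbox p q \<subseteq> \<Omega>" for p q
  proof -
    define f where "f x = indicator (cbox p q) x *\<^sub>R d x" for x
    have fi: "set_integrable lebesgue (cbox a b) f" for a b
      unfolding set_integrable_def f_def by (rule integrable_mult_indicator[OF _ si[OF compact_cbox pq]]) simp
    \<comment> \<open>The extension \<open>f\<close> by zero has vanishing integrals over all boxes,
      inside \<open>\<Omega>\<close> or not, because the intersection of two boxes is a box.\<close>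
    have f0: "integral (cbox a b) f = 0" for a b
    proof -
      obtain r s where rs: "cbox p q \<inter> cbox a b = cbox r s" using Int_interval[of p q a b] by blast
      have "integral (cbox a b) f = (\<integral>x. indicator (cbox a b) x *\<^sub>R f x \<partial>lebesgue)"
        using set_lebesgue_integral_eq_integral(2)[OF fi] by (simp add: set_lebesgue_integral_def)
      also have "\<dots> = (\<integral>x. indicator (cbox r s) x *\<^sub>R d x \<partial>lebesgue)"
        unfolding rs[symmetric] f_def by (intro Bochner_Integration.integral_cong) (auto simp: indicator_def)
      also have "\<dots> = 0" using rs pq by (intro box0) auto
      finally show ?thesis .
    qed
    obtain N where N: "negligible N" "\<And>x e. x \<notin> N \<Longrightarrow> 0 < e \<Longrightarrow>
        \<exists>\<delta>>0. \<forall>h. 0 < h \<and> h < \<delta> \<longrightarrow> norm (integral (cbox x (x + h *\<^sub>R One)) f /\<^sub>R h ^ DIM('a) - f x) < e"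
      using integrable_ccontinuous_explicit[of f] set_lebesgue_integral_eq_integral(1)[OF fi] by metis
    have "f x = 0" if xN: "x \<notin> N" for x
    proof (rule ccontr)
      assume "f x \<noteq> 0"
      then obtain \<delta> where "\<delta> > 0" "\<forall>h. 0 < h \<and> h < \<delta> \<longrightarrow> norm (integral (cbox x (x + h *\<^sub>R One)) f /\<^sub>R h ^ DIM('a) - f x) < norm (f x)"
        using N(2)[OF xN, of "norm (f x)"] by auto
      then have "norm (0 - f x) < norm (f x)"
        using f0 by (metis dense scaleR_zero_right)
      then show False by simp
    qed
    moreover have "AE x in lebesgue. x \<notin> N"
      using N(1) by (intro AE_not_in) (simp add: negligible_iff_null_sets)
    ultimately have "AE x in lebesgue. f x = 0" by (auto elim: eventually_mono)
    then show ?thesis by eventually_elim (auto simp: f_def)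
  qed
  obtain D where D: "countable D" "D \<subseteq> Pow \<Omega>" "\<And>X. X \<in> D \<Longrightarrow> \<exists>a b. X = cbox a b" "\<Union>D = \<Omega>"
    using open_countable_Union_open_cbox[OF assms(1)] by metis
  have "AE x in lebesgue. \<forall>X\<in>D. x \<in> X \<longrightarrow> d x = 0"
  proof (subst AE_ball_countable[OF D(1)], rule ballI)
    fix X assume X: "X \<in> D"
    then obtain a b where "X = cbox a b" using D(3) by blast
    then show "AE x in lebesgue. x \<in> X \<longrightarrow> d x = 0" using loc[of a b] D(2) X by blast
  qed
  then have "AE x in lebesgue. x \<in> \<Omega> \<longrightarrow> d x = 0"
    by eventually_elim (use D(4) in blast)
  then show ?thesis by (simp add: AE_restrict_space_iff[OF \<Omega>])
qed

text \<open>Justifies replacing the arbitrarily chosen \<open>weak_grad\<close> by any explicit weak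
  gradient inside integrals.\<close>

lemma weak_gradient_unique:
  assumes "open \<Omega>" "has_weak_gradient \<Omega> u g" "has_weak_gradient \<Omega> u g'"
  shows "AE x in lebesgue_on \<Omega>. g x = g' x"
proof -
  have l: "locally_integrable \<Omega> g" "locally_integrable \<Omega> g'"
    using assms(2,3) by (auto simp: has_weak_gradient_def)
  have "AE x in lebesgue_on \<Omega>. g x - g' x = 0"
  proof (rule fundamental_lemma[OF assms(1)])
    show "locally_integrable \<Omega> (\<lambda>x. g x - g' x)"
      using l by (auto simp: locally_integrable_def)
    fix \<phi> assume \<phi>: "test_function \<Omega> \<phi>"
    have "(\<integral>x. \<phi> x *\<^sub>R g x \<partial>lebesgue_on \<Omega>) = (\<integral>x. \<phi> x *\<^sub>R g' x \<partial>lebesgue_on \<Omega>)"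
      using assms(2,3) \<phi> by (simp add: has_weak_gradient_def)
    then show "(\<integral>x. \<phi> x *\<^sub>R (g x - g' x) \<partial>lebesgue_on \<Omega>) = 0"
      using locally_integrable_test_integrable[OF assms(1) l(1) \<phi>]
        locally_integrable_test_integrable[OF assms(1) l(2) \<phi>] by (simp add: scaleR_diff_right)
  qed
  then show ?thesis by simp
qed

text \<open>Measurability comes with local integrability only on compact subsets, and an exhaustion
  by compacts extends it to \<open>\<Omega>\<close>. It is needed for \<open>weak_grad\<close>,
  about which nothing but the defining property of a weak gradient is known.\<close>

lemma locally_integrable_measurable:
  fixes f :: "'a::euclidean_space \<Rightarrow> 'b::euclidean_space"
  assumes "open \<Omega>" "locally_integrable \<Omega> f"
  shows "f \<in> borel_measurable (lebesgue_on \<Omega>)"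
proof -
  obtain C where C: "\<And>n. compact (C n)" "\<And>n. C n \<subseteq> \<Omega>" "\<And>n::nat. C n \<subseteq> interior (C (Suc n))" "\<Union>(range C) = \<Omega>"
    using open_Union_compact_subsets[OF assms(1)] by metis
  have mono: "C m \<subseteq> C n" if "m \<le> n" for m n
    using lift_Suc_mono_le[of C, OF _ that] C(3) interior_subset by blast
  show ?thesis
  proof (rule borel_measurable_LIMSEQ_metric[where f="\<lambda>n x. indicator (C n) x *\<^sub>R f x"])
    show "(\<lambda>x. indicator (C n) x *\<^sub>R f x) \<in> borel_measurable (lebesgue_on \<Omega>)" for n
      using assms(2) C(1,2)[of n] by (intro measurable_restrict_space1) (auto simp: locally_integrable_def set_integrable_def)
    fix x assume "x \<in> space (lebesgue_on \<Omega>)"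
    then obtain n where n: "x \<in> C n" using C(4) by auto
    have "\<forall>\<^sub>F m in sequentially. indicator (C m) x *\<^sub>R f x = f x"
      using eventually_ge_at_top[of n] by eventually_elim (use n mono in \<open>auto simp: indicator_def\<close>)
    then show "(\<lambda>n. indicator (C n) x *\<^sub>R f x) \<longlonglongrightarrow> f x" by (rule tendsto_eventually)
  qed
qed

subsection \<open>The space \<open>H10\<close>\<close>

text \<open>\<open>hlim \<Omega> u g\<close> says that \<open>u \<in> H10 \<Omega>\<close> with weak gradient \<open>g\<close>, see \<open>H10_iff\<close>.\<close>

definition hlim :: "'a::euclidean_space set \<Rightarrow> ('a \<Rightarrow> real) \<Rightarrow> ('a \<Rightarrow> 'a) \<Rightarrow> bool" where
  "hlim \<Omega> u g \<longleftrightarrow> l2 (lebesgue_on \<Omega>) u \<and> l2 (lebesgue_on \<Omega>) g \<and> (\<exists>\<phi>. (\<forall>n::nat. test_function \<Omega> (\<phi> n)) \<and>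
     (\<lambda>n. n2 (lebesgue_on \<Omega>) (\<lambda>x. \<phi> n x - u x)) \<longlonglongrightarrow> 0 \<and>
     (\<lambda>n. n2 (lebesgue_on \<Omega>) (\<lambda>x. gradient (\<phi> n) x - g x)) \<longlonglongrightarrow> 0)"

lemma hlimI:
  assumes "l2 (lebesgue_on \<Omega>) u" "l2 (lebesgue_on \<Omega>) g" "\<And>n::nat. test_function \<Omega> (\<phi> n)"
    "(\<lambda>n. n2 (lebesgue_on \<Omega>) (\<lambda>x. \<phi> n x - u x)) \<longlonglongrightarrow> 0"
    "(\<lambda>n. n2 (lebesgue_on \<Omega>) (\<lambda>x. gradient (\<phi> n) x - g x)) \<longlonglongrightarrow> 0"
  shows "hlim \<Omega> u g"
  using assms unfolding hlim_def by blast

lemma hlim_l2: "hlim \<Omega> u g \<Longrightarrow> l2 (lebesgue_on \<Omega>) u" "hlim \<Omega> u g \<Longrightarrow> l2 (lebesgue_on \<Omega>) g"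
  by (auto simp: hlim_def)

lemma hlimE:
  assumes "hlim \<Omega> u g"
  obtains \<phi> where "\<And>n::nat. test_function \<Omega> (\<phi> n)"
    "(\<lambda>n. n2 (lebesgue_on \<Omega>) (\<lambda>x. \<phi> n x - u x)) \<longlonglongrightarrow> 0"
    "(\<lambda>n. n2 (lebesgue_on \<Omega>) (\<lambda>x. gradient (\<phi> n) x - g x)) \<longlonglongrightarrow> 0"
  using assms unfolding hlim_def by blast

lemma hlim_approx:
  assumes "hlim \<Omega> u g" "e > 0"
  obtains \<phi> where "test_function \<Omega> \<phi>" "n2 (lebesgue_on \<Omega>) (\<lambda>x. \<phi> x - u x) < e"
    "n2 (lebesgue_on \<Omega>) (\<lambda>x. gradient \<phi> x - g x) < e"
proof -
  obtain \<phi> where \<phi>: "\<And>n::nat. test_function \<Omega> (\<phi> n)"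
    "(\<lambda>n. n2 (lebesgue_on \<Omega>) (\<lambda>x. \<phi> n x - u x)) \<longlonglongrightarrow> 0"
    "(\<lambda>n. n2 (lebesgue_on \<Omega>) (\<lambda>x. gradient (\<phi> n) x - g x)) \<longlonglongrightarrow> 0"
    using hlimE[OF assms(1)] by blast
  have "\<forall>\<^sub>F n in sequentially. n2 (lebesgue_on \<Omega>) (\<lambda>x. \<phi> n x - u x) < e \<and>
      n2 (lebesgue_on \<Omega>) (\<lambda>x. gradient (\<phi> n) x - g x) < e"
    using order_tendstoD(2)[OF \<phi>(2) assms(2)] order_tendstoD(2)[OF \<phi>(3) assms(2)]
    by (rule eventually_conj)
  then obtain n where "n2 (lebesgue_on \<Omega>) (\<lambda>x. \<phi> n x - u x) < e" "n2 (lebesgue_on \<Omega>) (\<lambda>x. gradient (\<phi> n) x - g x) < e"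
    using eventually_happens' sequentially_bot by blast
  then show ?thesis using that \<phi>(1) by blast
qed

lemma finite_measure_lebesgue_on_bounded:
  assumes "open \<Omega>" "bounded \<Omega>" shows "finite_measure (lebesgue_on \<Omega>)"
  using assms by (intro finite_measure_lebesgue_on bounded_set_imp_lmeasurable) auto

lemma l2_const:
  assumes "open \<Omega>" "bounded \<Omega>" shows "l2 (lebesgue_on \<Omega>) (\<lambda>x. c)"
  using finite_measure.integrable_const[OF finite_measure_lebesgue_on_bounded[OF assms]] by (simp add: l2_def)

lemma l2_locally_integrable:
  fixes f :: "'a::euclidean_space \<Rightarrow> 'b::euclidean_space"
  assumes "open \<Omega>" "bounded \<Omega>" "l2 (lebesgue_on \<Omega>) f"
  shows "locally_integrable \<Omega> f"
proof -
  have "integrable (lebesgue_on \<Omega>) f"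
    using l2_scaleR_integrable[OF l2_const[OF assms(1,2), of 1] assms(3)] by simp
  then have "set_integrable lebesgue \<Omega> f"
    using assms(1) by (subst (asm) integrable_restrict_space) (auto simp: set_integrable_def)
  then show ?thesis
    unfolding locally_integrable_def by (auto intro!: set_integrable_subset[of lebesgue \<Omega> f] dest: compact_imp_closed)
qed

text \<open>Integration by parts holds for the approximating test functions, and both sides pass to
  the limit by Cauchy-Schwarz. Boundedness of \<open>\<Omega>\<close> turns square integrability
  into local integrability.\<close>

lemma hlim_weak_gradient:
  assumes "open \<Omega>" "bounded \<Omega>" "hlim \<Omega> u g"
  shows "has_weak_gradient \<Omega> u g"
proof -
  obtain \<phi> where \<phi>: "\<And>n::nat. test_function \<Omega> (\<phi> n)"
    "(\<lambda>n. n2 (lebesgue_on \<Omega>) (\<lambda>x. \<phi> n x - u x)) \<longlonglongrightarrow> 0"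
    "(\<lambda>n. n2 (lebesgue_on \<Omega>) (\<lambda>x. gradient (\<phi> n) x - g x)) \<longlonglongrightarrow> 0"
    using hlimE[OF assms(3)] by blast
  note l = test_function_l2[OF assms(1) \<phi>(1)] hlim_l2[OF assms(3)]
  have "(\<integral>x. u x *\<^sub>R gradient \<psi> x \<partial>lebesgue_on \<Omega>) = - (\<integral>x. \<psi> x *\<^sub>R g x \<partial>lebesgue_on \<Omega>)"
    if \<psi>: "test_function \<Omega> \<psi>" for \<psi>
  proof -
    note l\<psi> = test_function_l2[OF assms(1) \<psi>]
    have c1: "(\<integral>x. \<phi> n x *\<^sub>R gradient \<psi> x \<partial>lebesgue_on \<Omega>) = - (\<integral>x. \<psi> x *\<^sub>R gradient (\<phi> n) x \<partial>lebesgue_on \<Omega>)" for n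
    proof -
      have m: "(\<lambda>x. \<phi> n x *\<^sub>R gradient \<psi> x) \<in> borel_measurable borel" "(\<lambda>x. \<psi> x *\<^sub>R gradient (\<phi> n) x) \<in> borel_measurable borel"
        by (intro borel_measurable_scaleR test_function_measurable[OF \<phi>(1)] test_function_measurable[OF \<psi>])+
      show ?thesis
        using lebesgue_on_eq_lborel(1)[OF assms(1) m(1)] lebesgue_on_eq_lborel(1)[OF assms(1) m(2)]
          test_function_outside[OF \<psi>] test_function_integration_by_parts[OF \<psi> \<phi>(1)] by simp
    qed
    have c2: "(\<lambda>n. \<integral>x. \<psi> x *\<^sub>R gradient (\<phi> n) x \<partial>lebesgue_on \<Omega>) \<longlonglongrightarrow> (\<integral>x. \<psi> x *\<^sub>R g x \<partial>lebesgue_on \<Omega>)"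
      by (rule l2_tendsto_scaleR[OF l(2,6) \<phi>(3) l\<psi>(1)])
    have c3: "(\<lambda>n. \<integral>x. \<phi> n x *\<^sub>R gradient \<psi> x \<partial>lebesgue_on \<Omega>) \<longlonglongrightarrow> (\<integral>x. u x *\<^sub>R gradient \<psi> x \<partial>lebesgue_on \<Omega>)"
    proof -
      have "(\<lambda>n. (\<integral>x. \<phi> n x *\<^sub>R gradient \<psi> x \<partial>lebesgue_on \<Omega>) - (\<integral>x. u x *\<^sub>R gradient \<psi> x \<partial>lebesgue_on \<Omega>)) \<longlonglongrightarrow> 0"
      proof (rule Lim_null_comparison)
        show "(\<lambda>n. n2 (lebesgue_on \<Omega>) (\<lambda>x. \<phi> n x - u x) * n2 (lebesgue_on \<Omega>) (gradient \<psi>)) \<longlonglongrightarrow> 0"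
          by (rule tendsto_mult_left_zero[OF \<phi>(2)])
        have "(\<integral>x. \<phi> n x *\<^sub>R gradient \<psi> x \<partial>lebesgue_on \<Omega>) - (\<integral>x. u x *\<^sub>R gradient \<psi> x \<partial>lebesgue_on \<Omega>)
          = (\<integral>x. (\<phi> n x - u x) *\<^sub>R gradient \<psi> x \<partial>lebesgue_on \<Omega>)" for n
          using l2_scaleR_integrable[OF l(1) l\<psi>(2), of n] l2_scaleR_integrable[OF l(5) l\<psi>(2)]
          by (simp add: scaleR_diff_left)
        then show "\<forall>\<^sub>F n in sequentially. norm ((\<integral>x. \<phi> n x *\<^sub>R gradient \<psi> x \<partial>lebesgue_on \<Omega>) - (\<integral>x. u x *\<^sub>R gradient \<psi> x \<partial>lebesgue_on \<Omega>))
            \<le> n2 (lebesgue_on \<Omega>) (\<lambda>x. \<phi> n x - u x) * n2 (lebesgue_on \<Omega>) (gradient \<psi>)"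
          using l2_Cauchy_Schwarz_scaleR[OF l2_diff[OF l(1,5)] l\<psi>(2)] by simp
      qed
      then show ?thesis by (simp add: LIM_zero_iff)
    qed
    show ?thesis by (rule LIMSEQ_unique[OF c3[unfolded c1] tendsto_minus[OF c2]])
  qed
  then show ?thesis
    using l2_locally_integrable[OF assms(1,2) l(5)] l2_locally_integrable[OF assms(1,2) l(6)]
    by (simp add: has_weak_gradient_def)
qed

lemma weak_grad_AE:
  assumes "open \<Omega>" "has_weak_gradient \<Omega> u g"
  shows "AE x in lebesgue_on \<Omega>. weak_grad \<Omega> u x = g x" "weak_grad \<Omega> u \<in> borel_measurable (lebesgue_on \<Omega>)"
proof -
  have w: "has_weak_gradient \<Omega> u (weak_grad \<Omega> u)"
    unfolding weak_grad_def by (rule someI[of "has_weak_gradient \<Omega> u", OF assms(2)])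
  show "AE x in lebesgue_on \<Omega>. weak_grad \<Omega> u x = g x"
    by (rule weak_gradient_unique[OF assms(1) w assms(2)])
  show "weak_grad \<Omega> u \<in> borel_measurable (lebesgue_on \<Omega>)"
    using w by (intro locally_integrable_measurable[OF assms(1)]) (simp add: has_weak_gradient_def)
qed

lemma hlim_weak_grad:
  assumes "open \<Omega>" "bounded \<Omega>" "hlim \<Omega> u g"
  shows "AE x in lebesgue_on \<Omega>. weak_grad \<Omega> u x = g x" "weak_grad \<Omega> u \<in> borel_measurable (lebesgue_on \<Omega>)"
  using weak_grad_AE[OF assms(1) hlim_weak_gradient[OF assms]] by auto

lemma hlim_dirichlet_energy:
  assumes "open \<Omega>" "bounded \<Omega>" "hlim \<Omega> u g"
  shows "dirichlet_energy \<Omega> u = (n2 (lebesgue_on \<Omega>) g)\<^sup>2"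
proof -
  have "n2 (lebesgue_on \<Omega>) (weak_grad \<Omega> u) = n2 (lebesgue_on \<Omega>) g"
    by (rule n2_cong_AE[OF hlim_weak_grad[OF assms] l2_measurable[OF hlim_l2(2)[OF assms(3)]]])
  then show ?thesis by (simp add: dirichlet_energy_def flip: n2_power2)
qed

text \<open>Frees the rest of the proof from \<open>weak_grad\<close>: membership in
  \<open>H10 \<Omega>\<close> is handled through any explicit limit \<open>g\<close> of gradients,
  which agrees with \<open>weak_grad \<Omega> u\<close> almost everywhere.\<close>

lemma H10_iff:
  assumes "open \<Omega>" "bounded \<Omega>"
  shows "u \<in> H10 \<Omega> \<longleftrightarrow> (\<exists>g. hlim \<Omega> u g)"
proof
  assume u: "u \<in> H10 \<Omega>"
  then obtain g where g: "has_weak_gradient \<Omega> u g" "l2 (lebesgue_on \<Omega>) g" "l2 (lebesgue_on \<Omega>) u"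
    by (auto simp: H10_def H1_def L2_on_eq)
  note w = weak_grad_AE[OF assms(1) g(1)]
  have "l2 (lebesgue_on \<Omega>) (weak_grad \<Omega> u)"
    by (rule l2_cong_AE[OF _ g(2) w(2)]) (use w(1) in \<open>auto elim: eventually_mono\<close>)
  then have "hlim \<Omega> u (weak_grad \<Omega> u)"
    using u g(3) by (auto simp: H10_def hlim_def L2_norm_on_eq)
  then show "\<exists>g. hlim \<Omega> u g" by blast
next
  assume "\<exists>g. hlim \<Omega> u g"
  then obtain g where g: "hlim \<Omega> u g" by blast
  note w = hlim_weak_grad[OF assms g] and l = hlim_l2[OF g]
  obtain \<phi> where \<phi>: "\<And>n::nat. test_function \<Omega> (\<phi> n)"
    "(\<lambda>n. n2 (lebesgue_on \<Omega>) (\<lambda>x. \<phi> n x - u x)) \<longlonglongrightarrow> 0"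
    "(\<lambda>n. n2 (lebesgue_on \<Omega>) (\<lambda>x. gradient (\<phi> n) x - g x)) \<longlonglongrightarrow> 0"
    using hlimE[OF g] by blast
  have "n2 (lebesgue_on \<Omega>) (\<lambda>x. gradient (\<phi> n) x - weak_grad \<Omega> u x) = n2 (lebesgue_on \<Omega>) (\<lambda>x. gradient (\<phi> n) x - g x)" for n
    by (rule n2_cong_AE) (use w l2_measurable[OF l(2)] l2_measurable[OF test_function_l2(2)[OF assms(1) \<phi>(1)]] in \<open>auto elim: eventually_mono\<close>)
  then show "u \<in> H10 \<Omega>"
    using \<phi> l hlim_weak_gradient[OF assms g]
    by (auto simp: H10_def H1_def L2_on_eq L2_norm_on_eq intro!: exI[of _ \<phi>] exI[of _ g])
qed

lemma hlim_test_function: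
  assumes "open \<Omega>" "test_function \<Omega> \<phi>" shows "hlim \<Omega> \<phi> (gradient \<phi>)"
  by (rule hlimI[where \<phi>="\<lambda>_. \<phi>"]) (use test_function_l2[OF assms] assms in \<open>auto simp: n2_def\<close>)

section \<open>Closure properties of \<open>H10\<close>\<close>

lemma hlim_add:
  assumes "open \<Omega>" "hlim \<Omega> u g" "hlim \<Omega> v h"
  shows "hlim \<Omega> (\<lambda>x. u x + v x) (\<lambda>x. g x + h x)"
proof -
  obtain \<phi> where \<phi>: "\<And>n::nat. test_function \<Omega> (\<phi> n)"
    "(\<lambda>n. n2 (lebesgue_on \<Omega>) (\<lambda>x. \<phi> n x - u x)) \<longlonglongrightarrow> 0"
    "(\<lambda>n. n2 (lebesgue_on \<Omega>) (\<lambda>x. gradient (\<phi> n) x - g x)) \<longlonglongrightarrow> 0"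
    using hlimE[OF assms(2)] by blast
  obtain \<psi> where \<psi>: "\<And>n::nat. test_function \<Omega> (\<psi> n)"
    "(\<lambda>n. n2 (lebesgue_on \<Omega>) (\<lambda>x. \<psi> n x - v x)) \<longlonglongrightarrow> 0"
    "(\<lambda>n. n2 (lebesgue_on \<Omega>) (\<lambda>x. gradient (\<psi> n) x - h x)) \<longlonglongrightarrow> 0"
    using hlimE[OF assms(3)] by blast
  note l = test_function_l2[OF assms(1) \<phi>(1)] test_function_l2[OF assms(1) \<psi>(1)]
    hlim_l2[OF assms(2)] hlim_l2[OF assms(3)]
  have "gradient (\<lambda>x. \<phi> n x + \<psi> n x) = (\<lambda>x. gradient (\<phi> n) x + gradient (\<psi> n) x)" for n
    by (rule ext, rule gradient_add) (use test_function_differentiable \<phi>(1) \<psi>(1) in blast)+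
  then show ?thesis
    by (intro hlimI[where \<phi>="\<lambda>n x. \<phi> n x + \<psi> n x"] l2_add l test_function_add \<phi>(1) \<psi>(1))
      (simp_all add: l2_conv_add[OF l(1,9) \<phi>(2) l(5,11) \<psi>(2)] l2_conv_add[OF l(2,10) \<phi>(3) l(6,12) \<psi>(3)])
qed

text \<open>Diagonal choice: take a test function within \<open>1 / Suc n\<close> of the
  \<open>n\<close>-th element, in norm and in gradient.\<close>

lemma hlim_closed:
  assumes "open \<Omega>" "\<And>n::nat. hlim \<Omega> (u n) (g n)" "l2 (lebesgue_on \<Omega>) v" "l2 (lebesgue_on \<Omega>) h"
    and cu: "(\<lambda>n. n2 (lebesgue_on \<Omega>) (\<lambda>x. u n x - v x)) \<longlonglongrightarrow> 0"
    and cg: "(\<lambda>n. n2 (lebesgue_on \<Omega>) (\<lambda>x. g n x - h x)) \<longlonglongrightarrow> 0"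
  shows "hlim \<Omega> v h"
proof -
  let ?M = "lebesgue_on \<Omega>"
  have "\<exists>\<phi>. test_function \<Omega> \<phi> \<and> n2 ?M (\<lambda>x. \<phi> x - u n x) < 1 / Suc n \<and> n2 ?M (\<lambda>x. gradient \<phi> x - g n x) < 1 / Suc n" for n
    using hlim_approx[OF assms(2), of "1 / Suc n" n] by (metis of_nat_0_less_iff zero_less_Suc zero_less_divide_1_iff)
  then obtain \<phi> where \<phi>: "\<And>n. test_function \<Omega> (\<phi> n)" "\<And>n. n2 ?M (\<lambda>x. \<phi> n x - u n x) < 1 / Suc n"
    "\<And>n. n2 ?M (\<lambda>x. gradient (\<phi> n) x - g n x) < 1 / Suc n"
    by metis
  have z: "(\<lambda>n. 1 / real (Suc n)) \<longlonglongrightarrow> 0" using LIMSEQ_inverse_real_of_nat by (simp add: inverse_eq_divide)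
  note l = test_function_l2[OF assms(1) \<phi>(1)] hlim_l2[OF assms(2)]
  show ?thesis
  proof (rule hlimI[OF assms(3,4) \<phi>(1)])
    show "(\<lambda>n. n2 ?M (\<lambda>x. \<phi> n x - v x)) \<longlonglongrightarrow> 0"
    proof (rule Lim_null_comparison[OF _ tendsto_add_zero[OF z cu]], rule always_eventually, rule allI)
      fix n
      show "norm (n2 ?M (\<lambda>x. \<phi> n x - v x)) \<le> 1 / real (Suc n) + n2 ?M (\<lambda>x. u n x - v x)"
        using n2_triangle_diff[OF l(1) l(5) assms(3), of n n] \<phi>(2)[of n] by simp
    qed
    show "(\<lambda>n. n2 ?M (\<lambda>x. gradient (\<phi> n) x - h x)) \<longlonglongrightarrow> 0"
    proof (rule Lim_null_comparison[OF _ tendsto_add_zero[OF z cg]], rule always_eventually, rule allI)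
      fix n
      show "norm (n2 ?M (\<lambda>x. gradient (\<phi> n) x - h x)) \<le> 1 / real (Suc n) + n2 ?M (\<lambda>x. g n x - h x)"
        using n2_triangle_diff[OF l(2) l(6) assms(4), of n n] \<phi>(3)[of n] by simp
    qed
  qed
qed

lemma n2_bound_tendsto_0:
  assumes "(\<lambda>n. n2 M (q n)) \<longlonglongrightarrow> 0" "\<And>n. l2 M (q n)" "\<And>n x. x \<in> space M \<Longrightarrow> norm (p n x) \<le> B * norm (q n x)"
  shows "(\<lambda>n. n2 M (p n)) \<longlonglongrightarrow> 0"
proof (rule Lim_null_comparison)
  show "(\<lambda>n. \<bar>B\<bar> * n2 M (q n)) \<longlonglongrightarrow> 0" by (rule tendsto_mult_right_zero[OF assms(1)])
  have "n2 M (p n) \<le> n2 M (\<lambda>x. \<bar>B\<bar> *\<^sub>R q n x)" for n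
  proof (rule n2_mono[OF l2_scaleR[OF assms(2)]], rule AE_I2)
    fix x assume "x \<in> space M"
    from assms(3)[OF this, of n] mult_right_mono[OF abs_ge_self[of B] norm_ge_zero[of "q n x"]]
    show "norm (p n x) \<le> norm (\<bar>B\<bar> *\<^sub>R q n x)" by simp
  qed
  then show "\<forall>\<^sub>F n in sequentially. norm (n2 M (p n)) \<le> \<bar>B\<bar> * n2 M (q n)"
    by (simp add: n2_scaleR)
qed

lemma hlim_mult_smooth:
  fixes \<eta> :: "'a::euclidean_space \<Rightarrow> real"
  assumes "open \<Omega>" "hlim \<Omega> u g" "\<And>k. C_k k \<eta>" "\<And>x. \<bar>\<eta> x\<bar> \<le> B" "\<And>x. norm (gradient \<eta> x) \<le> B"
  shows "hlim \<Omega> (\<lambda>x. \<eta> x * u x) (\<lambda>x. \<eta> x *\<^sub>R g x + u x *\<^sub>R gradient \<eta> x)"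
proof -
  let ?M = "lebesgue_on \<Omega>"
  obtain \<phi> where \<phi>: "\<And>n::nat. test_function \<Omega> (\<phi> n)"
    "(\<lambda>n. n2 ?M (\<lambda>x. \<phi> n x - u x)) \<longlonglongrightarrow> 0"
    "(\<lambda>n. n2 ?M (\<lambda>x. gradient (\<phi> n) x - g x)) \<longlonglongrightarrow> 0"
    using hlimE[OF assms(2)] by blast
  note l = test_function_l2[OF assms(1) \<phi>(1)] hlim_l2[OF assms(2)]
  have \<eta>m: "\<eta> \<in> borel_measurable ?M" "gradient \<eta> \<in> borel_measurable ?M"
    using assms(3)[of 0] continuous_gradient[OF assms(3)]
    by (auto intro!: borel_measurable_lebesgue_on borel_measurable_continuous_onI)
  have b: "l2 ?M (\<lambda>x. \<eta> x * f x)" "l2 ?M (\<lambda>x. f x *\<^sub>R gradient \<eta> x)" if "l2 ?M f" for f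
  proof -
    note fm = l2_measurable[OF that]
    show "l2 ?M (\<lambda>x. \<eta> x * f x)"
      by (rule l2_boundI[OF that, where C=B])
        (use \<eta>m fm assms(4) in \<open>auto simp: abs_mult intro!: borel_measurable_times mult_right_mono\<close>)
    show "l2 ?M (\<lambda>x. f x *\<^sub>R gradient \<eta> x)"
      by (rule l2_boundI[OF that, where C=B])
        (use \<eta>m fm assms(5) in \<open>auto simp: mult.commute[of B] intro!: borel_measurable_scaleR mult_left_mono\<close>)
  qed
  have c: "l2 ?M (\<lambda>x. \<eta> x *\<^sub>R f x)" if "l2 ?M f" for f :: "'a \<Rightarrow> 'a"
    by (rule l2_boundI[OF that, where C=B])
      (use \<eta>m l2_measurable[OF that] assms(4) in \<open>auto intro!: borel_measurable_scaleR mult_right_mono\<close>)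
  have gr: "gradient (\<lambda>x. \<eta> x * \<phi> n x) = (\<lambda>x. \<eta> x *\<^sub>R gradient (\<phi> n) x + \<phi> n x *\<^sub>R gradient \<eta> x)" for n
    by (rule ext, rule gradient_mult) (use C_1_differentiable[OF assms(3)] test_function_differentiable[OF \<phi>(1)] in auto)
  show ?thesis
  proof (rule hlimI[where \<phi>="\<lambda>n x. \<eta> x * \<phi> n x"])
    show "l2 ?M (\<lambda>x. \<eta> x * u x)" by (rule b[OF l(5)])
    show "l2 ?M (\<lambda>x. \<eta> x *\<^sub>R g x + u x *\<^sub>R gradient \<eta> x)" by (intro l2_add b c l)
    show "test_function \<Omega> (\<lambda>x. \<eta> x * \<phi> n x)" for n by (intro test_function_mult \<phi> assms)
    show "(\<lambda>n. n2 ?M (\<lambda>x. \<eta> x * \<phi> n x - \<eta> x * u x)) \<longlonglongrightarrow> 0"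
      by (rule n2_bound_tendsto_0[OF \<phi>(2) l2_diff[OF l(1,5)], of _ B])
        (use assms(4) in \<open>auto simp: abs_mult mult_right_mono simp flip: right_diff_distrib\<close>)
    have 1: "(\<lambda>n. n2 ?M (\<lambda>x. \<eta> x *\<^sub>R gradient (\<phi> n) x - \<eta> x *\<^sub>R g x)) \<longlonglongrightarrow> 0"
      by (rule n2_bound_tendsto_0[OF \<phi>(3) l2_diff[OF l(2,6)], of _ B])
        (use assms(4) in \<open>auto simp: mult_right_mono simp flip: scaleR_diff_right\<close>)
    have 2: "(\<lambda>n. n2 ?M (\<lambda>x. \<phi> n x *\<^sub>R gradient \<eta> x - u x *\<^sub>R gradient \<eta> x)) \<longlonglongrightarrow> 0"
      by (rule n2_bound_tendsto_0[OF \<phi>(2) l2_diff[OF l(1,5)], of _ B])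
        (use assms(5) in \<open>auto simp: mult_left_mono mult.commute[of B] simp flip: scaleR_diff_left\<close>)
    show "(\<lambda>n. n2 ?M (\<lambda>x. gradient (\<lambda>x. \<eta> x * \<phi> n x) x - (\<eta> x *\<^sub>R g x + u x *\<^sub>R gradient \<eta> x))) \<longlonglongrightarrow> 0"
      unfolding gr by (rule l2_conv_add[OF c[OF l(2)] c[OF l(6)] 1 b(2)[OF l(1)] b(2)[OF l(5)] 2])
  qed
qed

lemma hlim_cmult:
  assumes "open \<Omega>" "hlim \<Omega> u g" shows "hlim \<Omega> (\<lambda>x. c * u x) (\<lambda>x. c *\<^sub>R g x)"
proof -
  have z: "gradient (\<lambda>x. c) = (\<lambda>x. 0)" by (rule ext, rule gradient_eqI) simp
  show ?thesis
    using hlim_mult_smooth[OF assms, of "\<lambda>x. c" "\<bar>c\<bar>"] by (simp add: z C_k_const)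
qed

lemma hlim_diff:
  assumes "open \<Omega>" "hlim \<Omega> u g" "hlim \<Omega> v h"
  shows "hlim \<Omega> (\<lambda>x. u x - v x) (\<lambda>x. g x - h x)"
  using hlim_add[OF assms(1,2) hlim_cmult[OF assms(1,3), of "-1"]] by simp

text \<open>Chain rule. The error of the gradients splits into
  \<open>step (c * \<phi> n) (D\<phi> n - g)\<close>, small in norm since \<open>step\<close> is
  bounded, and \<open>(step (c * \<phi> n) - step (c * u)) g\<close>, which tends to 0 by dominated
  convergence. The latter needs convergence almost everywhere, hence the passage to a
  subsequence.\<close>

lemma hlim_ramp:
  assumes "open \<Omega>" "hlim \<Omega> u g" "c > 0"
  shows "hlim \<Omega> (\<lambda>x. (1 / c) * ramp (c * u x)) (\<lambda>x. step (c * u x) *\<^sub>R g x)"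
proof -
  let ?M = "lebesgue_on \<Omega>"
  obtain \<phi>0 where \<phi>0: "\<And>n::nat. test_function \<Omega> (\<phi>0 n)"
    "(\<lambda>n. n2 ?M (\<lambda>x. \<phi>0 n x - u x)) \<longlonglongrightarrow> 0"
    "(\<lambda>n. n2 ?M (\<lambda>x. gradient (\<phi>0 n) x - g x)) \<longlonglongrightarrow> 0"
    using hlimE[OF assms(2)] by blast
  obtain r :: "nat \<Rightarrow> nat" where r: "strict_mono r" "AE x in ?M. (\<lambda>n. \<phi>0 (r n) x) \<longlonglongrightarrow> u x"
    using l2_conv_AE_subseq[OF test_function_l2(1)[OF assms(1) \<phi>0(1)] hlim_l2(1)[OF assms(2)] \<phi>0(2)] by blast
  define \<phi> where "\<phi> n = \<phi>0 (r n)" for n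
  have \<phi>: "test_function \<Omega> (\<phi> n)" for n by (simp add: \<phi>_def \<phi>0)
  have cu: "(\<lambda>n. n2 ?M (\<lambda>x. \<phi> n x - u x)) \<longlonglongrightarrow> 0"
    using LIMSEQ_subseq_LIMSEQ[OF \<phi>0(2) r(1)] by (simp add: \<phi>_def o_def)
  have cg: "(\<lambda>n. n2 ?M (\<lambda>x. gradient (\<phi> n) x - g x)) \<longlonglongrightarrow> 0"
    using LIMSEQ_subseq_LIMSEQ[OF \<phi>0(3) r(1)] by (simp add: \<phi>_def o_def)
  have ae: "AE x in ?M. (\<lambda>n. \<phi> n x) \<longlonglongrightarrow> u x" using r(2) by (simp add: \<phi>_def)
  note l = test_function_l2[OF assms(1) \<phi>] hlim_l2[OF assms(2)]
  note m = l(1,2,5,6)[THEN l2_measurable]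
  have cs: "continuous_on UNIV step" "continuous_on UNIV ramp" using C_k_step[of 0] C_k_ramp[of 0] by auto
  have sm: "(\<lambda>x. step (c * f x)) \<in> borel_measurable ?M" "(\<lambda>x. (1 / c) * ramp (c * f x)) \<in> borel_measurable ?M"
    if [measurable]: "f \<in> borel_measurable ?M" for f
  proof -
    have [measurable]: "step \<in> borel_measurable borel" "ramp \<in> borel_measurable borel"
      using cs by (auto intro: borel_measurable_continuous_onI)
    show "(\<lambda>x. step (c * f x)) \<in> borel_measurable ?M" "(\<lambda>x. (1 / c) * ramp (c * f x)) \<in> borel_measurable ?M"
      by measurable
  qed
  have rl: "\<bar>(1 / c) * ramp (c * s) - (1 / c) * ramp (c * t)\<bar> \<le> \<bar>s - t\<bar>" for s t
  proof -
    have "\<bar>(1 / c) * ramp (c * s) - (1 / c) * ramp (c * t)\<bar> = (1 / c) * \<bar>ramp (c * s) - ramp (c * t)\<bar>"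
      using assms(3) by (simp add: abs_mult flip: right_diff_distrib diff_divide_distrib)
    also have "\<dots> \<le> (1 / c) * \<bar>c * s - c * t\<bar>"
      using assms(3) by (intro mult_left_mono ramp_lipschitz) auto
    also have "\<dots> = \<bar>s - t\<bar>" using assms(3) by (simp add: abs_mult flip: right_diff_distrib)
    finally show ?thesis .
  qed
  have hd: "((\<lambda>t. (1 / c) * ramp (c * t)) has_real_derivative step (c * t)) (at t)" for t
    using assms(3) by (auto intro!: derivative_eq_intros DERIV_chain2[OF ramp_deriv])
  have hC: "C_k k (\<lambda>t. (1 / c) * ramp (c * t))" for k
    using C_k_cmult[OF C_k_affine[OF C_k_ramp, of k c 0], of "1 / c"] by simp
  have gr: "gradient (\<lambda>x. (1 / c) * ramp (c * \<phi> n x)) = (\<lambda>x. step (c * \<phi> n x) *\<^sub>R gradient (\<phi> n) x)" for n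
    by (rule ext, rule gradient_comp[OF test_function_differentiable[OF \<phi>] hd])
  have sb: "norm (step (c * f x) *\<^sub>R v) \<le> norm v" for f :: "'a \<Rightarrow> real" and x and v :: 'a
    using step_nonneg[of "c * f x"] step_le_1[of "c * f x"] by (auto intro: mult_left_le_one_le)
  have lS: "l2 ?M (\<lambda>x. step (c * f x) *\<^sub>R G x)" if "f \<in> borel_measurable ?M" "l2 ?M G" for f and G :: "'a \<Rightarrow> 'a"
    by (rule l2_boundI[OF that(2), where C=1])
      (use sb sm(1)[OF that(1)] l2_measurable[OF that(2)] in \<open>auto intro!: borel_measurable_scaleR simp del: norm_scaleR\<close>)
  show ?thesis
  proof (rule hlimI[where \<phi>="\<lambda>n x. (1 / c) * ramp (c * \<phi> n x)"])
    show "l2 ?M (\<lambda>x. (1 / c) * ramp (c * u x))"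
      by (rule l2_boundI[OF l(5), where C=1]) (use rl[of _ 0] sm(2)[OF m(3)] in \<open>auto simp: ramp_0\<close>)
    show "l2 ?M (\<lambda>x. step (c * u x) *\<^sub>R g x)" by (rule lS[OF m(3) l(6)])
    show "test_function \<Omega> (\<lambda>x. (1 / c) * ramp (c * \<phi> n x))" for n
      by (rule test_function_comp[OF \<phi> hC]) (simp add: ramp_0)
    show "(\<lambda>n. n2 ?M (\<lambda>x. (1 / c) * ramp (c * \<phi> n x) - (1 / c) * ramp (c * u x))) \<longlonglongrightarrow> 0"
      by (rule n2_bound_tendsto_0[OF cu l2_diff[OF l(1,5)], of _ 1]) (use rl in auto)
    have 1: "(\<lambda>n. n2 ?M (\<lambda>x. step (c * \<phi> n x) *\<^sub>R (gradient (\<phi> n) x - g x) - 0)) \<longlonglongrightarrow> 0"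
      by (rule n2_bound_tendsto_0[OF cg l2_diff[OF l(2,6)], of _ 1]) (use sb in \<open>simp del: norm_scaleR\<close>)
    have 2: "(\<lambda>n. n2 ?M (\<lambda>x. step (c * \<phi> n x) *\<^sub>R g x - step (c * u x) *\<^sub>R g x)) \<longlonglongrightarrow> 0"
    proof (rule l2_dominated(3)[OF _ _ l(6)])
      show "AE x in ?M. (\<lambda>n. step (c * \<phi> n x) *\<^sub>R g x) \<longlonglongrightarrow> step (c * u x) *\<^sub>R g x"
        using ae
      proof eventually_elim
        case (elim x)
        have "isCont step (c * u x)" using cs(1) by (simp add: continuous_on_eq_continuous_at)
        then have "(\<lambda>n. step (c * \<phi> n x)) \<longlonglongrightarrow> step (c * u x)"
          by (rule isCont_tendsto_compose) (intro tendsto_intros elim)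
        then show ?case by (intro tendsto_intros)
      qed
      show "AE x in ?M. norm (step (c * \<phi> n x) *\<^sub>R g x) \<le> norm (g x)" for n
        using sb by (intro AE_I2)
    qed (use lS[OF m(1) l(6)] lS[OF m(3) l(6)] l2_measurable in blast)+
    have 3: "l2 ?M (\<lambda>x. 0::'a)" by simp
    show "(\<lambda>n. n2 ?M (\<lambda>x. gradient (\<lambda>x. (1 / c) * ramp (c * \<phi> n x)) x - step (c * u x) *\<^sub>R g x)) \<longlonglongrightarrow> 0"
      using l2_conv_add[OF lS[OF m(1) l2_diff[OF l(2,6)]] 3 1 lS[OF m(1) l(6)] lS[OF m(3) l(6)] 2]
      unfolding gr by (simp add: algebra_simps)
  qed
qed

text \<open>Let the steepness of the smoothed positive part tend to infinity. The derivatives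
  \<open>step (c * t)\<close> tend to the indicator of \<open>t > 0\<close>, with value 0 at
  \<open>t = 0\<close> because \<open>step\<close> vanishes there, so the gradient is cut off on the
  zero set of \<open>u\<close>.\<close>

lemma hlim_pos_part:
  assumes "open \<Omega>" "hlim \<Omega> u g"
  shows "hlim \<Omega> (pos_part u) (\<lambda>x. if u x > 0 then g x else 0)"
proof -
  let ?M = "lebesgue_on \<Omega>"
  define c where "c k = real (Suc k)" for k
  have c: "c k > 0" for k by (simp add: c_def)
  have cinf: "(\<lambda>k. 1 / c k) \<longlonglongrightarrow> 0"
    using LIMSEQ_inverse_real_of_nat by (simp add: c_def inverse_eq_divide)
  note h = hlim_ramp[OF assms c]
  note l = hlim_l2[OF assms(2)] and lh = hlim_l2[OF h]
  note m [measurable] = l[THEN l2_measurable]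
  have 1: "(\<lambda>k. (1 / c k) * ramp (c k * t)) \<longlonglongrightarrow> max t 0" for t
  proof (rule LIM_zero_cancel, rule Lim_null_comparison[OF _ cinf], rule always_eventually, rule allI)
    fix k
    have mx: "max t 0 = (1 / c k) * max (c k * t) 0"
      using c[of k] by (auto simp: max_def zero_le_mult_iff mult_le_0_iff)
    have "norm ((1 / c k) * ramp (c k * t) - max t 0) = (1 / c k) * \<bar>ramp (c k * t) - max (c k * t) 0\<bar>"
      unfolding mx using c[of k] by (simp add: abs_mult flip: right_diff_distrib diff_divide_distrib)
    also have "\<dots> \<le> (1 / c k) * 1"
      using c[of k] by (intro mult_left_mono ramp_approx) auto
    finally show "norm ((1 / c k) * ramp (c k * t) - max t 0) \<le> 1 / c k" by simp
  qed
  have 2: "(\<lambda>k. step (c k * t) *\<^sub>R v) \<longlonglongrightarrow> (if t > 0 then v else 0)" for t and v :: 'a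
  proof (cases "t > 0")
    case True
    obtain K :: nat where K: "1 / t \<le> real K" using real_arch_simple by blast
    have "\<forall>\<^sub>F k in sequentially. step (c k * t) *\<^sub>R v = v"
      using eventually_ge_at_top[of K]
    proof eventually_elim
      case (elim k)
      then have "1 / t \<le> c k" using K by (simp add: c_def)
      then show ?case using True by (simp add: step_1 field_simps)
    qed
    then show ?thesis using True by (auto intro: tendsto_eventually)
  next
    case False
    then have "c k * t \<le> 0" for k using c[of k] by (simp add: mult_le_0_iff)
    then show ?thesis using False by (simp add: step_0)
  qed
  have rb: "\<bar>(1 / c k) * ramp (c k * t)\<bar> \<le> \<bar>t\<bar>" for k t
    using ramp_lipschitz[of "c k * t" 0] c[of k] by (simp add: ramp_0 abs_mult field_simps)
  have a: "l2 ?M (pos_part u)" "(\<lambda>k. n2 ?M (\<lambda>x. (1 / c k) * ramp (c k * u x) - pos_part u x)) \<longlonglongrightarrow> 0"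
  proof -
    have p: "pos_part u \<in> borel_measurable ?M" unfolding pos_part_def[abs_def] by measurable
    have q: "AE x in ?M. (\<lambda>k. (1 / c k) * ramp (c k * u x)) \<longlonglongrightarrow> pos_part u x"
      unfolding pos_part_def using 1 by (intro AE_I2)
    have s: "AE x in ?M. norm ((1 / c k) * ramp (c k * u x)) \<le> norm (u x)" for k
      using rb by (intro AE_I2) simp
    note d = l2_dominated[OF l2_measurable[OF lh(1)] p l(1) q s]
    show "l2 ?M (pos_part u)" "(\<lambda>k. n2 ?M (\<lambda>x. (1 / c k) * ramp (c k * u x) - pos_part u x)) \<longlonglongrightarrow> 0"
      using d(1,3) by auto
  qed
  have b: "l2 ?M (\<lambda>x. if u x > 0 then g x else 0)"
    "(\<lambda>k. n2 ?M (\<lambda>x. step (c k * u x) *\<^sub>R g x - (if u x > 0 then g x else 0))) \<longlonglongrightarrow> 0"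
  proof -
    have p: "(\<lambda>x. if u x > 0 then g x else 0) \<in> borel_measurable ?M" by measurable
    have q: "AE x in ?M. (\<lambda>k. step (c k * u x) *\<^sub>R g x) \<longlonglongrightarrow> (if u x > 0 then g x else 0)"
      using 2 by (intro AE_I2)
    have s: "AE x in ?M. norm (step (c k * u x) *\<^sub>R g x) \<le> norm (g x)" for k
      using step_nonneg step_le_1 by (intro AE_I2) (auto intro: mult_left_le_one_le)
    note d = l2_dominated[OF l2_measurable[OF lh(2)] p l(2) q s]
    show "l2 ?M (\<lambda>x. if u x > 0 then g x else 0)"
      "(\<lambda>k. n2 ?M (\<lambda>x. step (c k * u x) *\<^sub>R g x - (if u x > 0 then g x else 0))) \<longlonglongrightarrow> 0"
      using d(1,3) by auto
  qed
  show ?thesis by (rule hlim_closed[OF assms(1) h a(1) b(1) a(2) b(2)])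
qed

lemma hlim_neg_part:
  assumes "open \<Omega>" "hlim \<Omega> u g"
  shows "hlim \<Omega> (neg_part u) (\<lambda>x. if u x < 0 then - g x else 0)"
proof -
  have "hlim \<Omega> (\<lambda>x. - u x) (\<lambda>x. - g x)"
    using hlim_cmult[OF assms, of "-1"] by simp
  moreover have "pos_part (\<lambda>x. - u x) = neg_part u" by (simp add: fun_eq_iff pos_part_def neg_part_def)
  ultimately show ?thesis
    using hlim_pos_part[OF assms(1), of "\<lambda>x. - u x" "\<lambda>x. - g x"] by simp
qed

text \<open>The two summands of \<open>h\<close> live on disjoint sets, so
  \<open>norm (h x) \<le> norm (g x)\<close> everywhere. This lets a minimiser be replaced by its
  absolute value.\<close>

lemma hlim_abs:
  assumes "open \<Omega>" "hlim \<Omega> u g"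
  obtains h where "hlim \<Omega> (\<lambda>x. \<bar>u x\<bar>) h" "n2 (lebesgue_on \<Omega>) h \<le> n2 (lebesgue_on \<Omega>) g"
proof
  define h where "h x = (if u x > 0 then g x else 0) + (if u x < 0 then - g x else 0)" for x
  have "(\<lambda>x. pos_part u x + neg_part u x) = (\<lambda>x. \<bar>u x\<bar>)"
    by (auto simp: fun_eq_iff pos_part_def neg_part_def)
  then show "hlim \<Omega> (\<lambda>x. \<bar>u x\<bar>) h"
    using hlim_add[OF assms(1) hlim_pos_part[OF assms] hlim_neg_part[OF assms]] by (simp add: h_def[abs_def])
  show "n2 (lebesgue_on \<Omega>) h \<le> n2 (lebesgue_on \<Omega>) g"
    by (rule n2_mono[OF hlim_l2(2)[OF assms(2)]]) (auto simp: h_def)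
qed

subsection \<open>Scaled bump functions\<close>

text \<open>The dilated argument is written in the shape \<open>c *\<^sub>R x + a\<close> to match
  \<open>C_k_affine\<close> and \<open>gradient_affine\<close>.\<close>

lemma test_function_affine:
  assumes "test_function (ball 0 1) \<phi>" "r > 0"
  shows "test_function (ball x0 r) (\<lambda>x. \<phi> ((1 / r) *\<^sub>R x + - (1 / r) *\<^sub>R x0))"
proof -
  obtain K where K: "compact K" "K \<subseteq> ball 0 1" "\<And>x. x \<notin> K \<Longrightarrow> \<phi> x = 0"
    using assms(1) by (rule test_function_support) blast
  show ?thesis
  proof (rule test_functionI[where K="(\<lambda>y. x0 + r *\<^sub>R y) ` K"])
    show "C_k k (\<lambda>x. \<phi> ((1 / r) *\<^sub>R x + - (1 / r) *\<^sub>R x0))" for k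
      by (rule C_k_affine[OF test_function_smooth[OF assms(1)]])
    show "compact ((\<lambda>y. x0 + r *\<^sub>R y) ` K)"
      by (intro compact_continuous_image K continuous_intros)
    show "(\<lambda>y. x0 + r *\<^sub>R y) ` K \<subseteq> ball x0 r"
      using K(2) assms(2) by (auto simp: dist_norm)
    fix x assume x: "x \<notin> (\<lambda>y. x0 + r *\<^sub>R y) ` K"
    have "x = x0 + r *\<^sub>R ((1 / r) *\<^sub>R x + - (1 / r) *\<^sub>R x0)"
      using assms(2) by (simp add: algebra_simps)
    with x have "(1 / r) *\<^sub>R x + - (1 / r) *\<^sub>R x0 \<notin> K" by blast
    then show "\<phi> ((1 / r) *\<^sub>R x + - (1 / r) *\<^sub>R x0) = 0" by (rule K(3))
  qed
qed

lemma integral_lborel_scale: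
  fixes f :: "'a::euclidean_space \<Rightarrow> real"
  assumes [measurable]: "f \<in> borel_measurable borel" and "r > 0"
  shows "(\<integral>x. f ((1 / r) *\<^sub>R x + - (1 / r) *\<^sub>R x0) \<partial>lborel) = r ^ DIM('a) * (\<integral>x. f x \<partial>lborel)"
proof -
  let ?T = "\<lambda>x::'a. x0 + r *\<^sub>R x" and ?F = "\<lambda>x. f ((1 / r) *\<^sub>R x + - (1 / r) *\<^sub>R x0)"
  have "(\<integral>x. ?F x \<partial>lborel) = (\<integral>x. ?F x \<partial>density (distr lborel borel ?T) (\<lambda>_. \<bar>r\<bar> ^ DIM('a)))"
    using lborel_affine[of r x0] assms(2) by simp
  also have "\<dots> = (\<integral>x. \<bar>r\<bar> ^ DIM('a) *\<^sub>R ?F x \<partial>distr lborel borel ?T)"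
    by (rule integral_density) auto
  also have "\<dots> = (\<integral>x. \<bar>r\<bar> ^ DIM('a) *\<^sub>R ?F (?T x) \<partial>lborel)"
    by (rule integral_distr) measurable
  also have "(\<lambda>x. \<bar>r\<bar> ^ DIM('a) *\<^sub>R ?F (?T x)) = (\<lambda>x. r ^ DIM('a) * f x)"
    using assms(2) by (simp add: fun_eq_iff scaleR_add_right)
  finally show ?thesis by simp
qed

text \<open>The quotient of energy and mass thus scales like \<open>1 / r\<^sup>2\<close>, which is
  what couples \<open>r\<close> to \<open>\<beta>\<close>.\<close>

lemma n2_scaled:
  fixes \<phi> :: "'a::euclidean_space \<Rightarrow> real"
  assumes "test_function (ball 0 1) \<phi>" "r > 0"
  shows "(n2 lborel (\<lambda>x. \<phi> ((1 / r) *\<^sub>R x + - (1 / r) *\<^sub>R x0)))\<^sup>2 = r ^ DIM('a) * (n2 lborel \<phi>)\<^sup>2"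
    and "(n2 lborel (gradient (\<lambda>x. \<phi> ((1 / r) *\<^sub>R x + - (1 / r) *\<^sub>R x0))))\<^sup>2 = r ^ DIM('a) / r\<^sup>2 * (n2 lborel (gradient \<phi>))\<^sup>2"
proof -
  note [measurable] = test_function_measurable[OF assms(1)]
  show "(n2 lborel (\<lambda>x. \<phi> ((1 / r) *\<^sub>R x + - (1 / r) *\<^sub>R x0)))\<^sup>2 = r ^ DIM('a) * (n2 lborel \<phi>)\<^sup>2"
    unfolding n2_power2
    by (rule integral_lborel_scale[where f="\<lambda>x. (norm (\<phi> x))\<^sup>2", OF _ assms(2)]) measurable
  have gr: "gradient (\<lambda>x. \<phi> ((1 / r) *\<^sub>R x + - (1 / r) *\<^sub>R x0)) = (\<lambda>x. (1 / r) *\<^sub>R gradient \<phi> ((1 / r) *\<^sub>R x + - (1 / r) *\<^sub>R x0))"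
    by (rule ext, rule gradient_affine, rule test_function_differentiable[OF assms(1)])
  have e: "(\<integral>x. (norm (gradient \<phi> ((1 / r) *\<^sub>R x + - (1 / r) *\<^sub>R x0)))\<^sup>2 \<partial>lborel) = r ^ DIM('a) * (\<integral>x. (norm (gradient \<phi> x))\<^sup>2 \<partial>lborel)"
    by (rule integral_lborel_scale[where f="\<lambda>x. (norm (gradient \<phi> x))\<^sup>2", OF _ assms(2)]) measurable
  show "(n2 lborel (gradient (\<lambda>x. \<phi> ((1 / r) *\<^sub>R x + - (1 / r) *\<^sub>R x0))))\<^sup>2 = r ^ DIM('a) / r\<^sup>2 * (n2 lborel (gradient \<phi>))\<^sup>2"
    unfolding gr n2_scaleR power_mult_distrib n2_power2 e by (simp add: power_divide)
qed

text \<open>A radial bump: 1 for \<open>norm x \<le> 1/2\<close> and 0 once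
  \<open>(norm x)\<^sup>2 \<ge> 1/2\<close>, in particular outside the ball of radius 3/4. The
  squared norm keeps it smooth at the origin.\<close>

definition bump0 :: "'a::euclidean_space \<Rightarrow> real" where
  "bump0 x = step (2 + (- 4) * (norm x)\<^sup>2)"

lemma bump0_test_function: "test_function (ball 0 1) (bump0 :: 'a::euclidean_space \<Rightarrow> real)"
proof (rule test_functionI[where K="cball 0 (3/4)"])
  show "C_k k (bump0 :: 'a \<Rightarrow> real)" for k
    unfolding bump0_def[abs_def]
    by (rule C_k_comp[OF C_k_step C_k_add[OF C_k_const C_k_cmult[OF C_k_norm_sq]]])
  show "bump0 x = 0" if "x \<notin> cball 0 (3/4)" for x :: 'a
  proof -
    have "(3/4)\<^sup>2 \<le> (norm x)\<^sup>2" using that by (intro power_mono) auto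
    then show ?thesis unfolding bump0_def by (intro step_0) (simp add: power2_eq_square)
  qed
qed auto

lemma bump0_nonneg: "bump0 x \<ge> 0"
  by (simp add: bump0_def step_nonneg)

lemma bump0_n2_pos: "n2 lborel (bump0 :: 'a::euclidean_space \<Rightarrow> real) > 0"
proof -
  have ind: "indicator (ball 0 (1/2)) x \<le> (norm (bump0 x))\<^sup>2" for x :: 'a
  proof (cases "norm x < 1/2")
    case True
    have "(norm x)\<^sup>2 \<le> (1/2)\<^sup>2" using True by (intro power_mono) auto
    then have "bump0 x = 1" unfolding bump0_def by (intro step_1) (simp add: power2_eq_square)
    then show ?thesis by (simp add: indicator_def)
  qed simp
  have "(\<integral>x. indicator (ball (0::'a) (1/2)) x \<partial>lborel) \<le> (\<integral>x. (norm (bump0 (x::'a)))\<^sup>2 \<partial>lborel)"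
  proof (rule integral_mono[OF _ _ ind])
    show "integrable lborel (indicator (ball (0::'a) (1/2)) :: 'a \<Rightarrow> real)"
      using emeasure_bounded_finite[OF bounded_ball] by (intro integrable_real_indicator) auto
    show "integrable lborel (\<lambda>x::'a. (norm (bump0 x))\<^sup>2)"
      by (rule l2_integrable_sq[OF test_function_l2_lborel(1)[OF bump0_test_function]])
  qed
  moreover have "(\<integral>x. indicator (ball (0::'a) (1/2)) x \<partial>lborel) > (0::real)"
    using content_ball_pos[of "1/2" "0::'a"] by simp
  ultimately have "0 < (\<integral>x. (norm (bump0 (x::'a)))\<^sup>2 \<partial>lborel)" by (rule less_le_trans[rotated])
  then show ?thesis by (simp only: n2_def real_sqrt_gt_0_iff)
qed

lemma exists_unit_test_function:
  fixes \<Omega> :: "'a::euclidean_space set"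
  assumes "open \<Omega>" "\<Omega> \<noteq> {}"
  obtains \<phi> where "test_function \<Omega> \<phi>" "n2 lborel \<phi> = 1"
proof -
  obtain x0 r where r: "r > 0" "ball x0 r \<subseteq> \<Omega>" using assms open_contains_ball by blast
  define \<psi> where "\<psi> x = bump0 ((1 / r) *\<^sub>R x + - (1 / r) *\<^sub>R x0)" for x
  have \<psi>: "test_function \<Omega> \<psi>"
    using test_function_affine[OF bump0_test_function r(1), of x0] r(2)
    by (auto simp: test_function_def \<psi>_def[abs_def])
  have "(n2 lborel \<psi>)\<^sup>2 > 0"
    unfolding \<psi>_def[abs_def] n2_scaled(1)[OF bump0_test_function r(1)]
    by (intro mult_pos_pos zero_less_power r(1) bump0_n2_pos)
  then have "n2 lborel \<psi> > 0" using n2_nonneg[of lborel \<psi>] by (metis less_eq_real_def zero_less_power2)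
  then have "n2 lborel (\<lambda>x. (1 / n2 lborel \<psi>) * \<psi> x) = 1"
    using n2_scaleR[of lborel "1 / n2 lborel \<psi>" \<psi>] by simp
  then show ?thesis using that test_function_cmult[OF \<psi>] by blast
qed

subsection \<open>Compactness\<close>

lemma n2_lebesgue_on_le:
  fixes f :: "'a::euclidean_space \<Rightarrow> 'b::euclidean_space"
  assumes "open \<Omega>" "l2 lborel f"
  shows "l2 (lebesgue_on \<Omega>) f" "n2 (lebesgue_on \<Omega>) f \<le> n2 lborel f"
proof -
  have [measurable]: "f \<in> borel_measurable borel" using assms(2) by (simp add: l2_def)
  have \<Omega>: "\<Omega> \<inter> space lebesgue \<in> sets lebesgue" using assms(1) by simp
  define h where "h x = (norm (f x))\<^sup>2" for x
  have hm: "h \<in> borel_measurable lborel" unfolding h_def[abs_def] by measurable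
  have hi: "integrable lborel h" using assms(2) by (simp add: l2_def h_def[abs_def])
  then have hi': "integrable lebesgue h" using integrable_completion[OF hm] by simp
  have ii: "integrable lebesgue (\<lambda>x. indicator \<Omega> x *\<^sub>R h x)"
    using \<Omega> by (intro integrable_mult_indicator hi') simp
  then have "integrable (lebesgue_on \<Omega>) h" using integrable_restrict_space[OF \<Omega>] by blast
  moreover have "f \<in> borel_measurable (lebesgue_on \<Omega>)" by (intro borel_measurable_lebesgue_on) measurable
  ultimately show "l2 (lebesgue_on \<Omega>) f" by (simp add: l2_def h_def[abs_def])
  have "(\<integral>x. h x \<partial>lebesgue_on \<Omega>) = (\<integral>x. indicator \<Omega> x *\<^sub>R h x \<partial>lebesgue)"
    by (rule integral_restrict_space[OF \<Omega>])
  also have "\<dots> \<le> (\<integral>x. h x \<partial>lebesgue)"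
    by (rule integral_mono[OF ii hi']) (auto simp: indicator_def h_def)
  also have "\<dots> = (\<integral>x. h x \<partial>lborel)" by (rule integral_completion[OF hm])
  finally show "n2 (lebesgue_on \<Omega>) f \<le> n2 lborel f" by (simp add: n2_def h_def)
qed

section \<open>Averages over small balls\<close>

text \<open>A mollification by the normalised indicator of a ball. For functions bounded in norm and
  energy, the averages at a fixed radius are uniformly bounded and uniformly Lipschitz, hence
  accessible to Arzela-Ascoli.\<close>

definition ball_avg :: "real \<Rightarrow> ('a::euclidean_space \<Rightarrow> real) \<Rightarrow> 'a \<Rightarrow> real" where
  "ball_avg l f x = (\<integral>y. indicator (ball 0 l) y * f (x + y) \<partial>lborel) / measure lborel (ball (0::'a) l)"

lemma indicator_ball_l2:
  "l2 lborel (indicator (ball (0::'a::euclidean_space) l) :: 'a \<Rightarrow> real)"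
  "n2 lborel (indicator (ball (0::'a) l) :: 'a \<Rightarrow> real) = sqrt (measure lborel (ball (0::'a) l))"
proof -
  have e: "(\<lambda>x::'a. (norm (indicator (ball 0 l) x :: real))\<^sup>2) = indicator (ball 0 l)"
    by (auto simp: indicator_def fun_eq_iff)
  have "integrable lborel (indicator (ball (0::'a) l) :: 'a \<Rightarrow> real)"
    using emeasure_bounded_finite[OF bounded_ball] by (intro integrable_real_indicator) auto
  then show "l2 lborel (indicator (ball (0::'a) l) :: 'a \<Rightarrow> real)" unfolding l2_def e by simp
  show "n2 lborel (indicator (ball (0::'a) l) :: 'a \<Rightarrow> real) = sqrt (measure lborel (ball (0::'a) l))"
    unfolding n2_def e by simp
qed

lemma l2_translate':
  assumes "l2 lborel f" shows "l2 lborel (\<lambda>y. f (x + y))" "n2 lborel (\<lambda>y. f (x + y)) = n2 lborel f"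
  using l2_lborel_translate[OF assms, of x] by (simp_all add: add.commute)

lemma ball_avg_bound:
  fixes f :: "'a::euclidean_space \<Rightarrow> real"
  assumes "l > 0" "l2 lborel f"
  shows "\<bar>ball_avg l f x\<bar> \<le> n2 lborel f / sqrt (measure lborel (ball (0::'a) l))"
proof -
  define V where "V = measure lborel (ball (0::'a) l)"
  have V: "V > 0" using content_ball_pos[OF assms(1), of "0::'a"] by (simp add: V_def)
  have "\<bar>\<integral>y. indicator (ball 0 l) y * f (x + y) \<partial>lborel\<bar> \<le> sqrt V * n2 lborel f"
    using l2_Cauchy_Schwarz[OF indicator_ball_l2(1)[of l] l2_translate'(1)[OF assms(2), of x]]
    by (simp add: indicator_ball_l2 l2_translate'[OF assms(2)] V_def)
  then have "\<bar>ball_avg l f x\<bar> \<le> sqrt V * n2 lborel f / V"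
    using V by (simp add: ball_avg_def V_def[symmetric] divide_right_mono)
  also have "\<dots> = n2 lborel f / sqrt V"
    using V real_sqrt_mult_self[of V] by (simp add: field_simps)
  finally show ?thesis by (simp add: V_def)
qed

lemma indicator_mult_l2:
  assumes "l2 lborel f"
  shows "integrable lborel (\<lambda>y. indicator (ball (0::'a::euclidean_space) l) y * (f y :: real))"
  using l2_mult_integrable[OF indicator_ball_l2(1) assms] .

lemma ball_avg_diff:
  fixes f :: "'a::euclidean_space \<Rightarrow> real"
  assumes "l2 lborel f" "l2 lborel g"
  shows "ball_avg l (\<lambda>x. f x - g x) x = ball_avg l f x - ball_avg l g x"
  using indicator_mult_l2[OF l2_translate'(1)[OF assms(1)], of l x] indicator_mult_l2[OF l2_translate'(1)[OF assms(2)], of l x]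
  by (simp add: ball_avg_def right_diff_distrib diff_divide_distrib)

lemma ball_avg_translate: "ball_avg l f (x + z) = ball_avg l (\<lambda>x. f (x + z)) x"
proof -
  have e: "x + z + y = x + y + z" for y by (simp only: add.assoc add.commute[of z])
  show ?thesis unfolding ball_avg_def e ..
qed

text \<open>Averaging commutes with translation, so a difference of averages is the average of
  \<open>\<phi>(z + h) - \<phi>(z)\<close> with \<open>h = x - y\<close>, and the translation
  estimate applies.\<close>

lemma ball_avg_lipschitz:
  fixes \<phi> :: "'a::euclidean_space \<Rightarrow> real"
  assumes "l > 0" "test_function \<Omega> \<phi>"
  shows "\<bar>ball_avg l \<phi> x - ball_avg l \<phi> y\<bar> \<le> norm (x - y) * n2 lborel (gradient \<phi>) / sqrt (measure lborel (ball (0::'a) l))"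
proof -
  note l = test_function_l2_lborel(1)[OF assms(2)]
  have "ball_avg l \<phi> x - ball_avg l \<phi> y = ball_avg l (\<lambda>z. \<phi> (z + (x - y)) - \<phi> z) y"
    using ball_avg_translate[of l \<phi> y "x - y"] ball_avg_diff[OF l2_lborel_translate(1)[OF l] l] by simp
  also have "\<bar>\<dots>\<bar> \<le> n2 lborel (\<lambda>z. \<phi> (z + (x - y)) - \<phi> z) / sqrt (measure lborel (ball (0::'a) l))"
    by (rule ball_avg_bound[OF assms(1) l2_diff[OF l2_lborel_translate(1)[OF l] l]])
  also have "\<dots> \<le> norm (x - y) * n2 lborel (gradient \<phi>) / sqrt (measure lborel (ball (0::'a) l))"
    by (intro divide_right_mono test_function_translation[OF assms(2)]) simp
  finally show ?thesis .
qed

lemma continuous_ball_avg: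
  fixes \<phi> :: "'a::euclidean_space \<Rightarrow> real"
  assumes "l > 0" "test_function \<Omega> \<phi>"
  shows "continuous_on UNIV (ball_avg l \<phi>)"
proof -
  have "lipschitz_on (n2 lborel (gradient \<phi>) / sqrt (measure lborel (ball (0::'a) l))) UNIV (ball_avg l \<phi>)"
    using ball_avg_lipschitz[OF assms] by (intro lipschitz_onI) (auto simp: dist_norm mult.commute)
  then show ?thesis by (rule lipschitz_on_continuous_on)
qed

text \<open>By Cauchy-Schwarz the squared error at \<open>x\<close> is at most the mean of
  \<open>(\<phi> x - \<phi> (x + y))\<^sup>2\<close> over \<open>norm y < l\<close>. After
  exchanging the integrals, the translation estimate bounds the inner one by
  \<open>l\<^sup>2\<close> times the energy.\<close>

lemma ball_avg_approx:
  fixes \<phi> :: "'a::euclidean_space \<Rightarrow> real"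
  assumes "l > 0" "test_function \<Omega> \<phi>"
  shows "l2 lborel (\<lambda>x. \<phi> x - ball_avg l \<phi> x)" "n2 lborel (\<lambda>x. \<phi> x - ball_avg l \<phi> x) \<le> l * n2 lborel (gradient \<phi>)"
proof -
  note l = test_function_l2_lborel[OF assms(2)]
  note [measurable] = test_function_measurable[OF assms(2)] borel_measurable_continuous_onI[OF continuous_ball_avg[OF assms]]
  have [measurable]: "ball (0::'a) l \<in> sets borel" by simp
  define V where "V = measure lborel (ball (0::'a) l)"
  have V: "V > 0" using content_ball_pos[OF assms(1), of "0::'a"] by (simp add: V_def)
  define G where "G = n2 lborel (gradient \<phi>)"
  let ?i = "\<lambda>y. indicator (ball (0::'a) l) y :: real"
  have sq: "ennreal ((\<phi> x - ball_avg l \<phi> x)\<^sup>2) \<le> (\<integral>\<^sup>+y. ennreal (?i y / V * (\<phi> x - \<phi> (x + y))\<^sup>2) \<partial>lborel)" for x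
  proof -
    define F where "F y = ?i y * (\<phi> x - \<phi> (x + y))" for y
    have Fe: "F = (\<lambda>y. \<phi> x *\<^sub>R ?i y - ?i y * \<phi> (x + y))" by (simp add: F_def fun_eq_iff algebra_simps)
    have "l2 lborel (\<lambda>y. ?i y * \<phi> (x + y))"
      by (rule l2_boundI[OF l2_translate'(1)[OF l(1)], where C=1]) (auto simp: indicator_def)
    then have Fl: "l2 lborel F"
      unfolding Fe by (intro l2_diff l2_scaleR indicator_ball_l2(1))
    have "(\<integral>y. ?i y * F y \<partial>lborel) = (\<integral>y. \<phi> x * ?i y - ?i y * \<phi> (x + y) \<partial>lborel)"
      by (rule Bochner_Integration.integral_cong) (auto simp: F_def indicator_def)
    also have "\<dots> = \<phi> x * V - V * ball_avg l \<phi> x"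
      using indicator_mult_l2[OF l2_translate'(1)[OF l(1)], of l x] emeasure_bounded_finite[OF bounded_ball[of "0::'a" l]] V
      by (subst Bochner_Integration.integral_diff) (auto simp: V_def ball_avg_def less_top)
    finally have "\<bar>V * (\<phi> x - ball_avg l \<phi> x)\<bar> \<le> sqrt V * n2 lborel F"
      using l2_Cauchy_Schwarz[OF indicator_ball_l2(1)[of l] Fl] by (simp add: indicator_ball_l2 V_def algebra_simps)
    then have "\<bar>V * (\<phi> x - ball_avg l \<phi> x)\<bar>\<^sup>2 \<le> (sqrt V * n2 lborel F)\<^sup>2" by (intro power_mono) auto
    then have "V\<^sup>2 * (\<phi> x - ball_avg l \<phi> x)\<^sup>2 \<le> V * (n2 lborel F)\<^sup>2" using V by (simp add: power_mult_distrib)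
    then have "V * (V * (\<phi> x - ball_avg l \<phi> x)\<^sup>2) \<le> V * (n2 lborel F)\<^sup>2"
      by (simp only: power2_eq_square[of V] mult.assoc)
    then have "(\<phi> x - ball_avg l \<phi> x)\<^sup>2 \<le> (n2 lborel F)\<^sup>2 / V"
      using V by (simp only: mult_le_cancel_left_pos pos_le_divide_eq mult.commute[of _ V])
    also have "\<dots> = (\<integral>y. (F y)\<^sup>2 / V \<partial>lborel)" by (simp add: n2_power2)
    also have "(\<lambda>y. (F y)\<^sup>2 / V) = (\<lambda>y. ?i y / V * (\<phi> x - \<phi> (x + y))\<^sup>2)"
      by (auto simp: F_def indicator_def fun_eq_iff)
    finally have "ennreal ((\<phi> x - ball_avg l \<phi> x)\<^sup>2) \<le> ennreal (\<integral>y. ?i y / V * (\<phi> x - \<phi> (x + y))\<^sup>2 \<partial>lborel)"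
      by (rule ennreal_leI)
    also have "\<dots> = (\<integral>\<^sup>+y. ennreal (?i y / V * (\<phi> x - \<phi> (x + y))\<^sup>2) \<partial>lborel)"
    proof (rule nn_integral_eq_integral[symmetric])
      have "integrable lborel (\<lambda>y. (F y)\<^sup>2 / V)" using Fl by (simp add: l2_def)
      then show "integrable lborel (\<lambda>y. ?i y / V * (\<phi> x - \<phi> (x + y))\<^sup>2)"
        unfolding \<open>(\<lambda>y. (F y)\<^sup>2 / V) = (\<lambda>y. ?i y / V * (\<phi> x - \<phi> (x + y))\<^sup>2)\<close> .
    qed (use V in auto)
    finally show ?thesis .
  qed
  have "(\<integral>\<^sup>+x. ennreal ((\<phi> x - ball_avg l \<phi> x)\<^sup>2) \<partial>lborel)
      \<le> (\<integral>\<^sup>+x. \<integral>\<^sup>+y. ennreal (?i y / V * (\<phi> x - \<phi> (x + y))\<^sup>2) \<partial>lborel \<partial>lborel)"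
    by (rule nn_integral_mono) (rule sq)
  also have "\<dots> = (\<integral>\<^sup>+y. \<integral>\<^sup>+x. ennreal (?i y / V * (\<phi> x - \<phi> (x + y))\<^sup>2) \<partial>lborel \<partial>lborel)"
    by (rule lborel_pair.Fubini') measurable
  also have "\<dots> \<le> (\<integral>\<^sup>+y. ennreal (l\<^sup>2 * G\<^sup>2 / V * ?i y) \<partial>lborel)"
  proof (rule nn_integral_mono)
    fix y :: 'a
    have d: "l2 lborel (\<lambda>x. \<phi> (x + y) - \<phi> x)" by (rule l2_diff[OF l2_lborel_translate(1)[OF l(1)] l(1)])
    show "(\<integral>\<^sup>+x. ennreal (?i y / V * (\<phi> x - \<phi> (x + y))\<^sup>2) \<partial>lborel) \<le> ennreal (l\<^sup>2 * G\<^sup>2 / V * ?i y)"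
    proof (cases "y \<in> ball 0 l")
      case True
      have "(\<integral>\<^sup>+x. ennreal (?i y / V * (\<phi> x - \<phi> (x + y))\<^sup>2) \<partial>lborel) = (\<integral>\<^sup>+x. ennreal ((\<phi> (x + y) - \<phi> x)\<^sup>2 / V) \<partial>lborel)"
        using True by (simp add: power2_commute)
      also have "\<dots> = ennreal (\<integral>x. (\<phi> (x + y) - \<phi> x)\<^sup>2 / V \<partial>lborel)"
        using d V by (intro nn_integral_eq_integral) (auto simp: l2_def)
      also have "\<dots> = ennreal ((n2 lborel (\<lambda>x. \<phi> (x + y) - \<phi> x))\<^sup>2 / V)" by (simp add: n2_power2)
      also have "\<dots> \<le> ennreal ((l * G)\<^sup>2 / V)"
      proof -
        have "n2 lborel (\<lambda>x. \<phi> (x + y) - \<phi> x) \<le> norm y * G"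
          unfolding G_def by (rule test_function_translation[OF assms(2)])
        also have "\<dots> \<le> l * G" using True by (intro mult_right_mono) (auto simp: G_def)
        finally show ?thesis using V by (intro ennreal_leI divide_right_mono power_mono) auto
      qed
      finally show ?thesis using True by (simp add: power_mult_distrib)
    qed simp
  qed
  also have "\<dots> = ennreal (l\<^sup>2 * G\<^sup>2)"
  proof -
    have "(\<integral>\<^sup>+y. ennreal (l\<^sup>2 * G\<^sup>2 / V * ?i y) \<partial>lborel) = ennreal (\<integral>y. l\<^sup>2 * G\<^sup>2 / V * ?i y \<partial>lborel)"
      using indicator_mult_l2[OF indicator_ball_l2(1)[of l], of l] V emeasure_bounded_finite[OF bounded_ball[of "0::'a" l]]
      by (intro nn_integral_eq_integral integrable_mult_right integrable_real_indicator) auto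
    also have "\<dots> = ennreal (l\<^sup>2 * G\<^sup>2)" using V by (simp add: V_def)
    finally show ?thesis .
  qed
  finally have le: "(\<integral>\<^sup>+x. ennreal ((\<phi> x - ball_avg l \<phi> x)\<^sup>2) \<partial>lborel) \<le> ennreal (l\<^sup>2 * G\<^sup>2)" .
  have i: "integrable lborel (\<lambda>x. (\<phi> x - ball_avg l \<phi> x)\<^sup>2)"
    by (rule integrableI_bounded) (use le in \<open>auto intro: le_less_trans\<close>)
  then show "l2 lborel (\<lambda>x. \<phi> x - ball_avg l \<phi> x)" by (simp add: l2_def)
  have "(n2 lborel (\<lambda>x. \<phi> x - ball_avg l \<phi> x))\<^sup>2 \<le> (l * G)\<^sup>2"
    using le i by (subst (asm) nn_integral_eq_integral) (auto simp: n2_power2 power_mult_distrib)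
  then show "n2 lborel (\<lambda>x. \<phi> x - ball_avg l \<phi> x) \<le> l * n2 lborel (gradient \<phi>)"
    unfolding G_def by (rule power2_le_imp_le) (use assms(1) in simp)
qed

section \<open>Rellich's theorem\<close>

text \<open>For one tolerance \<open>e\<close>: a fixed radius \<open>l\<close> makes the averages
  \<open>e/4\<close>-close to the functions, Arzela-Ascoli makes a subsequence of the averages
  uniformly convergent on the compact closure of \<open>\<Omega>\<close>, and the finite measure of
  \<open>\<Omega>\<close> turns this into closeness in norm.\<close>

lemma rellich_step:
  fixes \<phi> :: "nat \<Rightarrow> 'a::euclidean_space \<Rightarrow> real"
  assumes \<Omega>: "open \<Omega>" "bounded \<Omega>" and \<phi>: "\<And>n. test_function \<Omega> (\<phi> n)"
    and B: "\<And>n. n2 lborel (\<phi> n) \<le> B" "\<And>n. n2 lborel (gradient (\<phi> n)) \<le> B" and "e > 0"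
  obtains r :: "nat \<Rightarrow> nat" and N where "strict_mono r"
    "\<And>m n. m \<ge> N \<Longrightarrow> n \<ge> N \<Longrightarrow> n2 (lebesgue_on \<Omega>) (\<lambda>x. \<phi> (r m) x - \<phi> (r n) x) < e"
proof -
  let ?M = "lebesgue_on \<Omega>"
  have B0: "B \<ge> 0" using order_trans[OF n2_nonneg B(1)] .
  define l where "l = e / (4 * (B + 1))"
  have l: "l > 0" using B0 \<open>e > 0\<close> by (simp add: l_def)
  have "l * B \<le> l * (B + 1)" using l by (intro mult_left_mono) auto
  also have "\<dots> = e / 4" using B0 by (simp add: l_def field_simps)
  finally have lB: "l * B \<le> e / 4" .
  define W where "W = n2 ?M (\<lambda>x. 1::real)"
  have W: "W \<ge> 0" by (simp add: W_def)
  define C where "C = B / sqrt (measure lborel (ball (0::'a) l)) + 1"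
  have C: "C > 0" using B0 by (simp add: C_def add_nonneg_pos)
  have bnd: "\<bar>ball_avg l (\<phi> n) x\<bar> \<le> C" for n x
  proof -
    have "\<bar>ball_avg l (\<phi> n) x\<bar> \<le> n2 lborel (\<phi> n) / sqrt (measure lborel (ball (0::'a) l))"
      by (rule ball_avg_bound[OF l test_function_l2_lborel(1)[OF \<phi>]])
    also have "\<dots> \<le> B / sqrt (measure lborel (ball (0::'a) l))" by (intro divide_right_mono B) simp
    finally show ?thesis by (simp add: C_def)
  qed
  have lip: "\<bar>ball_avg l (\<phi> n) x - ball_avg l (\<phi> n) y\<bar> \<le> C * norm (x - y)" for n x y
  proof -
    have "\<bar>ball_avg l (\<phi> n) x - ball_avg l (\<phi> n) y\<bar> \<le> norm (x - y) * n2 lborel (gradient (\<phi> n)) / sqrt (measure lborel (ball (0::'a) l))"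
      by (rule ball_avg_lipschitz[OF l \<phi>])
    also have "\<dots> \<le> norm (x - y) * B / sqrt (measure lborel (ball (0::'a) l))"
      by (intro divide_right_mono mult_left_mono B) auto
    also have "\<dots> \<le> C * norm (x - y)" by (simp add: C_def algebra_simps)
    finally show ?thesis .
  qed
  have "compact (closure \<Omega>)" using \<Omega>(2) by simp
  then obtain g r where gr: "strict_mono (r :: nat \<Rightarrow> nat)"
    "\<And>e. 0 < e \<Longrightarrow> \<exists>N. \<forall>n x. n \<ge> N \<and> x \<in> closure \<Omega> \<longrightarrow> norm (ball_avg l (\<phi> (r n)) x - g x) < e"
  proof (rule Arzela_Ascoli[where \<F>="\<lambda>n. ball_avg l (\<phi> n)" and M=C])
    show "norm (ball_avg l (\<phi> n) x) \<le> C" for n x using bnd by simp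
    fix x :: 'a and e :: real assume "0 < e"
    show "\<exists>d>0. \<forall>n y. y \<in> closure \<Omega> \<and> norm (x - y) < d \<longrightarrow> norm (ball_avg l (\<phi> n) x - ball_avg l (\<phi> n) y) < e"
    proof (intro exI[of _ "e / C"] conjI allI impI)
      show "e / C > 0" using \<open>0 < e\<close> C by simp
      fix n y assume "y \<in> closure \<Omega> \<and> norm (x - y) < e / C"
      then have "C * norm (x - y) < e" using C by (simp add: field_simps)
      then show "norm (ball_avg l (\<phi> n) x - ball_avg l (\<phi> n) y) < e" using lip[of n x y] by simp
    qed
  qed blast
  \<comment> \<open>Makes two averages that are \<open>2 * \<delta>\<close>-close in the sup norm
    \<open>e/4\<close>-close in norm; with the two approximation errors the total is
    \<open>3e/4\<close>.\<close>
  define \<delta> where "\<delta> = e / (8 * (W + 1))"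
  have \<delta>: "\<delta> > 0" using W \<open>e > 0\<close> by (simp add: \<delta>_def)
  have "2 * \<delta> * W \<le> 2 * \<delta> * (W + 1)" using \<delta> by (intro mult_left_mono) auto
  also have "\<dots> = e / 4" using W by (simp add: \<delta>_def field_simps)
  finally have \<delta>W: "2 * \<delta> * W \<le> e / 4" .
  obtain N where N: "\<And>n x. n \<ge> N \<Longrightarrow> x \<in> closure \<Omega> \<Longrightarrow> \<bar>ball_avg l (\<phi> (r n)) x - g x\<bar> < \<delta>"
    using gr(2)[OF \<delta>] by auto
  have la: "l2 ?M (ball_avg l (\<phi> n))" for n
    by (rule l2_boundI[OF l2_const[OF \<Omega>, of "1::real"], where C=C])
      (use bnd borel_measurable_lebesgue_on[OF borel_measurable_continuous_onI[OF continuous_ball_avg[OF l \<phi>]]] in auto)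
  note lt = test_function_l2(1)[OF \<Omega>(1) \<phi>]
  have ap: "n2 ?M (\<lambda>x. \<phi> n x - ball_avg l (\<phi> n) x) \<le> e / 4" for n
  proof -
    have "n2 ?M (\<lambda>x. \<phi> n x - ball_avg l (\<phi> n) x) \<le> l * n2 lborel (gradient (\<phi> n))"
      using n2_lebesgue_on_le(2)[OF \<Omega>(1) ball_avg_approx(1)[OF l \<phi>]] ball_avg_approx(2)[OF l \<phi>] order_trans by blast
    also have "\<dots> \<le> l * B" using l B by (intro mult_left_mono) auto
    finally show ?thesis using lB by simp
  qed
  show ?thesis
  proof (rule that[OF gr(1), of N])
    fix m n assume mn: "m \<ge> N" "n \<ge> N"
    have "n2 ?M (\<lambda>x. ball_avg l (\<phi> (r m)) x - ball_avg l (\<phi> (r n)) x) \<le> n2 ?M (\<lambda>x. (2 * \<delta>) *\<^sub>R (1::real))"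
    proof (rule n2_mono[OF l2_const[OF \<Omega>]], rule AE_I2)
      fix x assume "x \<in> space ?M"
      then have "x \<in> closure \<Omega>" using closure_subset by auto
      from N[OF mn(1) this] N[OF mn(2) this] \<delta>
      show "norm (ball_avg l (\<phi> (r m)) x - ball_avg l (\<phi> (r n)) x) \<le> norm ((2 * \<delta>) *\<^sub>R (1::real))"
        by simp
    qed
    also have "\<dots> = 2 * \<delta> * W" using \<delta> unfolding n2_scaleR W_def by simp
    also have "\<dots> \<le> e / 4" by (rule \<delta>W)
    finally have 1: "n2 ?M (\<lambda>x. ball_avg l (\<phi> (r m)) x - ball_avg l (\<phi> (r n)) x) \<le> e / 4" .
    have "n2 ?M (\<lambda>x. \<phi> (r m) x - \<phi> (r n) x)
      \<le> n2 ?M (\<lambda>x. \<phi> (r m) x - ball_avg l (\<phi> (r m)) x) + n2 ?M (\<lambda>x. ball_avg l (\<phi> (r m)) x - \<phi> (r n) x)"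
      by (rule n2_triangle_diff[OF lt la lt])
    also have "n2 ?M (\<lambda>x. ball_avg l (\<phi> (r m)) x - \<phi> (r n) x) \<le>
      n2 ?M (\<lambda>x. ball_avg l (\<phi> (r m)) x - ball_avg l (\<phi> (r n)) x) + n2 ?M (\<lambda>x. ball_avg l (\<phi> (r n)) x - \<phi> (r n) x)"
      by (rule n2_triangle_diff[OF la la lt])
    finally show "n2 ?M (\<lambda>x. \<phi> (r m) x - \<phi> (r n) x) < e"
      using 1 ap[of "r m"] ap[of "r n"] \<open>e > 0\<close> n2_commute[of ?M "ball_avg l (\<phi> (r n))" "\<phi> (r n)"] by simp
  qed
qed

lemma rellich:
  fixes \<phi> :: "nat \<Rightarrow> 'a::euclidean_space \<Rightarrow> real"
  assumes \<Omega>: "open \<Omega>" "bounded \<Omega>" and \<phi>: "\<And>n. test_function \<Omega> (\<phi> n)"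
    and B: "\<And>n. n2 lborel (\<phi> n) \<le> B" "\<And>n. n2 lborel (gradient (\<phi> n)) \<le> B"
  obtains r :: "nat \<Rightarrow> nat" where "strict_mono r"
    "\<And>e. e > 0 \<Longrightarrow> \<exists>N. \<forall>m\<ge>N. \<forall>n\<ge>N. n2 (lebesgue_on \<Omega>) (\<lambda>x. \<phi> (r m) x - \<phi> (r n) x) < e"
proof -
  define P where "P k s \<longleftrightarrow> (\<exists>N. \<forall>m\<ge>N. \<forall>n\<ge>N. n2 (lebesgue_on \<Omega>) (\<lambda>x. \<phi> (s m) x - \<phi> (s n) x) < 1 / Suc k)"
    for k :: nat and s :: "nat \<Rightarrow> nat"
  interpret subseqs P
  proof
    fix k and s :: "nat \<Rightarrow> nat" assume "strict_mono s"
    have pos: "0 < 1 / real (Suc k)" by simp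
    obtain r :: "nat \<Rightarrow> nat" and N where "strict_mono r"
      "\<And>m n. m \<ge> N \<Longrightarrow> n \<ge> N \<Longrightarrow> n2 (lebesgue_on \<Omega>) (\<lambda>x. \<phi> (s (r m)) x - \<phi> (s (r n)) x) < 1 / Suc k"
      using rellich_step[OF \<Omega>, of "\<lambda>n. \<phi> (s n)" B "1 / Suc k", OF \<phi> B pos] by blast
    then show "\<exists>r. strict_mono r \<and> P k (s \<circ> r)" unfolding P_def o_def by blast
  qed
  \<comment> \<open>\<open>P k\<close> is inherited by subsequences, so it holds for the diagonal
    sequence from index \<open>Suc k\<close> on. This offset reappears in the final bound.\<close>
  have h: "P k (diagseq \<circ> (+) (Suc k))" for k
  proof (rule diagseq_holds)
    fix r s :: "nat \<Rightarrow> nat" and n assume r: "strict_mono r" and "P n s"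
    then obtain N where "\<forall>i\<ge>N. \<forall>j\<ge>N. n2 (lebesgue_on \<Omega>) (\<lambda>x. \<phi> (s i) x - \<phi> (s j) x) < 1 / Suc n"
      unfolding P_def by blast
    moreover have "r i \<ge> N" if "i \<ge> N" for i using seq_suble[OF r, of i] that by linarith
    ultimately show "P n (s \<circ> r)" unfolding P_def o_def by blast
  qed
  show ?thesis
  proof (rule that[OF subseq_diagseq])
    fix e :: real assume "e > 0"
    then obtain k where k: "1 / Suc k < e" using nat_approx_posE by blast
    obtain N where N: "\<And>m n. m \<ge> N \<Longrightarrow> n \<ge> N \<Longrightarrow>
        n2 (lebesgue_on \<Omega>) (\<lambda>x. \<phi> (diagseq (Suc k + m)) x - \<phi> (diagseq (Suc k + n)) x) < 1 / Suc k"
      using h[of k] unfolding P_def o_def by blast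
    have "n2 (lebesgue_on \<Omega>) (\<lambda>x. \<phi> (diagseq m) x - \<phi> (diagseq n) x) < e"
      if "m \<ge> Suc k + N" "n \<ge> Suc k + N" for m n
    proof -
      have "N \<le> m - Suc k" "N \<le> n - Suc k" using that by auto
      from N[OF this] that k show ?thesis by simp
    qed
    then show "\<exists>N. \<forall>m\<ge>N. \<forall>n\<ge>N. n2 (lebesgue_on \<Omega>) (\<lambda>x. \<phi> (diagseq m) x - \<phi> (diagseq n) x) < e" by blast
  qed
qed

subsection \<open>The first eigenvalue\<close>

text \<open>The infimum runs over test functions, where \<open>lborel\<close> and classical
  gradients suffice; \<open>rayleigh_hlim\<close> carries the resulting inequality over to all of
  \<open>H10 \<Omega>\<close>.\<close>

definition rayleigh :: "'a::euclidean_space set \<Rightarrow> real" where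
  "rayleigh \<Omega> = Inf {(n2 lborel (gradient \<phi>))\<^sup>2 | \<phi>. test_function \<Omega> \<phi> \<and> n2 lborel \<phi> = 1}"

lemma rayleigh_test_function:
  assumes "test_function \<Omega> \<phi>"
  shows "rayleigh \<Omega> * (n2 lborel \<phi>)\<^sup>2 \<le> (n2 lborel (gradient \<phi>))\<^sup>2"
proof (cases "n2 lborel \<phi> = 0")
  case False
  define c where "c = 1 / n2 lborel \<phi>"
  have gr: "gradient (\<lambda>x. c * \<phi> x) = (\<lambda>x. c *\<^sub>R gradient \<phi> x)"
    by (rule ext, rule gradient_cmult, rule test_function_differentiable[OF assms])
  have "n2 lborel (\<lambda>x. c * \<phi> x) = 1"
    using n2_scaleR[of lborel c \<phi>] False by (simp add: c_def)
  then have "rayleigh \<Omega> \<le> (n2 lborel (gradient (\<lambda>x. c * \<phi> x)))\<^sup>2"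
    unfolding rayleigh_def
    by (intro cInf_lower bdd_belowI[of _ 0]) (use test_function_cmult[OF assms] in auto)
  then have "rayleigh \<Omega> \<le> (n2 lborel (gradient \<phi>))\<^sup>2 / (n2 lborel \<phi>)\<^sup>2"
    unfolding gr n2_scaleR by (simp add: c_def power_mult_distrib power_divide)
  then show ?thesis using False by (simp add: field_simps)
qed simp

lemma rayleigh_nonneg:
  assumes "open \<Omega>" "\<Omega> \<noteq> {}" shows "rayleigh \<Omega> \<ge> 0"
proof -
  obtain \<phi> where "test_function \<Omega> \<phi>" "n2 lborel \<phi> = 1" using exists_unit_test_function[OF assms] .
  then have "{(n2 lborel (gradient \<phi>))\<^sup>2 | \<phi>. test_function \<Omega> \<phi> \<and> n2 lborel \<phi> = 1} \<noteq> {}" by blast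
  then show ?thesis unfolding rayleigh_def by (rule cInf_greatest) auto
qed

lemma rayleigh_hlim:
  assumes "open \<Omega>" "hlim \<Omega> u g"
  shows "rayleigh \<Omega> * (n2 (lebesgue_on \<Omega>) u)\<^sup>2 \<le> (n2 (lebesgue_on \<Omega>) g)\<^sup>2"
proof -
  let ?M = "lebesgue_on \<Omega>"
  obtain \<phi> where \<phi>: "\<And>n::nat. test_function \<Omega> (\<phi> n)"
    "(\<lambda>n. n2 ?M (\<lambda>x. \<phi> n x - u x)) \<longlonglongrightarrow> 0"
    "(\<lambda>n. n2 ?M (\<lambda>x. gradient (\<phi> n) x - g x)) \<longlonglongrightarrow> 0"
    using hlimE[OF assms(2)] by blast
  note l = test_function_l2[OF assms(1) \<phi>(1)] hlim_l2[OF assms(2)]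
  show ?thesis
  proof (rule LIMSEQ_le)
    show "(\<lambda>n. rayleigh \<Omega> * (n2 ?M (\<phi> n))\<^sup>2) \<longlonglongrightarrow> rayleigh \<Omega> * (n2 ?M u)\<^sup>2"
      by (intro tendsto_intros n2_tendsto[OF l(1,5) \<phi>(2)])
    show "(\<lambda>n. (n2 ?M (gradient (\<phi> n)))\<^sup>2) \<longlonglongrightarrow> (n2 ?M g)\<^sup>2"
      by (intro tendsto_intros n2_tendsto[OF l(2,6) \<phi>(3)])
    show "\<exists>N. \<forall>n\<ge>N. rayleigh \<Omega> * (n2 ?M (\<phi> n))\<^sup>2 \<le> (n2 ?M (gradient (\<phi> n)))\<^sup>2"
      using rayleigh_test_function[OF \<phi>(1)] l(3,4) by simp
  qed
qed

lemma n2_parallelogram: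
  assumes "l2 M f" "l2 M g"
  shows "(n2 M (\<lambda>x. f x - g x))\<^sup>2 = 2 * (n2 M f)\<^sup>2 + 2 * (n2 M g)\<^sup>2 - (n2 M (\<lambda>x. f x + g x))\<^sup>2"
  using n2_add_power2[OF assms] n2_add_power2[OF assms(1) l2_uminus[OF assms(2)]] by (simp add: n2_uminus)

text \<open>Direct method without weak limits. Rellich makes a minimising sequence Cauchy in norm;
  the parallelogram law, together with the Rayleigh inequality for the sum of two members, then
  makes the gradients Cauchy too.\<close>

lemma minimizer_exists:
  assumes \<Omega>: "open \<Omega>" "bounded \<Omega>" "\<Omega> \<noteq> {}"
  obtains u g where "hlim \<Omega> u g" "n2 (lebesgue_on \<Omega>) u = 1" "(n2 (lebesgue_on \<Omega>) g)\<^sup>2 = rayleigh \<Omega>"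
proof -
  let ?M = "lebesgue_on \<Omega>" and ?R = "rayleigh \<Omega>"
  have R0: "?R \<ge> 0" by (rule rayleigh_nonneg[OF \<Omega>(1,3)])
  have "\<exists>\<phi>. test_function \<Omega> \<phi> \<and> n2 lborel \<phi> = 1 \<and> (n2 lborel (gradient \<phi>))\<^sup>2 < ?R + 1 / Suc n" for n
  proof -
    let ?S = "{(n2 lborel (gradient \<phi>))\<^sup>2 | \<phi>. test_function \<Omega> \<phi> \<and> n2 lborel \<phi> = 1}"
    have "?S \<noteq> {}" using exists_unit_test_function[OF \<Omega>(1,3)] by blast
    moreover have "Inf ?S < ?R + 1 / Suc n" by (simp add: rayleigh_def)
    ultimately obtain a where "a \<in> ?S" "a < ?R + 1 / Suc n" by (rule cInf_lessD[THEN bexE])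
    then show ?thesis by blast
  qed
  then obtain \<phi> where \<phi>: "\<And>n. test_function \<Omega> (\<phi> n)" "\<And>n. n2 lborel (\<phi> n) = 1"
    "\<And>n. (n2 lborel (gradient (\<phi> n)))\<^sup>2 < ?R + 1 / Suc n" by metis
  have gb: "n2 lborel (gradient (\<phi> n)) \<le> ?R + 1" for n
  proof (rule power2_le_imp_le)
    have "(n2 lborel (gradient (\<phi> n)))\<^sup>2 \<le> ?R + 1"
      using \<phi>(3)[of n] by (rule less_imp_le[THEN order_trans]) (simp add: divide_le_eq)
    also have "\<dots> \<le> (?R + 1)\<^sup>2" using R0 by (simp add: power2_eq_square algebra_simps)
    finally show "(n2 lborel (gradient (\<phi> n)))\<^sup>2 \<le> (?R + 1)\<^sup>2" .
  qed (use R0 in simp)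
  have ob: "n2 lborel (\<phi> n) \<le> ?R + 1" for n using \<phi>(2) R0 by simp
  obtain r :: "nat \<Rightarrow> nat" where r: "strict_mono r"
    "\<And>e. e > 0 \<Longrightarrow> \<exists>N. \<forall>m\<ge>N. \<forall>n\<ge>N. n2 ?M (\<lambda>x. \<phi> (r m) x - \<phi> (r n) x) < e"
    using rellich[where \<phi>=\<phi>, OF \<Omega>(1,2) \<phi>(1) ob gb] by blast
  define \<psi> where "\<psi> n = \<phi> (r n)" for n
  have \<psi>: "test_function \<Omega> (\<psi> n)" for n by (simp add: \<psi>_def \<phi>)
  note l = test_function_l2[OF \<Omega>(1) \<psi>]
  have \<psi>1: "n2 ?M (\<psi> n) = 1" for n using l(3) by (simp add: \<psi>_def \<phi>)
  have \<psi>g: "(n2 ?M (gradient (\<psi> n)))\<^sup>2 < ?R + 1 / Suc n" for n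
  proof -
    have "(n2 ?M (gradient (\<psi> n)))\<^sup>2 < ?R + 1 / Suc (r n)" using l(4)[of n] \<phi>(3)[of "r n"] by (simp add: \<psi>_def)
    also have "\<dots> \<le> ?R + 1 / Suc n" using seq_suble[OF r(1), of n] by (simp add: frac_le)
    finally show ?thesis .
  qed
  have \<psi>C: "\<exists>N. \<forall>m\<ge>N. \<forall>n\<ge>N. n2 ?M (\<lambda>x. \<psi> m x - \<psi> n x) < e" if "e > 0" for e
    unfolding \<psi>_def by (rule r(2)[OF that])
  have gsum: "gradient (\<lambda>x. \<psi> m x + \<psi> n x) = (\<lambda>x. gradient (\<psi> m) x + gradient (\<psi> n) x)" for m n
    by (rule ext, rule gradient_add) (use test_function_differentiable \<psi> in blast)+
  \<comment> \<open>The squared gradient norms contribute at most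
    \<open>4R + 2 / Suc m + 2 / Suc n\<close>, with \<open>R\<close> the Rayleigh infimum; the
    gradient of the sum removes at least \<open>R\<close> times the squared norm of the sum, which
    is 4 minus that of the difference.\<close>
  have key: "(n2 ?M (\<lambda>x. gradient (\<psi> m) x - gradient (\<psi> n) x))\<^sup>2 \<le> 2 / Suc m + 2 / Suc n + ?R * (n2 ?M (\<lambda>x. \<psi> m x - \<psi> n x))\<^sup>2" for m n
  proof -
    have "?R * (n2 ?M (\<lambda>x. \<psi> m x + \<psi> n x))\<^sup>2 \<le> (n2 ?M (\<lambda>x. gradient (\<psi> m) x + gradient (\<psi> n) x))\<^sup>2"
      using rayleigh_hlim[OF \<Omega>(1) hlim_test_function[OF \<Omega>(1) test_function_add[OF \<psi> \<psi>]], of m n]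
      unfolding gsum .
    moreover have "(n2 ?M (\<lambda>x. \<psi> m x + \<psi> n x))\<^sup>2 = 4 - (n2 ?M (\<lambda>x. \<psi> m x - \<psi> n x))\<^sup>2"
      using n2_parallelogram[OF l(1,1), of m n] \<psi>1 by simp
    ultimately show ?thesis
      using n2_parallelogram[OF l(2,2), of m n] \<psi>g[of m] \<psi>g[of n] by (simp add: algebra_simps)
  qed
  have gC: "\<exists>N. \<forall>m\<ge>N. \<forall>n\<ge>N. n2 ?M (\<lambda>x. gradient (\<psi> m) x - gradient (\<psi> n) x) < e" if "e > 0" for e
  proof -
    \<comment> \<open>Gives \<open>R d\<^sup>2 \<le> ((R + 1) d)\<^sup>2 = e\<^sup>2 / 4\<close>.
      The terms with \<open>m\<close> and \<open>n\<close> add at most \<open>e\<^sup>2 / 8\<close>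
      each, so the total \<open>e\<^sup>2 / 2\<close> stays below \<open>e\<^sup>2\<close>.\<close>
    define d where "d = e / (2 * (?R + 1))"
    have d: "d > 0" using \<open>e > 0\<close> R0 by (simp add: d_def)
    obtain N where N: "\<And>m n. m \<ge> N \<Longrightarrow> n \<ge> N \<Longrightarrow> n2 ?M (\<lambda>x. \<psi> m x - \<psi> n x) < d" using \<psi>C[OF d] by blast
    obtain K where K: "1 / Suc K < e\<^sup>2 / 16" using nat_approx_posE[of "e\<^sup>2 / 16"] \<open>e > 0\<close> by auto
    have fin: "n2 ?M (\<lambda>x. gradient (\<psi> m) x - gradient (\<psi> n) x) < e" if mn: "m \<ge> max N K" "n \<ge> max N K" for m n
    proof (rule power2_less_imp_less)
      have s: "2 / Suc j \<le> e\<^sup>2 / 8" if "j \<ge> K" for j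
      proof -
        have "1 / real (Suc j) \<le> 1 / Suc K" using that by (intro divide_left_mono) auto
        then show ?thesis using K by simp
      qed
      have sm: "2 / real (Suc m) \<le> e\<^sup>2 / 8" and sn: "2 / real (Suc n) \<le> e\<^sup>2 / 8"
        using mn by (simp_all only: max.bounded_iff s)
      have "(n2 ?M (\<lambda>x. \<psi> m x - \<psi> n x))\<^sup>2 \<le> d\<^sup>2" using N[of m n] mn by (intro power_mono) auto
      then have "?R * (n2 ?M (\<lambda>x. \<psi> m x - \<psi> n x))\<^sup>2 \<le> ?R * d\<^sup>2" using R0 by (intro mult_left_mono) auto
      also have "\<dots> \<le> (?R + 1)\<^sup>2 * d\<^sup>2" using R0 by (intro mult_right_mono) (auto simp: power2_eq_square algebra_simps)
      also have "\<dots> = e\<^sup>2 / 4"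
      proof -
        have hd: "(?R + 1) * d = e / 2" using R0 by (simp add: d_def field_simps)
        show ?thesis unfolding power_mult_distrib[symmetric] hd by (simp add: power_divide)
      qed
      finally have "(n2 ?M (\<lambda>x. gradient (\<psi> m) x - gradient (\<psi> n) x))\<^sup>2 \<le> e\<^sup>2 / 8 + e\<^sup>2 / 8 + e\<^sup>2 / 4"
        using key[of m n] sm sn by linarith
      also have "\<dots> < e\<^sup>2" using zero_less_power[OF \<open>e > 0\<close>, of 2] by linarith
      finally show "(n2 ?M (\<lambda>x. gradient (\<psi> m) x - gradient (\<psi> n) x))\<^sup>2 < e\<^sup>2" .
    qed (use \<open>e > 0\<close> in simp)
    show ?thesis by (intro exI[of _ "max N K"] allI impI fin)
  qed
  obtain u where u: "l2 ?M u" "(\<lambda>n. n2 ?M (\<lambda>x. \<psi> n x - u x)) \<longlonglongrightarrow> 0"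
    by (rule l2_complete[OF l(1) \<psi>C])
  obtain g where g: "l2 ?M g" "(\<lambda>n. n2 ?M (\<lambda>x. gradient (\<psi> n) x - g x)) \<longlonglongrightarrow> 0"
    by (rule l2_complete[OF l(2) gC])
  have h: "hlim \<Omega> u g" by (rule hlimI[OF u(1) g(1) \<psi> u(2) g(2)])
  have u1: "n2 ?M u = 1"
    using n2_tendsto[OF l(1) u] by (simp add: \<psi>1 LIMSEQ_const_iff)
  have "(n2 ?M g)\<^sup>2 \<le> ?R + 0"
  proof (rule LIMSEQ_le)
    show "(\<lambda>n. (n2 ?M (gradient (\<psi> n)))\<^sup>2) \<longlonglongrightarrow> (n2 ?M g)\<^sup>2" by (intro tendsto_intros n2_tendsto[OF l(2) g])
    show "(\<lambda>n. ?R + 1 / Suc n) \<longlonglongrightarrow> ?R + 0"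
      using LIMSEQ_inverse_real_of_nat by (intro tendsto_intros) (simp add: inverse_eq_divide)
    show "\<exists>N. \<forall>n\<ge>N. (n2 ?M (gradient (\<psi> n)))\<^sup>2 \<le> ?R + 1 / Suc n"
      by (intro exI[of _ 0] allI impI less_imp_le \<psi>g)
  qed
  moreover have "?R \<le> (n2 ?M g)\<^sup>2" using rayleigh_hlim[OF \<Omega>(1) h] u1 by simp
  ultimately show ?thesis using that h u1 by simp
qed

text \<open>First variation: applying the Rayleigh inequality to \<open>u + t v\<close> leaves
  \<open>0 \<le> 2 t p + t\<^sup>2 q\<close> for all \<open>t\<close>, since the constant terms
  cancel for a minimiser, and this forces the linear coefficient \<open>p\<close> to vanish.\<close>

lemma minimizer_eigen:
  assumes \<Omega>: "open \<Omega>" and u: "hlim \<Omega> u g" "n2 (lebesgue_on \<Omega>) u = 1" "(n2 (lebesgue_on \<Omega>) g)\<^sup>2 = rayleigh \<Omega>"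
    and v: "hlim \<Omega> v h"
  shows "(\<integral>x. g x \<bullet> h x \<partial>lebesgue_on \<Omega>) = rayleigh \<Omega> * (\<integral>x. u x * v x \<partial>lebesgue_on \<Omega>)"
proof -
  let ?M = "lebesgue_on \<Omega>" and ?R = "rayleigh \<Omega>"
  note l = hlim_l2[OF u(1)] hlim_l2[OF v]
  define p where "p = (\<integral>x. g x \<bullet> h x \<partial>?M) - ?R * (\<integral>x. u x * v x \<partial>?M)"
  define q where "q = (n2 ?M h)\<^sup>2 - ?R * (n2 ?M v)\<^sup>2"
  have key: "0 \<le> 2 * t * p + t\<^sup>2 * q" for t
  proof -
    have "?R * (n2 ?M (\<lambda>x. u x + t *\<^sub>R v x))\<^sup>2 \<le> (n2 ?M (\<lambda>x. g x + t *\<^sub>R h x))\<^sup>2"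
      using rayleigh_hlim[OF \<Omega> hlim_add[OF \<Omega> u(1) hlim_cmult[OF \<Omega> v, of t]]] by simp
    moreover have "(n2 ?M (\<lambda>x. u x + t *\<^sub>R v x))\<^sup>2 = 1 + 2 * (t * (\<integral>x. u x * v x \<partial>?M)) + t\<^sup>2 * (n2 ?M v)\<^sup>2"
      using n2_add_power2[OF l(1) l2_scaleR[OF l(3), of t]] u(2)
      by (simp add: n2_scaleR[of ?M t v, simplified] power_mult_distrib mult.left_commute[of _ t])
    moreover have "(n2 ?M (\<lambda>x. g x + t *\<^sub>R h x))\<^sup>2 = ?R + 2 * (t * (\<integral>x. g x \<bullet> h x \<partial>?M)) + t\<^sup>2 * (n2 ?M h)\<^sup>2"
      using n2_add_power2[OF l(2) l2_scaleR[OF l(4), of t]] u(3) by (simp add: n2_scaleR power_mult_distrib)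
    ultimately show ?thesis by (simp add: p_def q_def algebra_simps)
  qed
  have "p = 0"
  proof (rule ccontr)
    assume "p \<noteq> 0"
    \<comment> \<open>\<open>s\<close> is positive and exceeds \<open>q\<close> whatever its sign,
      so at \<open>t = - p / s\<close> the linear term outweighs the quadratic one.\<close>
    define s where "s = \<bar>q\<bar> + 1"
    have s: "s > 0" "q < s" by (auto simp: s_def)
    have "2 * (- p / s) * p + (- p / s)\<^sup>2 * q = (p\<^sup>2 / s) * (q / s - 2)"
      using s by (simp add: field_simps power2_eq_square)
    also have "\<dots> < 0"
      using s \<open>p \<noteq> 0\<close> by (intro mult_pos_neg) (auto simp: field_simps)
    finally show False using key[of "- p / s"] by simp
  qed
  then show ?thesis by (simp add: p_def)
qed

text \<open>Passing to the absolute value does not raise the energy. The sign is needed later so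
  that the cut-off minimiser is itself the negative part of the competitor.\<close>

lemma nonneg_minimizer_exists:
  assumes \<Omega>: "open \<Omega>" "bounded \<Omega>" "\<Omega> \<noteq> {}"
  obtains u g where "hlim \<Omega> u g" "n2 (lebesgue_on \<Omega>) u = 1" "(n2 (lebesgue_on \<Omega>) g)\<^sup>2 = rayleigh \<Omega>" "\<forall>x. u x \<ge> 0"
proof -
  let ?M = "lebesgue_on \<Omega>"
  obtain u g where u: "hlim \<Omega> u g" "n2 ?M u = 1" "(n2 ?M g)\<^sup>2 = rayleigh \<Omega>"
    using minimizer_exists[OF \<Omega>] by blast
  obtain h where h: "hlim \<Omega> (\<lambda>x. \<bar>u x\<bar>) h" "n2 ?M h \<le> n2 ?M g" using hlim_abs[OF \<Omega>(1) u(1)] by blast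
  have 1: "n2 ?M (\<lambda>x. \<bar>u x\<bar>) = 1" using n2_norm[of ?M u] u(2) by simp
  have "rayleigh \<Omega> \<le> (n2 ?M h)\<^sup>2" using rayleigh_hlim[OF \<Omega>(1) h(1)] 1 by simp
  moreover have "(n2 ?M h)\<^sup>2 \<le> rayleigh \<Omega>" using power_mono[OF h(2), of 2] u(3) by simp
  ultimately show ?thesis using that[OF h(1) 1] by simp
qed

text \<open>The attained infimum is an eigenvalue by the first variation, and testing any other
  eigenvalue equation with its own eigenfunction exhibits the eigenvalue as a Rayleigh
  quotient.\<close>

lemma lambda1_eq_rayleigh:
  assumes \<Omega>: "open \<Omega>" "bounded \<Omega>" "\<Omega> \<noteq> {}"
  shows "lambda1 \<Omega> = rayleigh \<Omega>"
  unfolding lambda1_def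
proof (rule Least_equality)
  let ?M = "lebesgue_on \<Omega>"
  note wg = hlim_weak_grad[OF \<Omega>(1,2)]
  have wi: "(\<integral>x. weak_grad \<Omega> u x \<bullet> weak_grad \<Omega> v x \<partial>?M) = (\<integral>x. g x \<bullet> h x \<partial>?M)"
    if "hlim \<Omega> u g" "hlim \<Omega> v h" for u v g h
  proof (rule integral_cong_AE)
    show "AE x in ?M. weak_grad \<Omega> u x \<bullet> weak_grad \<Omega> v x = g x \<bullet> h x"
      using wg(1)[OF that(1)] wg(1)[OF that(2)] by eventually_elim simp
  qed (use wg(2)[OF that(1)] wg(2)[OF that(2)] hlim_l2(2)[OF that(1)] hlim_l2(2)[OF that(2)]
      in \<open>auto intro!: borel_measurable_inner dest: l2_measurable\<close>)
  obtain u g where u: "hlim \<Omega> u g" "n2 ?M u = 1" "(n2 ?M g)\<^sup>2 = rayleigh \<Omega>"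
    using minimizer_exists[OF \<Omega>] by blast
  show "dirichlet_eigenvalue \<Omega> (rayleigh \<Omega>)"
    unfolding dirichlet_eigenvalue_def
  proof (intro bexI conjI ballI)
    show "\<not> (AE x in ?M. u x = 0)"
    proof
      assume "AE x in ?M. u x = 0"
      then have "n2 ?M u = n2 ?M (\<lambda>x. 0::real)"
        by (intro n2_cong_AE) (use hlim_l2(1)[OF u(1)] in \<open>auto dest: l2_measurable\<close>)
      then show False using u(2) by (simp add: n2_def)
    qed
    fix v assume "v \<in> H10 \<Omega>"
    then obtain h where h: "hlim \<Omega> v h" using H10_iff[OF \<Omega>(1,2)] by blast
    show "(\<integral>x. weak_grad \<Omega> u x \<bullet> weak_grad \<Omega> v x \<partial>?M) = rayleigh \<Omega> * (\<integral>x. u x * v x \<partial>?M)"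
      unfolding wi[OF u(1) h] by (rule minimizer_eigen[OF \<Omega>(1) u h])
  qed (use H10_iff[OF \<Omega>(1,2)] u(1) in blast)
  fix \<mu> assume "dirichlet_eigenvalue \<Omega> \<mu>"
  then obtain v where v: "v \<in> H10 \<Omega>" "\<not> (AE x in ?M. v x = 0)"
    "(\<integral>x. weak_grad \<Omega> v x \<bullet> weak_grad \<Omega> v x \<partial>?M) = \<mu> * (\<integral>x. v x * v x \<partial>?M)"
    unfolding dirichlet_eigenvalue_def by blast
  obtain h where h: "hlim \<Omega> v h" using H10_iff[OF \<Omega>(1,2)] v(1) by blast
  have "(n2 ?M h)\<^sup>2 = \<mu> * (n2 ?M v)\<^sup>2"
    using v(3) unfolding wi[OF h h] by (simp only: n2_power2 power2_norm_eq_inner inner_real_def)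
  then have "rayleigh \<Omega> * (n2 ?M v)\<^sup>2 \<le> \<mu> * (n2 ?M v)\<^sup>2" using rayleigh_hlim[OF \<Omega>(1) h] by simp
  moreover have "n2 ?M v \<noteq> 0" using n2_eq_0_AE[OF hlim_l2(1)[OF h]] v(2) by blast
  ultimately show "rayleigh \<Omega> \<le> \<mu>" by simp
qed

subsection \<open>Elements of \<open>H10\<close> are not bounded away from zero\<close>

text \<open>On the exit set a test function vanishes at \<open>x + a\<close>, so
  \<open>\<phi> x\<close> equals the increment \<open>\<phi> x - \<phi> (x + a)\<close> and the
  translation estimate bounds its norm there. In the limit the same holds for \<open>u\<close>,
  whose norm on the exit set is at least \<open>c\<close> times the root of the measure.\<close>

lemma exit_set_measure:
  fixes \<Omega> :: "'a::euclidean_space set"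
  assumes \<Omega>: "open \<Omega>" "bounded \<Omega>" and u: "hlim \<Omega> u g" and c: "c > 0" "AE x in lebesgue_on \<Omega>. \<bar>u x\<bar> \<ge> c"
  shows "measure lborel {x \<in> \<Omega>. x + a \<notin> \<Omega>} \<le> (norm a * n2 (lebesgue_on \<Omega>) g / c)\<^sup>2"
proof -
  let ?M = "lebesgue_on \<Omega>" and ?D = "{x \<in> \<Omega>. x + a \<notin> \<Omega>}"
  obtain \<phi> where \<phi>: "\<And>n::nat. test_function \<Omega> (\<phi> n)"
    "(\<lambda>n. n2 ?M (\<lambda>x. \<phi> n x - u x)) \<longlonglongrightarrow> 0"
    "(\<lambda>n. n2 ?M (\<lambda>x. gradient (\<phi> n) x - g x)) \<longlonglongrightarrow> 0"
    using hlimE[OF u] by blast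
  note l = test_function_l2[OF \<Omega>(1) \<phi>(1)] hlim_l2[OF u]
  have Om [measurable]: "\<Omega> \<in> sets borel" using \<Omega>(1) by simp
  have D: "?D \<in> sets borel"
  proof -
    have "?D = \<Omega> - (\<lambda>x. x + a) -` \<Omega>" by auto
    moreover have "open ((\<lambda>x. x + a) -` \<Omega>)" using \<Omega>(1) by (intro open_vimage continuous_intros)
    ultimately show ?thesis using Om by auto
  qed
  define i where "i x = (indicator ?D x :: real)" for x
  have im: "i \<in> borel_measurable borel" unfolding i_def[abs_def] using D by simp
  have il: "l2 ?M (\<lambda>x. i x * f x)" if "l2 ?M f" for f
    by (rule l2_boundI[OF that borel_measurable_times[OF borel_measurable_lebesgue_on[OF im] l2_measurable[OF that]], where C=1])
      (auto simp: i_def indicator_def)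
  have conv: "(\<lambda>n. n2 ?M (\<lambda>x. i x * \<phi> n x - i x * u x)) \<longlonglongrightarrow> 0"
    by (rule n2_bound_tendsto_0[OF \<phi>(2) l2_diff[OF l(1,5)], of _ 1]) (auto simp: i_def indicator_def)
  have "n2 ?M (\<lambda>x. i x * u x) \<le> norm a * n2 ?M g"
  proof (rule LIMSEQ_le)
    show "(\<lambda>n. n2 ?M (\<lambda>x. i x * \<phi> n x)) \<longlonglongrightarrow> n2 ?M (\<lambda>x. i x * u x)"
      by (rule n2_tendsto[OF il[OF l(1)] il[OF l(5)] conv])
    show "(\<lambda>n. norm a * n2 ?M (gradient (\<phi> n))) \<longlonglongrightarrow> norm a * n2 ?M g"
      by (intro tendsto_intros n2_tendsto[OF l(2,6) \<phi>(3)])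
    show "\<exists>N. \<forall>n\<ge>N. n2 ?M (\<lambda>x. i x * \<phi> n x) \<le> norm a * n2 ?M (gradient (\<phi> n))"
    proof (intro exI allI impI)
      fix n
      note t = test_function_l2_lborel(1)[OF \<phi>(1)[of n]]
      have m: "(\<lambda>x. i x * \<phi> n x) \<in> borel_measurable borel"
        by (intro borel_measurable_times im test_function_measurable(1)[OF \<phi>(1)])
      have "n2 ?M (\<lambda>x. i x * \<phi> n x) = n2 lborel (\<lambda>x. i x * \<phi> n x)"
        by (rule l2_lebesgue_on_eq_lborel(2)[OF \<Omega>(1) m]) (use test_function_outside(1)[OF \<phi>(1)] in auto)
      also have "\<dots> \<le> n2 lborel (\<lambda>x. \<phi> n (x + a) - \<phi> n x)"
        by (rule n2_mono[OF l2_diff[OF l2_lborel_translate(1)[OF t] t]])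
          (use test_function_outside(1)[OF \<phi>(1)] in \<open>auto simp: i_def indicator_def\<close>)
      also have "\<dots> \<le> norm a * n2 lborel (gradient (\<phi> n))" by (rule test_function_translation[OF \<phi>(1)])
      finally show "n2 ?M (\<lambda>x. i x * \<phi> n x) \<le> norm a * n2 ?M (gradient (\<phi> n))" by (simp add: l(4))
    qed
  qed
  moreover have "n2 ?M (\<lambda>x. c *\<^sub>R i x) \<le> n2 ?M (\<lambda>x. i x * u x)"
  proof (rule n2_mono[OF il[OF l(5)]])
    show "AE x in ?M. norm (c *\<^sub>R i x) \<le> norm (i x * u x)"
      using c(2) by eventually_elim (use c(1) in \<open>auto simp: i_def indicator_def\<close>)
  qed
  ultimately have "c * n2 ?M i \<le> norm a * n2 ?M g" using c(1) n2_scaleR[of ?M c i] by simp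
  then have "n2 ?M i \<le> norm a * n2 ?M g / c" using c(1) by (simp add: field_simps)
  then have "(n2 ?M i)\<^sup>2 \<le> (norm a * n2 ?M g / c)\<^sup>2" by (intro power_mono) auto
  moreover have "(n2 ?M i)\<^sup>2 = measure lborel ?D"
  proof -
    have a: "n2 ?M i = n2 lborel i"
      by (rule l2_lebesgue_on_eq_lborel(2)[OF \<Omega>(1) im]) (auto simp: i_def)
    have b: "(\<lambda>x. (norm (i x))\<^sup>2) = indicator ?D" by (auto simp: i_def fun_eq_iff indicator_def)
    show ?thesis unfolding a n2_power2 b using D by simp
  qed
  ultimately show ?thesis by simp
qed

text \<open>If \<open>\<bar>u\<bar> \<ge> c\<close> on \<open>\<Omega>\<close>, shifting by \<open>a\<close> moves only \<open>O(\<bar>a\<bar>\<^sup>2)\<close> of the mass of \<open>\<Omega>\<close> out of \<open>\<Omega>\<close>.  Reaching a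
  fixed large shift in \<open>k\<close> steps then moves \<open>O(1/k)\<close> of the mass, although it moves everything.\<close>

lemma hlim_not_bounded_below:
  fixes \<Omega> :: "'a::euclidean_space set"
  assumes \<Omega>: "open \<Omega>" "bounded \<Omega>" "\<Omega> \<noteq> {}" and u: "hlim \<Omega> u g" and c: "c > 0"
  shows "\<not> (AE x in lebesgue_on \<Omega>. \<bar>u x\<bar> \<ge> c)"
proof
  assume ae: "AE x in lebesgue_on \<Omega>. \<bar>u x\<bar> \<ge> c"
  define D where "D a = {x \<in> \<Omega>. x + a \<notin> \<Omega>}" for a
  have Dm: "D a \<in> sets borel" for a
  proof -
    have "D a = \<Omega> - (\<lambda>x. x + a) -` \<Omega>" by (auto simp: D_def)
    moreover have "open ((\<lambda>x. x + a) -` \<Omega>)" using \<Omega>(1) by (intro open_vimage continuous_intros)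
    ultimately show ?thesis using \<Omega>(1) by auto
  qed
  obtain b where b: "\<And>x. x \<in> \<Omega> \<Longrightarrow> norm x \<le> b" using \<Omega>(2) bounded_iff by blast
  obtain e :: 'a where e: "e \<in> Basis" using nonempty_Basis by blast
  \<comment> \<open>A shift longer than the diameter, so that every point of \<open>\<Omega>\<close>
    leaves \<open>\<Omega>\<close>.\<close>
  define h where "h = (2 * \<bar>b\<bar> + 1) *\<^sub>R e"
  have nh: "norm h = 2 * \<bar>b\<bar> + 1" using e by (simp add: h_def)
  have Dh: "D h = \<Omega>"
  proof -
    have "x + h \<notin> \<Omega>" if "x \<in> \<Omega>" for x
    proof
      assume "x + h \<in> \<Omega>"
      from b[OF this] b[OF that] norm_triangle_ineq4[of "x + h" x] nh show False by simp
    qed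
    then show ?thesis by (auto simp: D_def)
  qed
  define q where "q = (norm h * n2 (lebesgue_on \<Omega>) g / c)\<^sup>2"
  have bd: "measure lborel \<Omega> \<le> q / real (Suc k)" for k
  proof -
    define a where "a = (1 / real (Suc k)) *\<^sub>R h"
    have "\<Omega> \<subseteq> (\<Union>j<Suc k. {x. x + real j *\<^sub>R a \<in> D a})"
    proof
      fix x assume x: "x \<in> \<Omega>"
      have "x + real (Suc k) *\<^sub>R a \<notin> \<Omega>" using Dh x by (auto simp: a_def D_def simp del: of_nat_Suc)
      \<comment> \<open>The last point of the chain \<open>x, x + a, x + 2a, ...\<close> before its
        first exit from \<open>\<Omega>\<close>; that point lies in \<open>D a\<close>.\<close>
      then obtain j where "x + real (Suc j) *\<^sub>R a \<notin> \<Omega>" and lo: "\<And>i. i \<le> j \<Longrightarrow> x + real i *\<^sub>R a \<in> \<Omega>" and jk: "j < Suc k"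
      proof -
        define n where "n = (LEAST n. x + real n *\<^sub>R a \<notin> \<Omega>)"
        have n: "x + real n *\<^sub>R a \<notin> \<Omega>" unfolding n_def by (rule LeastI, fact)
        have nk: "n \<le> Suc k" unfolding n_def by (rule Least_le, fact)
        have less: "x + real i *\<^sub>R a \<in> \<Omega>" if "i < n" for i
          using not_less_Least[of i "\<lambda>n. x + real n *\<^sub>R a \<notin> \<Omega>"] that unfolding n_def by simp
        have "n \<noteq> 0" using n x by (metis add.right_neutral of_nat_0 scaleR_zero_left)
        then obtain j where "n = Suc j" using not0_implies_Suc by blast
        then show thesis using that[of j] n nk less by auto
      qed
      then have "x + real j *\<^sub>R a \<in> D a" using lo[of j] by (simp add: D_def algebra_simps)
      then show "x \<in> (\<Union>j<Suc k. {x. x + real j *\<^sub>R a \<in> D a})" using jk by blast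
    qed
    moreover have Dt: "{x. x + v \<in> D a} \<in> sets borel" for v
      using measurable_sets[of "\<lambda>x. x + v" borel borel "D a"] Dm by (auto simp: vimage_def)
    ultimately have "emeasure lborel \<Omega> \<le> emeasure lborel (\<Union>j<Suc k. {x. x + real j *\<^sub>R a \<in> D a})"
      by (intro emeasure_mono) auto
    also have "\<dots> \<le> (\<Sum>j<Suc k. emeasure lborel {x. x + real j *\<^sub>R a \<in> D a})"
      using Dt by (intro emeasure_subadditive_finite) auto
    also have "\<dots> = (\<Sum>j<Suc k. emeasure lborel (D a))"
    proof (rule sum.cong[OF refl])
      fix j
      have [measurable]: "D a \<in> sets borel" by (rule Dm)
      have "(\<integral>\<^sup>+x. indicator (D a) (x + real j *\<^sub>R a) \<partial>lborel) = (\<integral>\<^sup>+x. indicator (D a) x \<partial>lborel)"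
        by (rule nn_integral_lborel_translate) measurable
      moreover have "(\<lambda>x. indicator (D a) (x + real j *\<^sub>R a) :: ennreal) = indicator {x. x + real j *\<^sub>R a \<in> D a}"
        by (auto simp: indicator_def fun_eq_iff)
      ultimately show "emeasure lborel {x. x + real j *\<^sub>R a \<in> D a} = emeasure lborel (D a)"
        using Dt by simp
    qed
    also have "\<dots> = ennreal (real (Suc k) * measure lborel (D a))"
    proof -
      have "emeasure lborel (D a) < \<infinity>"
        by (rule emeasure_bounded_finite[OF bounded_subset[OF \<Omega>(2)]]) (auto simp: D_def)
      then have "emeasure lborel (D a) = ennreal (measure lborel (D a))"
        by (intro emeasure_eq_ennreal_measure) auto
      then show ?thesis by (simp add: ennreal_mult ennreal_of_nat_eq_real_of_nat del: of_nat_Suc)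
    qed
    finally have "measure lborel \<Omega> \<le> real (Suc k) * measure lborel (D a)"
      using emeasure_eq_ennreal_measure[of lborel \<Omega>] emeasure_bounded_finite[OF \<Omega>(2)]
      by (simp add: ennreal_le_iff less_top del: of_nat_Suc)
    also have "\<dots> \<le> real (Suc k) * (norm a * n2 (lebesgue_on \<Omega>) g / c)\<^sup>2"
      using exit_set_measure[OF \<Omega>(1,2) u c ae, of a] by (intro mult_left_mono) (auto simp: D_def)
    \<comment> \<open>\<open>Suc k\<close> exit sets, each of measure at most
      \<open>q / (Suc k)\<^sup>2\<close> because \<open>a\<close> is \<open>h\<close> divided by
      \<open>Suc k\<close>.\<close>
    also have "\<dots> = q / real (Suc k)"
      by (simp add: q_def a_def power_divide power_mult_distrib power2_eq_square mult_ac del: of_nat_Suc)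
    finally show ?thesis .
  qed
  have "(\<lambda>k. q / real (Suc k)) \<longlonglongrightarrow> 0"
    using tendsto_mult_right_zero[OF LIMSEQ_inverse_real_of_nat, of q] by (simp add: divide_inverse)
  then have "measure lborel \<Omega> \<le> 0" by (rule LIMSEQ_le_const) (use bd in blast)
  moreover obtain x0 r where r: "r > 0" "ball x0 r \<subseteq> \<Omega>" using \<Omega>(1,3) open_contains_ball by blast
  have "0 < measure lborel (ball x0 r)" using content_ball_pos[OF r(1)] by simp
  also have "\<dots> \<le> measure lborel \<Omega>"
    using r(2) \<Omega> emeasure_bounded_finite[OF \<Omega>(2)] by (intro measure_mono_fmeasurable) (auto intro!: fmeasurableI)
  ultimately show False by simp
qed

text \<open>The sublevel set has positive measure, since \<open>u\<close> is not bounded away from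
  0; inner regularity by a closed set that misses less than its full measure yields the compact
  set.\<close>

lemma small_values_compact:
  fixes \<Omega> :: "'a::euclidean_space set"
  assumes \<Omega>: "open \<Omega>" "bounded \<Omega>" "\<Omega> \<noteq> {}" and u: "hlim \<Omega> u g" and c: "c > 0"
  obtains K where "compact K" "K \<subseteq> \<Omega>" "measure lborel K > 0" "\<forall>x\<in>K. \<bar>u x\<bar> < c"
proof -
  let ?M = "lebesgue_on \<Omega>"
  have \<Omega>s: "\<Omega> \<inter> space lebesgue \<in> sets lebesgue" using \<Omega>(1) by simp
  define S where "S = {x \<in> \<Omega>. \<bar>u x\<bar> < c}"
  have "{x \<in> space ?M. \<bar>u x\<bar> < c} \<in> sets ?M"
    using l2_measurable[OF hlim_l2(1)[OF u]] by measurable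
  then have S: "S \<in> sets lebesgue"
    using \<Omega>s by (auto simp: S_def sets_restrict_space_iff)
  have Spos: "emeasure lebesgue S > 0"
  proof (rule ccontr)
    assume "\<not> emeasure lebesgue S > 0"
    then have "S \<in> null_sets lebesgue" using S by auto
    then have "AE x in lebesgue. x \<notin> S" by (rule AE_not_in)
    then have "AE x in ?M. \<bar>u x\<bar> \<ge> c"
      unfolding AE_restrict_space_iff[OF \<Omega>s] by eventually_elim (auto simp: S_def)
    then show False using hlim_not_bounded_below[OF \<Omega> u c] by blast
  qed
  have Sl: "S \<in> lmeasurable"
    by (rule bounded_set_imp_lmeasurable[OF bounded_subset[OF \<Omega>(2)] S]) (auto simp: S_def)
  then have mS: "measure lebesgue S > 0" using Spos
    by (metis emeasure_eq_measure2 ennreal_0 less_numeral_extra(3) measure_nonneg order_less_le)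
  obtain T where T: "closed T" "T \<subseteq> S" "S - T \<in> lmeasurable" "emeasure lebesgue (S - T) < ennreal (measure lebesgue S)"
    using sets_lebesgue_inner_closed[OF S mS] by blast
  have bT: "bounded T" by (rule bounded_subset[OF \<Omega>(2)]) (use T(2) in \<open>auto simp: S_def\<close>)
  have Tl: "T \<in> lmeasurable" using T(1) bT by (intro bounded_set_imp_lmeasurable) auto
  have "measure lebesgue (S - T) < measure lebesgue S"
    using T(4) emeasure_eq_measure2[OF T(3)] by (simp add: ennreal_less_iff)
  moreover have "measure lebesgue (S - T) = measure lebesgue S - measure lebesgue T"
    by (rule measurable_measure_Diff[OF Sl _ T(2)]) (use Tl in auto)
  ultimately have "measure lebesgue T > 0" by simp
  then have "measure lborel T > 0" using T(1) by (simp add: measure_completion)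
  show ?thesis
  proof (rule that[of T])
    show "compact T" using T(1) bT by (simp add: compact_eq_bounded_closed)
    show "T \<subseteq> \<Omega>" using T(2) by (auto simp: S_def)
    show "\<forall>x\<in>T. \<bar>u x\<bar> < c" using T(2) by (auto simp: S_def)
    show "measure lborel T > 0" by fact
  qed
qed

subsection \<open>Choosing the centre of the perturbation\<close>

text \<open>Averaging \<open>\<integral> u\<^sup>2 k(\<cdot> - x\<^sub>0)\<close> over \<open>x\<^sub>0 \<in> K\<close> bounds it by the values of \<open>u\<close> on \<open>K\<close>, up to an error
  controlled by the translation estimate.\<close>

lemma good_centre:
  fixes \<Omega> :: "'a::euclidean_space set"
  assumes \<Omega>: "open \<Omega>" and u: "hlim \<Omega> u g"
    and K: "compact K" "K \<subseteq> \<Omega>" "measure lborel K > 0" "\<And>x. x \<in> K \<Longrightarrow> \<bar>u x\<bar> < s"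
    and s: "s > 0" and R: "R * (n2 (lebesgue_on \<Omega>) g + 1) \<le> s * sqrt (measure lborel K)" "R > 0"
    and k: "k \<in> borel_measurable borel" "\<And>x. 0 \<le> k x" "\<And>x. k x \<le> B" "\<And>x. norm x \<ge> R \<Longrightarrow> k x = 0"
      "(\<integral>\<^sup>+x. ennreal (k x) \<partial>lborel) \<le> ennreal c" "c > 0"
  obtains x0 where "x0 \<in> K" "(\<integral>x. (u x)\<^sup>2 * k (x - x0) \<partial>lebesgue_on \<Omega>) \<le> 21 * c * s\<^sup>2"
proof -
  let ?M = "lebesgue_on \<Omega>"
  note [measurable] = k(1)
  define \<kappa> where "\<kappa> = measure lborel K"
  have \<kappa>: "\<kappa> > 0" using K(3) by (simp add: \<kappa>_def)
  have KM [measurable]: "K \<in> sets borel" using K(1) by (auto intro: borel_compact)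
  have Ke: "emeasure lborel K = ennreal \<kappa>"
    unfolding \<kappa>_def using emeasure_bounded_finite[OF compact_imp_bounded[OF K(1)]] by (intro emeasure_eq_ennreal_measure) auto
  have B: "B \<ge> 0" using order_trans[OF k(2,3)] .
  \<comment> \<open>Three demands on the approximation: \<open>1\<close> bounds the energy of
    \<open>\<phi>\<close> through \<open>norm g + 1\<close>, \<open>s * sqrt \<kappa>\<close> keeps
    \<open>\<phi>\<close> small on \<open>K\<close>, and the last term makes the error weighted by
    \<open>k \<le> B\<close> at most \<open>c * s\<^sup>2\<close>.\<close>
  define e where "e = min (min 1 (s * sqrt \<kappa>)) (s * sqrt (c / (2 * (B + 1))))"
  have e: "e > 0" "e \<le> 1" "e \<le> s * sqrt \<kappa>" "e \<le> s * sqrt (c / (2 * (B + 1)))"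
    using s \<kappa> k(6) B by (auto simp: e_def)
  have eB: "2 * B * e\<^sup>2 \<le> c * s\<^sup>2"
  proof -
    have "e\<^sup>2 \<le> (s * sqrt (c / (2 * (B + 1))))\<^sup>2" using e by (intro power_mono) auto
    also have "\<dots> = s\<^sup>2 * (c / (2 * (B + 1)))" using k(6) B by (simp add: power_mult_distrib)
    finally have "2 * (B + 1) * e\<^sup>2 \<le> 2 * (B + 1) * (s\<^sup>2 * (c / (2 * (B + 1))))" using B by (intro mult_left_mono) auto
    also have "\<dots> = c * s\<^sup>2" using B by (simp add: field_simps)
    finally have "2 * (B + 1) * e\<^sup>2 \<le> c * s\<^sup>2" .
    moreover have "2 * B * e\<^sup>2 \<le> 2 * (B + 1) * e\<^sup>2" by (intro mult_right_mono) auto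
    ultimately show ?thesis by linarith
  qed
  obtain \<phi> where \<phi>: "test_function \<Omega> \<phi>" "n2 ?M (\<lambda>x. \<phi> x - u x) < e" "n2 ?M (\<lambda>x. gradient \<phi> x - g x) < e"
    using hlim_approx[OF u e(1)] by blast
  note l = test_function_l2[OF \<Omega> \<phi>(1)] hlim_l2[OF u] and lb = test_function_l2_lborel[OF \<phi>(1)]
  note [measurable] = test_function_measurable[OF \<phi>(1)]
  have gphi: "n2 lborel (gradient \<phi>) \<le> n2 ?M g + 1"
    using n2_diff_le[OF l(2,6)] \<phi>(3) e(2) l(4) by (simp add: abs_le_iff)
  define i where "i x = (indicator K x :: real)" for x
  have im [measurable]: "i \<in> borel_measurable borel" unfolding i_def[abs_def] by measurable
  have i01: "0 \<le> i x" "i x \<le> 1" for x by (auto simp: i_def indicator_def)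
  have il: "l2 N (\<lambda>x. i x * f x)" if "l2 N f" "i \<in> borel_measurable N" for f N
    by (rule l2_boundI[OF that(1) borel_measurable_times[OF that(2) l2_measurable[OF that(1)]], where C=1])
      (auto simp: i_def indicator_def)
  note imM = borel_measurable_lebesgue_on[OF im, of \<Omega>]
  have iK: "n2 lborel (\<lambda>x. s *\<^sub>R i x) = s * sqrt \<kappa>"
  proof -
    have "(\<lambda>x. (norm (i x))\<^sup>2) = indicator K" by (auto simp: i_def fun_eq_iff indicator_def)
    then have "n2 lborel i = sqrt \<kappa>" unfolding n2_def \<kappa>_def by simp
    then show ?thesis using s by (simp only: n2_scaleR)
  qed
  have liK: "l2 lborel i"
  proof -
    have "(\<lambda>x. (norm (i x))\<^sup>2) = indicator K" by (auto simp: i_def fun_eq_iff indicator_def)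
    then show ?thesis unfolding l2_def using Ke by (auto intro!: integrable_real_indicator)
  qed
  \<comment> \<open>One \<open>s * sqrt \<kappa>\<close> comes from \<open>|u| < s\<close> on
    \<open>K\<close>, the other from replacing \<open>u\<close> by \<open>\<phi>\<close>.\<close>
  have phiK: "n2 lborel (\<lambda>x. i x * \<phi> x) \<le> 2 * (s * sqrt \<kappa>)"
  proof -
    have "n2 lborel (\<lambda>x. i x * \<phi> x) = n2 ?M (\<lambda>x. i x * \<phi> x)"
    proof (rule l2_lebesgue_on_eq_lborel(2)[OF \<Omega>, symmetric])
      show "(\<lambda>x. i x * \<phi> x) \<in> borel_measurable borel" by measurable
    qed (use test_function_outside(1)[OF \<phi>(1)] in auto)
    also have "\<dots> = n2 ?M (\<lambda>x. i x * u x + i x * (\<phi> x - u x))" by (simp add: algebra_simps)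
    also have "\<dots> \<le> n2 ?M (\<lambda>x. i x * u x) + n2 ?M (\<lambda>x. i x * (\<phi> x - u x))"
      by (rule n2_triangle[OF il[OF l(5) imM] il[OF l2_diff[OF l(1,5)] imM]])
    also have "n2 ?M (\<lambda>x. i x * u x) \<le> n2 ?M (\<lambda>x. s *\<^sub>R i x)"
    proof (rule n2_mono)
      show "l2 ?M (\<lambda>x. s *\<^sub>R i x)" by (rule l2_scaleR[OF n2_lebesgue_on_le(1)[OF \<Omega> liK]])
      show "AE x in ?M. norm (i x * u x) \<le> norm (s *\<^sub>R i x)"
        using K(4) s by (intro AE_I2) (force simp: i_def indicator_def less_imp_le)
    qed
    also have "\<dots> \<le> s * sqrt \<kappa>" using n2_lebesgue_on_le(2)[OF \<Omega> l2_scaleR[OF liK, of s]] iK by simp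
    also have "n2 ?M (\<lambda>x. i x * (\<phi> x - u x)) \<le> n2 ?M (\<lambda>x. \<phi> x - u x)"
      by (rule n2_mono[OF l2_diff[OF l(1,5)]]) (auto simp: i_def indicator_def)
    finally show ?thesis using \<phi>(2) e(3) by simp
  qed
  \<comment> \<open>The third \<open>s * sqrt \<kappa>\<close> pays for shifting by less than
    \<open>R\<close>; this is what the hypothesis on \<open>R\<close> is made for.\<close>
  have shift: "n2 lborel (\<lambda>x. i x * \<phi> (x + y)) \<le> 3 * (s * sqrt \<kappa>)" if "norm y < R" for y
  proof -
    note d = l2_diff[OF l2_lborel_translate(1)[OF lb(1), of y] lb(1)]
    have il': "l2 lborel (\<lambda>x. i x * f x)" if "l2 lborel f" for f by (rule il[OF that]) simp
    have "(\<lambda>x. i x * \<phi> (x + y)) = (\<lambda>x. i x * \<phi> x + i x * (\<phi> (x + y) - \<phi> x))" by (simp add: algebra_simps fun_eq_iff)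
    then have "n2 lborel (\<lambda>x. i x * \<phi> (x + y)) \<le> n2 lborel (\<lambda>x. i x * \<phi> x) + n2 lborel (\<lambda>x. i x * (\<phi> (x + y) - \<phi> x))"
      using n2_triangle[OF il'[OF lb(1)] il'[OF d]] by simp
    also have "n2 lborel (\<lambda>x. i x * (\<phi> (x + y) - \<phi> x)) \<le> n2 lborel (\<lambda>x. \<phi> (x + y) - \<phi> x)"
      by (rule n2_mono[OF d]) (auto simp: i_def indicator_def)
    also have "\<dots> \<le> norm y * n2 lborel (gradient \<phi>)" by (rule test_function_translation[OF \<phi>(1)])
    also have "\<dots> \<le> R * (n2 ?M g + 1)" using that gphi R(2) by (intro mult_mono) auto
    also have "\<dots> \<le> s * sqrt \<kappa>" using R(1) by (simp add: \<kappa>_def)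
    finally show ?thesis using phiK by simp
  qed
  \<comment> \<open>Integrated over \<open>K\<close>, the quantity is at most
    \<open>9 c s\<^sup>2 \<kappa>\<close> by Fubini and the shifted bound, so it cannot be at least
    \<open>10 c s\<^sup>2\<close> at every point of \<open>K\<close>.\<close>
  have "\<exists>x0\<in>K. (\<integral>\<^sup>+y. ennreal ((\<phi> (x0 + y))\<^sup>2 * k y) \<partial>lborel) < ennreal (10 * c * s\<^sup>2)"
  proof (rule ccontr)
    assume "\<not> ?thesis"
    then have ge: "ennreal (10 * c * s\<^sup>2) \<le> (\<integral>\<^sup>+y. ennreal ((\<phi> (x + y))\<^sup>2 * k y) \<partial>lborel)" if "x \<in> K" for x
      using that by (auto simp: not_less)
    have "ennreal (10 * c * s\<^sup>2) * ennreal \<kappa> = (\<integral>\<^sup>+x. ennreal (10 * c * s\<^sup>2) * indicator K x \<partial>lborel)"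
      using Ke by (simp add: nn_integral_cmult_indicator)
    also have "\<dots> \<le> (\<integral>\<^sup>+x. (\<integral>\<^sup>+y. ennreal (i x * ((\<phi> (x + y))\<^sup>2 * k y)) \<partial>lborel) \<partial>lborel)"
    proof (rule nn_integral_mono)
      fix x
      show "ennreal (10 * c * s\<^sup>2) * indicator K x \<le> (\<integral>\<^sup>+y. ennreal (i x * ((\<phi> (x + y))\<^sup>2 * k y)) \<partial>lborel)"
        using ge[of x] by (cases "x \<in> K") (auto simp: i_def)
    qed
    also have "\<dots> = (\<integral>\<^sup>+y. (\<integral>\<^sup>+x. ennreal (i x * ((\<phi> (x + y))\<^sup>2 * k y)) \<partial>lborel) \<partial>lborel)"
      by (rule lborel_pair.Fubini') measurable
    also have "\<dots> \<le> (\<integral>\<^sup>+y. ennreal (9 * s\<^sup>2 * \<kappa>) * ennreal (k y) \<partial>lborel)"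
    proof (rule nn_integral_mono)
      fix y
      show "(\<integral>\<^sup>+x. ennreal (i x * ((\<phi> (x + y))\<^sup>2 * k y)) \<partial>lborel) \<le> ennreal (9 * s\<^sup>2 * \<kappa>) * ennreal (k y)"
      proof (cases "norm y < R")
        case False
        then show ?thesis using k(4)[of y] by simp
      next
        case True
        have f: "l2 lborel (\<lambda>x. i x * \<phi> (x + y))" by (rule il[OF l2_lborel_translate(1)[OF lb(1)]]) simp
        have eq: "i x * ((\<phi> (x + y))\<^sup>2 * k y) = k y * (norm (i x * \<phi> (x + y)))\<^sup>2" for x
          by (auto simp: i_def indicator_def)
        have "(\<integral>\<^sup>+x. ennreal (i x * ((\<phi> (x + y))\<^sup>2 * k y)) \<partial>lborel) = ennreal (\<integral>x. k y * (norm (i x * \<phi> (x + y)))\<^sup>2 \<partial>lborel)"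
          unfolding eq using f k(2) by (intro nn_integral_eq_integral integrable_mult_right) (auto simp: l2_def)
        also have "(\<integral>x. k y * (norm (i x * \<phi> (x + y)))\<^sup>2 \<partial>lborel) = k y * (n2 lborel (\<lambda>x. i x * \<phi> (x + y)))\<^sup>2"
          unfolding n2_power2 by simp
        also have "ennreal \<dots> \<le> ennreal (k y * (3 * (s * sqrt \<kappa>))\<^sup>2)"
          by (intro ennreal_leI mult_left_mono power_mono shift[OF True] k(2)) simp
        also have "k y * (3 * (s * sqrt \<kappa>))\<^sup>2 = (9 * s\<^sup>2 * \<kappa>) * k y"
          using \<kappa> by (simp add: power_mult_distrib)
        also have "ennreal \<dots> = ennreal (9 * s\<^sup>2 * \<kappa>) * ennreal (k y)" using \<kappa> k(2) by (simp add: ennreal_mult)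
        finally show ?thesis .
      qed
    qed
    also have "\<dots> = ennreal (9 * s\<^sup>2 * \<kappa>) * (\<integral>\<^sup>+y. ennreal (k y) \<partial>lborel)" by (rule nn_integral_cmult) measurable
    also have "\<dots> \<le> ennreal (9 * s\<^sup>2 * \<kappa>) * ennreal c" by (intro mult_left_mono k(5)) simp
    finally have "ennreal (10 * c * s\<^sup>2 * \<kappa>) \<le> ennreal (9 * s\<^sup>2 * \<kappa> * c)"
      using \<kappa> k(6) by (simp add: ennreal_mult'')
    then have "10 * (c * s\<^sup>2 * \<kappa>) \<le> 9 * (c * s\<^sup>2 * \<kappa>)"
      using \<kappa> k(6) by (subst (asm) ennreal_le_iff) (auto simp: mult.commute mult.left_commute)
    moreover have "c * s\<^sup>2 * \<kappa> > 0" using \<kappa> k(6) s by simp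
    ultimately show False by linarith
  qed
  then obtain x0 where x0: "x0 \<in> K" "(\<integral>\<^sup>+y. ennreal ((\<phi> (x0 + y))\<^sup>2 * k y) \<partial>lborel) < ennreal (10 * c * s\<^sup>2)" by blast
  have "(\<integral>\<^sup>+y. ennreal ((\<phi> (x0 + y))\<^sup>2 * k y) \<partial>lborel) = (\<integral>\<^sup>+x. ennreal ((\<phi> x)\<^sup>2 * k (x - x0)) \<partial>lborel)"
    using nn_integral_lborel_translate[of "\<lambda>x. ennreal ((\<phi> x)\<^sup>2 * k (x - x0))" x0] by (simp add: add.commute)
  with x0(2) have lt: "(\<integral>\<^sup>+x. ennreal ((\<phi> x)\<^sup>2 * k (x - x0)) \<partial>lborel) < ennreal (10 * c * s\<^sup>2)" by simp
  have pb: "(\<lambda>x. (\<phi> x)\<^sup>2 * k (x - x0)) \<in> borel_measurable borel" by measurable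
  have pi: "integrable lborel (\<lambda>x. (\<phi> x)\<^sup>2 * k (x - x0))"
    by (rule integrableI_bounded) (use lt k(2) in \<open>auto simp: abs_mult intro: less_trans\<close>)
  have p10: "(\<integral>x. (\<phi> x)\<^sup>2 * k (x - x0) \<partial>lborel) \<le> 10 * c * s\<^sup>2"
    using lt nn_integral_eq_integral[OF pi] k(2,6) s by (auto simp: ennreal_less_iff less_imp_le)
  note pM = lebesgue_on_eq_lborel[OF \<Omega> pb]
  have p0: "x \<notin> \<Omega> \<Longrightarrow> (\<phi> x)\<^sup>2 * k (x - x0) = 0" for x using test_function_outside(1)[OF \<phi>(1)] by simp
  have kM: "(\<lambda>x. k (x - x0)) \<in> borel_measurable ?M" by (intro borel_measurable_lebesgue_on) measurable
  have wint: "integrable ?M (\<lambda>x. (norm (f x))\<^sup>2 * k (x - x0))" if "l2 ?M f" for f :: "'a \<Rightarrow> real"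
  proof (rule Bochner_Integration.integrable_bound[OF integrable_mult_left[OF l2_integrable_sq[OF that], of B]])
    show "(\<lambda>x. (norm (f x))\<^sup>2 * k (x - x0)) \<in> borel_measurable ?M"
      using l2_measurable[OF that] kM by measurable
    show "AE x in ?M. norm ((norm (f x))\<^sup>2 * k (x - x0)) \<le> norm ((norm (f x))\<^sup>2 * B)"
      using k(2,3) B by (intro AE_I2) (auto simp: abs_mult intro!: mult_left_mono)
  qed
  \<comment> \<open>Back from \<open>\<phi>\<close> to \<open>u\<close>:
    \<open>2 \<phi>\<^sup>2 + 2 (\<phi> - u)\<^sup>2 - u\<^sup>2\<close> is the square of
    \<open>2 \<phi> - u\<close>. The first term contributes \<open>20 c s\<^sup>2\<close>, the
    second at most \<open>c s\<^sup>2\<close> by the choice of \<open>e\<close>, whence the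
    21.\<close>
  have "(\<integral>x. (norm (u x))\<^sup>2 * k (x - x0) \<partial>?M) \<le> (\<integral>x. 2 * ((norm (\<phi> x))\<^sup>2 * k (x - x0)) + 2 * (B * (norm (\<phi> x - u x))\<^sup>2) \<partial>?M)"
  proof (rule integral_mono[OF wint[OF l(5)]])
    show "integrable ?M (\<lambda>x. 2 * ((norm (\<phi> x))\<^sup>2 * k (x - x0)) + 2 * (B * (norm (\<phi> x - u x))\<^sup>2))"
      by (intro Bochner_Integration.integrable_add integrable_mult_right wint[OF l(1)] l2_integrable_sq[OF l2_diff[OF l(1,5)]])
    fix x
    have "(norm (u x))\<^sup>2 \<le> 2 * (norm (\<phi> x))\<^sup>2 + 2 * (norm (\<phi> x - u x))\<^sup>2"
      using zero_le_power2[of "2 * \<phi> x - u x"] by (simp add: power2_eq_square algebra_simps)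
    then have "(norm (u x))\<^sup>2 * k (x - x0) \<le> (2 * (norm (\<phi> x))\<^sup>2 + 2 * (norm (\<phi> x - u x))\<^sup>2) * k (x - x0)"
      by (intro mult_right_mono k(2))
    also have "\<dots> \<le> 2 * ((norm (\<phi> x))\<^sup>2 * k (x - x0)) + 2 * (B * (norm (\<phi> x - u x))\<^sup>2)"
      using mult_right_mono[OF k(3)[of "x - x0"], of "(norm (\<phi> x - u x))\<^sup>2"] by (simp add: algebra_simps)
    finally show "(norm (u x))\<^sup>2 * k (x - x0) \<le> 2 * ((norm (\<phi> x))\<^sup>2 * k (x - x0)) + 2 * (B * (norm (\<phi> x - u x))\<^sup>2)" .
  qed
  also have "\<dots> = 2 * (\<integral>x. (norm (\<phi> x))\<^sup>2 * k (x - x0) \<partial>?M) + 2 * (B * (n2 ?M (\<lambda>x. \<phi> x - u x))\<^sup>2)"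
    using wint[OF l(1)] l2_integrable_sq[OF l2_diff[OF l(1,5)]] unfolding n2_power2
    by (subst Bochner_Integration.integral_add) auto
  also have "\<dots> \<le> 2 * (10 * c * s\<^sup>2) + 2 * (B * e\<^sup>2)"
  proof (intro add_mono mult_left_mono power_mono)
    show "(\<integral>x. (norm (\<phi> x))\<^sup>2 * k (x - x0) \<partial>?M) \<le> 10 * c * s\<^sup>2"
      using pM(1)[OF p0] p10 by simp
  qed (use \<phi>(2) B in auto)
  also have "\<dots> \<le> 21 * c * s\<^sup>2" using eB by (simp add: algebra_simps)
  finally show ?thesis using that[OF x0(1)] by simp
qed

subsection \<open>Perturbing the first eigenfunction\<close>

lemma ground_state_energy:
  fixes \<Omega> :: "'a::euclidean_space set"
  assumes \<Omega>: "open \<Omega>" and u: "hlim \<Omega> u g" "n2 (lebesgue_on \<Omega>) u = 1" "(n2 (lebesgue_on \<Omega>) g)\<^sup>2 = rayleigh \<Omega>"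
    and \<eta>: "\<And>k. C_k k \<eta>" "\<And>x. 0 \<le> \<eta> x" "\<And>x. \<eta> x \<le> 1" "\<And>x. norm (gradient \<eta> x) \<le> B"
  obtains h where "hlim \<Omega> (\<lambda>x. \<eta> x * u x) h"
    "(n2 (lebesgue_on \<Omega>) h)\<^sup>2 = rayleigh \<Omega> * (n2 (lebesgue_on \<Omega>) (\<lambda>x. \<eta> x * u x))\<^sup>2
      + (\<integral>x. (u x)\<^sup>2 * (norm (gradient \<eta> x))\<^sup>2 \<partial>lebesgue_on \<Omega>)"
proof
  let ?M = "lebesgue_on \<Omega>"
  have B: "B \<ge> 0" using order_trans[OF norm_ge_zero \<eta>(4)] .
  define h where "h x = \<eta> x *\<^sub>R g x + u x *\<^sub>R gradient \<eta> x" for x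
  have \<eta>d: "\<eta> differentiable (at x)" for x using C_1_differentiable[OF \<eta>(1)] .
  have g2: "gradient (\<lambda>x. \<eta> x * \<eta> x) x = (2 * \<eta> x) *\<^sub>R gradient \<eta> x" for x
    using gradient_mult[OF \<eta>d \<eta>d, of x] by (simp add: scaleR_2 algebra_simps flip: scaleR_scaleR)
  show h: "hlim \<Omega> (\<lambda>x. \<eta> x * u x) h"
    unfolding h_def[abs_def]
    by (rule hlim_mult_smooth[OF \<Omega> u(1) \<eta>(1), where B="B + 1"]) (use \<eta> B in \<open>auto simp: add_increasing2 add_increasing abs_of_nonneg intro: order_trans\<close>)
  have h2: "hlim \<Omega> (\<lambda>x. (\<eta> x * \<eta> x) * u x) (\<lambda>x. (\<eta> x * \<eta> x) *\<^sub>R g x + u x *\<^sub>R ((2 * \<eta> x) *\<^sub>R gradient \<eta> x))"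
  proof -
    have b1: "\<bar>\<eta> x * \<eta> x\<bar> \<le> 2 * B + 1" for x
      using mult_le_one[OF \<eta>(3) \<eta>(2) \<eta>(3), of x x] \<eta>(2) B by (simp add: abs_mult)
    have b2: "norm (gradient (\<lambda>x. \<eta> x * \<eta> x) x) \<le> 2 * B + 1" for x
    proof -
      have "\<eta> x * norm (gradient \<eta> x) \<le> 1 * B" using \<eta>(2,3,4) B by (intro mult_mono) auto
      then show ?thesis using \<eta>(2)[of x] by (simp add: g2 abs_mult)
    qed
    show ?thesis
      using hlim_mult_smooth[OF \<Omega> u(1) C_k_mult[OF \<eta>(1) \<eta>(1)] b1 b2] by (simp add: g2)
  qed
  have lu: "l2 ?M (\<lambda>x. u x *\<^sub>R gradient \<eta> x)"
  proof (rule l2_boundI[OF hlim_l2(1)[OF u(1)], where C=B])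
    show "(\<lambda>x. u x *\<^sub>R gradient \<eta> x) \<in> borel_measurable ?M"
      by (rule borel_measurable_scaleR[OF l2_measurable[OF hlim_l2(1)[OF u(1)]]
            borel_measurable_lebesgue_on[OF borel_measurable_continuous_onI[OF continuous_gradient[OF \<eta>(1)]]]])
    show "AE x in ?M. norm (u x *\<^sub>R gradient \<eta> x) \<le> B * norm (u x)"
      using \<eta>(4) by (intro AE_I2) (auto simp: mult.commute[of B] intro!: mult_left_mono)
  qed
  \<comment> \<open>Pointwise, \<open>|D(\<eta> u)|\<^sup>2 = Du \<bullet> D(\<eta>\<^sup>2 u) +
    u\<^sup>2 |D\<eta>|\<^sup>2\<close>: the mixed term is absorbed completely by the test function
    \<open>\<eta>\<^sup>2 u\<close>.\<close>
  have "(n2 ?M h)\<^sup>2 = (\<integral>x. g x \<bullet> ((\<eta> x * \<eta> x) *\<^sub>R g x + u x *\<^sub>R ((2 * \<eta> x) *\<^sub>R gradient \<eta> x)) + (norm (u x *\<^sub>R gradient \<eta> x))\<^sup>2 \<partial>?M)"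
    unfolding n2_power2
    by (rule Bochner_Integration.integral_cong)
      (simp_all add: h_def power2_norm_eq_inner inner_add_left inner_add_right inner_commute algebra_simps, auto simp: power2_eq_square)
  also have "\<dots> = (\<integral>x. g x \<bullet> ((\<eta> x * \<eta> x) *\<^sub>R g x + u x *\<^sub>R ((2 * \<eta> x) *\<^sub>R gradient \<eta> x)) \<partial>?M) + (\<integral>x. (norm (u x *\<^sub>R gradient \<eta> x))\<^sup>2 \<partial>?M)"
    by (rule Bochner_Integration.integral_add[OF l2_inner_integrable[OF hlim_l2(2)[OF u(1)] hlim_l2(2)[OF h2]] l2_integrable_sq[OF lu]])
  also have "(\<integral>x. g x \<bullet> ((\<eta> x * \<eta> x) *\<^sub>R g x + u x *\<^sub>R ((2 * \<eta> x) *\<^sub>R gradient \<eta> x)) \<partial>?M) = rayleigh \<Omega> * (\<integral>x. u x * ((\<eta> x * \<eta> x) * u x) \<partial>?M)"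
    by (rule minimizer_eigen[OF \<Omega> u h2])
  also have "(\<integral>x. u x * ((\<eta> x * \<eta> x) * u x) \<partial>?M) = (n2 ?M (\<lambda>x. \<eta> x * u x))\<^sup>2"
    unfolding n2_power2 by (rule Bochner_Integration.integral_cong) (simp_all add: power2_eq_square)
  also have "(\<integral>x. (norm (u x *\<^sub>R gradient \<eta> x))\<^sup>2 \<partial>?M) = (\<integral>x. (u x)\<^sup>2 * (norm (gradient \<eta> x))\<^sup>2 \<partial>?M)"
    by (simp add: power_mult_distrib)
  finally show "(n2 ?M h)\<^sup>2 = rayleigh \<Omega> * (n2 ?M (\<lambda>x. \<eta> x * u x))\<^sup>2 + (\<integral>x. (u x)\<^sup>2 * (norm (gradient \<eta> x))\<^sup>2 \<partial>?M)" .
qed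

text \<open>The Rayleigh quotient of the unit bump. It depends only on the dimension, hence the type
  argument; a bump of radius \<open>r\<close> has quotient
  \<open>bump_energy / r\<^sup>2\<close>.\<close>

definition bump_energy :: "'a::euclidean_space itself \<Rightarrow> real" where
  "bump_energy _ = (n2 lborel (gradient (bump0 :: 'a \<Rightarrow> real)))\<^sup>2 / (n2 lborel (bump0 :: 'a \<Rightarrow> real))\<^sup>2"

text \<open>A shift of length 2 moves the bump off its own support, so the increment has squared
  norm twice that of the bump; by the translation estimate the energy cannot vanish.\<close>

lemma bump_energy_pos: "bump_energy TYPE('a::euclidean_space) > 0"
proof -
  let ?b = "bump0 :: 'a \<Rightarrow> real"
  note l = test_function_l2_lborel(1)[OF bump0_test_function[where 'a='a]]
  obtain e :: 'a where e: "e \<in> Basis" using nonempty_Basis by blast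
  define h where "h = 2 *\<^sub>R e"
  have nh: "norm h = 2" using e by (simp add: h_def)
  have z: "?b (x + h) \<bullet> - ?b x = 0" for x
  proof (rule ccontr)
    assume "?b (x + h) \<bullet> - ?b x \<noteq> 0"
    then have "x + h \<in> ball 0 1" "x \<in> ball 0 1"
      using test_function_outside(1)[OF bump0_test_function] by force+
    then show False using norm_triangle_ineq4[of "x + h" x] nh by simp
  qed
  have eq: "(n2 lborel (\<lambda>x. ?b (x + h) + - ?b x))\<^sup>2 = 2 * (n2 lborel ?b)\<^sup>2"
    using n2_add_power2[OF l2_lborel_translate(1)[OF l, of h] l2_uminus[OF l]]
    unfolding z by (simp add: l2_lborel_translate(2)[OF l] n2_uminus)
  have le: "n2 lborel (\<lambda>x. ?b (x + h) - ?b x) \<le> 2 * n2 lborel (gradient ?b)"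
    using test_function_translation[OF bump0_test_function, of h] nh by simp
  have "(n2 lborel ?b)\<^sup>2 > 0" using bump0_n2_pos[where 'a='a] by simp
  with eq have "(n2 lborel (\<lambda>x. ?b (x + h) - ?b x))\<^sup>2 > 0" by simp
  then have "n2 lborel (\<lambda>x. ?b (x + h) - ?b x) > 0"
    using n2_nonneg[of lborel "\<lambda>x. ?b (x + h) - ?b x"] by (metis less_eq_real_def zero_less_power2)
  also note le
  finally have "n2 lborel (gradient ?b) \<noteq> 0" by simp
  then show ?thesis using bump0_n2_pos[where 'a='a] by (simp add: bump_energy_def)
qed

text \<open>The competitor is \<open>w - v\<close>, with \<open>w\<close> a normalised bump of
  energy \<open>\<beta>\<close> in the ball and \<open>v\<close> the normalised
  \<open>\<eta> u\<close>. Both are nonnegative and never nonzero at the same point, so they are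
  exactly its positive and negative part. The number \<open>m\<close> bounds from below the mass
  that survives the cutoff.\<close>

lemma alpha_bounds:
  fixes \<Omega> :: "'a::euclidean_space set"
  assumes \<Omega>: "open \<Omega>" "bounded \<Omega>" "\<Omega> \<noteq> {}"
    and u: "hlim \<Omega> u g" "n2 (lebesgue_on \<Omega>) u = 1" "(n2 (lebesgue_on \<Omega>) g)\<^sup>2 = rayleigh \<Omega>" "\<And>x. u x \<ge> 0"
    and \<eta>: "\<And>k. C_k k \<eta>" "\<And>x. 0 \<le> \<eta> x" "\<And>x. \<eta> x \<le> 1" "\<And>x. norm (gradient \<eta> x) \<le> B"
    and r: "r > 0" "ball x0 r \<subseteq> \<Omega>" "\<And>x. x \<in> ball x0 r \<Longrightarrow> \<eta> x = 0"
    and m: "m > 0" "m \<le> (n2 (lebesgue_on \<Omega>) (\<lambda>x. \<eta> x * u x))\<^sup>2"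
  shows "rayleigh \<Omega> \<le> alpha \<Omega> (bump_energy TYPE('a) / r\<^sup>2)"
    and "alpha \<Omega> (bump_energy TYPE('a) / r\<^sup>2) \<le> rayleigh \<Omega> + (\<integral>x. (u x)\<^sup>2 * (norm (gradient \<eta> x))\<^sup>2 \<partial>lebesgue_on \<Omega>) / m"
proof -
  let ?M = "lebesgue_on \<Omega>" and ?\<beta> = "bump_energy TYPE('a) / r\<^sup>2"
  define I where "I = (\<integral>x. (u x)\<^sup>2 * (norm (gradient \<eta> x))\<^sup>2 \<partial>?M)"
  have I0: "I \<ge> 0" unfolding I_def by (intro Bochner_Integration.integral_nonneg) auto
  let ?S = "{dirichlet_energy \<Omega> (neg_part u) | u. u \<in> H10 \<Omega> \<and> L2_norm_on \<Omega> (pos_part u) = 1 \<and>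
     L2_norm_on \<Omega> (neg_part u) = 1 \<and> dirichlet_energy \<Omega> (pos_part u) = ?\<beta>}"
  have lower: "rayleigh \<Omega> \<le> t" if "t \<in> ?S" for t
  proof -
    from that obtain v where v: "t = dirichlet_energy \<Omega> (neg_part v)" "v \<in> H10 \<Omega>" "n2 ?M (neg_part v) = 1"
      by (auto simp: L2_norm_on_eq)
    obtain h where "hlim \<Omega> v h" using v(2) H10_iff[OF \<Omega>(1,2)] by blast
    note n = hlim_neg_part[OF \<Omega>(1) this]
    show ?thesis
      using rayleigh_hlim[OF \<Omega>(1) n] hlim_dirichlet_energy[OF \<Omega>(1,2) n] v(1,3) by simp
  qed
  define w0 where "w0 x = bump0 ((1 / r) *\<^sub>R x + - (1 / r) *\<^sub>R x0)" for x
  have w0: "test_function (ball x0 r) w0" unfolding w0_def[abs_def] by (rule test_function_affine[OF bump0_test_function r(1)])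
  have w0n: "(n2 lborel w0)\<^sup>2 = r ^ DIM('a) * (n2 lborel (bump0 :: 'a \<Rightarrow> real))\<^sup>2"
    "(n2 lborel (gradient w0))\<^sup>2 = r ^ DIM('a) / r\<^sup>2 * (n2 lborel (gradient (bump0 :: 'a \<Rightarrow> real)))\<^sup>2"
    unfolding w0_def[abs_def] by (rule n2_scaled[OF bump0_test_function r(1)])+
  have bp: "(n2 lborel (bump0 :: 'a \<Rightarrow> real))\<^sup>2 > 0" using bump0_n2_pos[where 'a='a] by simp
  have w0p: "n2 lborel w0 > 0"
  proof -
    have "(n2 lborel w0)\<^sup>2 > 0" unfolding w0n(1) by (intro mult_pos_pos zero_less_power r(1) bp)
    then show ?thesis using n2_nonneg[of lborel w0] by (metis less_eq_real_def zero_less_power2)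
  qed
  define w where "w x = (1 / n2 lborel w0) * w0 x" for x
  have w: "test_function \<Omega> w" using test_function_cmult[OF w0, of "1 / n2 lborel w0"] r(2) by (auto simp: test_function_def w_def[abs_def])
  have w_nonneg: "w x \<ge> 0" for x by (simp add: w_def w0_def bump0_nonneg)
  have w_out: "w x = 0" if "x \<notin> ball x0 r" for x using test_function_outside(1)[OF w0 that] by (simp add: w_def)
  have w1: "n2 ?M w = 1"
    using test_function_l2(3)[OF \<Omega>(1) w] n2_scaleR[of lborel "1 / n2 lborel w0" w0] w0p by (simp add: w_def[abs_def])
  have wE: "(n2 ?M (gradient w))\<^sup>2 = ?\<beta>"
  proof -
    have "gradient w = (\<lambda>x. (1 / n2 lborel w0) *\<^sub>R gradient w0 x)"
      unfolding w_def[abs_def] by (rule ext, rule gradient_cmult, rule test_function_differentiable[OF w0])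
    then have "(n2 lborel (gradient w))\<^sup>2 = (n2 lborel (gradient w0))\<^sup>2 / (n2 lborel w0)\<^sup>2"
      by (simp only: n2_scaleR) (simp add: power_mult_distrib power_divide)
    also have "\<dots> = ?\<beta>" unfolding w0n bump_energy_def using r(1) bp by (simp add: field_simps)
    finally show ?thesis using test_function_l2(4)[OF \<Omega>(1) w] by simp
  qed
  obtain h where h: "hlim \<Omega> (\<lambda>x. \<eta> x * u x) h" "(n2 ?M h)\<^sup>2 = rayleigh \<Omega> * (n2 ?M (\<lambda>x. \<eta> x * u x))\<^sup>2 + I"
    unfolding I_def by (rule ground_state_energy[OF \<Omega>(1) u(1-3) \<eta>])
  define \<mu> where "\<mu> = n2 ?M (\<lambda>x. \<eta> x * u x)"
  have \<mu>: "\<mu> > 0" "m \<le> \<mu>\<^sup>2"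
    using m n2_nonneg[of ?M "\<lambda>x. \<eta> x * u x"] by (auto simp: \<mu>_def less_eq_real_def)
  define v where "v x = (1 / \<mu>) * (\<eta> x * u x)" for x
  have v: "hlim \<Omega> v (\<lambda>x. (1 / \<mu>) *\<^sub>R h x)" unfolding v_def[abs_def] by (rule hlim_cmult[OF \<Omega>(1) h(1)])
  have v1: "n2 ?M v = 1"
    using n2_scaleR[of ?M "1 / \<mu>" "\<lambda>x. \<eta> x * u x"] \<mu>(1) by (simp add: v_def[abs_def] \<mu>_def[symmetric])
  have vE: "(n2 ?M (\<lambda>x. (1 / \<mu>) *\<^sub>R h x))\<^sup>2 = rayleigh \<Omega> + I / \<mu>\<^sup>2"
    unfolding n2_scaleR power_mult_distrib h(2) using \<mu>(1) by (simp add: \<mu>_def[symmetric] field_simps power2_eq_square)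
  have v_nonneg: "v x \<ge> 0" for x using \<mu>(1) \<eta>(2) u(4) by (simp add: v_def)
  have vw: "v x = 0 \<or> w x = 0" for x using w_out[of x] r(3)[of x] by (auto simp: v_def)
  define U where "U x = w x - v x" for x
  have U: "hlim \<Omega> U (\<lambda>x. gradient w x - (1 / \<mu>) *\<^sub>R h x)"
    unfolding U_def[abs_def] by (rule hlim_diff[OF \<Omega>(1) hlim_test_function[OF \<Omega>(1) w] v])
  have "pos_part U x = w x \<and> neg_part U x = v x" for x
    using w_nonneg[of x] v_nonneg[of x] vw[of x] by (auto simp: pos_part_def neg_part_def U_def max_def)
  then have pos: "pos_part U = w" and neg: "neg_part U = v" by (simp_all add: fun_eq_iff)
  have "dirichlet_energy \<Omega> (neg_part U) \<in> ?S"
  proof -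
    have "U \<in> H10 \<Omega>" using H10_iff[OF \<Omega>(1,2)] U by blast
    moreover have "dirichlet_energy \<Omega> (pos_part U) = ?\<beta>"
      unfolding pos hlim_dirichlet_energy[OF \<Omega>(1,2) hlim_test_function[OF \<Omega>(1) w]] by (rule wE)
    moreover have "L2_norm_on \<Omega> (pos_part U) = 1" "L2_norm_on \<Omega> (neg_part U) = 1"
      unfolding pos neg L2_norm_on_eq by (fact w1, fact v1)
    ultimately show ?thesis by blast
  qed
  moreover have "dirichlet_energy \<Omega> (neg_part U) = rayleigh \<Omega> + I / \<mu>\<^sup>2"
    unfolding neg hlim_dirichlet_energy[OF \<Omega>(1,2) v] by (rule vE)
  ultimately have mem: "rayleigh \<Omega> + I / \<mu>\<^sup>2 \<in> ?S" by simp
  \<comment> \<open>The competitor is needed for the lower bound as well: \<open>Inf\<close> says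
    nothing about an empty set.\<close>
  show "rayleigh \<Omega> \<le> alpha \<Omega> ?\<beta>"
    unfolding alpha_def using mem by (intro cInf_greatest lower) auto
  have "alpha \<Omega> ?\<beta> \<le> rayleigh \<Omega> + I / \<mu>\<^sup>2"
    unfolding alpha_def using mem lower by (intro cInf_lower bdd_belowI[of _ "rayleigh \<Omega>"])
  also have "I / \<mu>\<^sup>2 \<le> I / m" using m \<mu> I0 by (intro divide_left_mono) auto
  finally show "alpha \<Omega> ?\<beta> \<le> rayleigh \<Omega> + (\<integral>x. (u x)\<^sup>2 * (norm (gradient \<eta> x))\<^sup>2 \<partial>lebesgue_on \<Omega>) / m"
    by (simp add: I_def)
qed

subsection \<open>Dyadic cutoff functions\<close>

text \<open>Outside the open unit interval \<open>step\<close> attains its minimum 0 or its maximum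
  1, so the derivative vanishes there; being continuous with compact support, it is bounded.\<close>

lemma step_derivative:
  "\<exists>s' S. (\<forall>t. (step has_real_derivative s' t) (at t)) \<and> S > 0 \<and> (\<forall>t. \<bar>s' t\<bar> \<le> S) \<and>
    (\<forall>t. t \<le> 0 \<or> t \<ge> 1 \<longrightarrow> s' t = 0)"
proof -
  have C1: "C_k (Suc 0) step" by (rule C_k_step)
  define s' where "s' t = frechet_derivative step (at t) 1" for t :: real
  have lin: "frechet_derivative step (at t) v = s' t * v" for t v
    using linear_cmul[OF has_derivative_linear[OF C_k_SucD(1)[OF C1]], of t v 1]
    by (simp add: s'_def mult.commute[of v])
  have d: "(step has_real_derivative s' t) (at t)" for t
  proof -
    have "frechet_derivative step (at t) = (*) (s' t)" by (rule ext) (rule lin)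
    then show ?thesis using C_k_SucD(1)[OF C1, of t] by (simp only: has_field_derivative_def)
  qed
  have z: "s' t = 0" if "t \<le> 0 \<or> t \<ge> 1" for t
  proof (cases "t \<le> 0")
    case True
    show ?thesis by (rule DERIV_local_min[OF d zero_less_one]) (simp add: step_0[OF True] step_nonneg)
  next
    case False
    then have "t \<ge> 1" using that by simp
    show ?thesis by (rule DERIV_local_max[OF d zero_less_one]) (simp add: step_1[OF \<open>t \<ge> 1\<close>] step_le_1)
  qed
  have c: "continuous_on UNIV s'"
    using C_k_SucD(2)[OF C1, of 1] by (simp add: s'_def[abs_def])
  obtain S where "S > 0" "\<And>t. norm (s' t) \<le> S"
    by (rule compact_support_bounded[OF c, of "{0..1}"]) (use z in auto)
  then show ?thesis using d z by (intro exI[of _ s'] exI[of _ S]) auto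
qed

text \<open>The argument is affine in the squared norm, which keeps it smooth at the origin, and
  takes the value 0 at \<open>norm x = b\<close> and 1 at \<open>norm x = 2 * b\<close>.\<close>

definition annulus_cut :: "real \<Rightarrow> 'a::euclidean_space \<Rightarrow> real" where
  "annulus_cut b x = step ((1 / (3 * b\<^sup>2)) * (norm x)\<^sup>2 + - (1 / 3))"

lemma C_k_annulus_cut: "C_k k (annulus_cut b)"
  unfolding annulus_cut_def[abs_def]
  by (rule C_k_comp[OF C_k_step C_k_add[OF C_k_cmult[OF C_k_norm_sq] C_k_const]])

lemma annulus_cut_arg:
  fixes x :: "'a::euclidean_space"
  assumes "b > 0"
  shows "norm x \<le> b \<Longrightarrow> (1 / (3 * b\<^sup>2)) * (norm x)\<^sup>2 + - (1 / 3) \<le> 0"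
    and "2 * b \<le> norm x \<Longrightarrow> (1 / (3 * b\<^sup>2)) * (norm x)\<^sup>2 + - (1 / 3) \<ge> 1"
proof -
  assume "norm x \<le> b"
  then have "(norm x)\<^sup>2 \<le> b\<^sup>2" by (intro power_mono) auto
  then show "(1 / (3 * b\<^sup>2)) * (norm x)\<^sup>2 + - (1 / 3) \<le> 0" using assms by (simp add: field_simps)
next
  assume "2 * b \<le> norm x"
  then have "(2 * b)\<^sup>2 \<le> (norm x)\<^sup>2" using assms by (intro power_mono) auto
  then show "(1 / (3 * b\<^sup>2)) * (norm x)\<^sup>2 + - (1 / 3) \<ge> 1" using assms by (simp add: field_simps)
qed

lemma annulus_cut_gradient:
  "\<exists>S>0. (\<forall>b>0. \<forall>x::'a::euclidean_space. norm (gradient (annulus_cut b) x) \<le> S / b) \<and>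
    (\<forall>b>0. \<forall>x::'a. norm x \<le> b \<or> 2 * b \<le> norm x \<longrightarrow> gradient (annulus_cut b) x = 0)"
proof -
  obtain s' S where s0: "\<forall>t. (step has_real_derivative s' t) (at t)" "S > 0" "\<forall>t. \<bar>s' t\<bar> \<le> S"
    "\<forall>t. t \<le> 0 \<or> t \<ge> 1 \<longrightarrow> s' t = 0"
    using step_derivative by (elim exE conjE) (rule that)
  note s = s0(1)[rule_format] s0(2) s0(3)[rule_format] s0(4)[rule_format]
  define a where "a b x = (1 / (3 * b\<^sup>2)) * (norm x)\<^sup>2 + - (1 / 3)" for b and x :: 'a
  have ga: "gradient (annulus_cut b) x = s' (a b x) *\<^sub>R ((2 / (3 * b\<^sup>2)) *\<^sub>R x)" for b and x :: 'a
  proof -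
    have dn: "(\<lambda>x::'a. (norm x)\<^sup>2) differentiable (at x)" by (rule C_1_differentiable[OF C_k_norm_sq])
    have "C_k 1 (a b)" unfolding a_def[abs_def] by (rule C_k_add[OF C_k_cmult[OF C_k_norm_sq] C_k_const])
    then have da: "a b differentiable (at x)" by (rule C_1_differentiable)
    have "gradient (\<lambda>x::'a. - (1 / 3)) x = 0" by (rule gradient_eqI) simp
    then have "gradient (a b) x = (1 / (3 * b\<^sup>2)) *\<^sub>R (2 *\<^sub>R x)"
      unfolding a_def[abs_def]
      using gradient_add[of "\<lambda>x::'a. (1 / (3 * b\<^sup>2)) * (norm x)\<^sup>2" x "\<lambda>x. - (1 / 3)"]
        C_1_differentiable[OF C_k_cmult[OF C_k_norm_sq], of "1 / (3 * b\<^sup>2)" x]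
        C_1_differentiable[OF C_k_const, of "- (1 / 3)" x]
        gradient_cmult[OF dn, of "1 / (3 * b\<^sup>2)"] gradient_norm_sq[of x] by simp
    then show ?thesis
      using gradient_comp[OF da s(1)] by (simp add: annulus_cut_def[abs_def] a_def[abs_def])
  qed
  have z: "gradient (annulus_cut b) x = 0" if "b > 0" "norm x \<le> b \<or> 2 * b \<le> norm x" for b and x :: 'a
  proof -
    have "s' (a b x) = 0"
      using that(2) annulus_cut_arg[OF that(1), of x] unfolding a_def by (intro s(4)) blast
    then show ?thesis by (simp add: ga)
  qed
  show ?thesis
  \<comment> \<open>On \<open>norm x \<le> 2 * b\<close> the argument of \<open>step\<close> has
    gradient at most \<open>4 / (3 * b)\<close>, so \<open>2 * S\<close> is ample.\<close>
  proof (intro exI[of _ "2 * S"] conjI allI impI)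
    show "2 * S > 0" using s(2) by simp
    show "gradient (annulus_cut b) x = 0" if "b > 0" "norm x \<le> b \<or> 2 * b \<le> norm x" for b and x :: 'a
      by (rule z[OF that])
    show "norm (gradient (annulus_cut b) x) \<le> 2 * S / b" if "b > 0" for b and x :: 'a
    proof (cases "norm x \<le> 2 * b")
      case True
      have "norm (gradient (annulus_cut b) x) = \<bar>s' (a b x)\<bar> * ((2 / (3 * b\<^sup>2)) * norm x)"
        by (simp add: ga abs_mult)
      also have "\<dots> \<le> S * ((2 / (3 * b\<^sup>2)) * (2 * b))"
        using True s(2) \<open>b > 0\<close> by (intro mult_mono s(3)) auto
      also have "\<dots> = (4 / 3) * S / b" using \<open>b > 0\<close> by (simp add: field_simps power2_eq_square)
      also have "\<dots> \<le> 2 * S / b" using s(2) \<open>b > 0\<close> by (intro divide_right_mono) auto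
      finally show ?thesis .
    next
      case False
      then show ?thesis using z[OF \<open>b > 0\<close>, of x] s(2) \<open>b > 0\<close> by simp
    qed
  qed
qed

text \<open>Averaging the cutoffs of \<open>J\<close> dyadic annuli divides the Dirichlet energy of the average by \<open>J\<^sup>2\<close>, since
  the gradients have disjoint supports.  In dimension 2 every annulus contributes the same
  energy, which yields the logarithmic capacity \<open>O(1 / J)\<close>.\<close>

lemma cutoff_exists:
  "\<exists>C>0. \<forall>r>0. \<forall>J\<ge>1. \<exists>\<eta>::'a::euclidean_space \<Rightarrow> real. (\<forall>k. C_k k \<eta>) \<and> (\<forall>x. 0 \<le> \<eta> x \<and> \<eta> x \<le> 1) \<and>
      (\<forall>x. norm x \<le> r \<longrightarrow> \<eta> x = 0) \<and> (\<forall>x. 2 ^ J * r \<le> norm x \<longrightarrow> \<eta> x = 1 \<and> gradient \<eta> x = 0) \<and>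
      (\<exists>B. \<forall>x. norm (gradient \<eta> x) \<le> B) \<and>
      (\<integral>\<^sup>+x. ennreal ((norm (gradient \<eta> x))\<^sup>2) \<partial>lborel)
        \<le> ennreal (C / (real J)\<^sup>2 * (\<Sum>j<J. (2 ^ j * r) ^ DIM('a) / (2 ^ j * r)\<^sup>2))"
proof -
  obtain S where S0: "S > 0"
    "\<forall>b>0. \<forall>x::'a. norm (gradient (annulus_cut b) x) \<le> S / b"
    "\<forall>b>0. \<forall>x::'a. norm x \<le> b \<or> 2 * b \<le> norm x \<longrightarrow> gradient (annulus_cut b) x = 0"
    using annulus_cut_gradient[where 'a='a] by (elim exE conjE) (rule that)
  note S = S0(1) S0(2)[rule_format] S0(3)[rule_format]
  define \<omega> where "\<omega> = measure lborel (ball (0::'a) 1)"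
  have \<omega>: "\<omega> > 0" using content_ball_pos[of 1 "0::'a"] by (simp add: \<omega>_def)
  have vol: "measure lborel (ball (0::'a) t) = \<omega> * t ^ DIM('a)" if "t \<ge> 0" for t
    using content_ball[of t "0::'a"] content_ball[of 1 "0::'a"] that by (simp add: \<omega>_def)
  \<comment> \<open>Square of the gradient bound times the volume of a ball of radius
    \<open>2 * b j\<close>, with the powers of \<open>b j\<close> taken out.\<close>
  define C where "C = S\<^sup>2 * \<omega> * 2 ^ DIM('a)"
  have C: "C > 0" using S(1) \<omega> by (simp add: C_def)
  show ?thesis
  proof (intro exI[of _ C] conjI[OF C] allI impI)
    fix r :: real and J :: nat assume r: "r > 0" and J: "J \<ge> 1"
    define b where "b j = 2 ^ j * r" for j :: nat
    have b: "b j > 0" for j using r by (simp add: b_def)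
    have bb: "2 * b i \<le> b j" if "i < j" for i j
    proof -
      have "(2::real) ^ Suc i \<le> 2 ^ j" using that by (intro power_increasing) auto
      then have "2 ^ Suc i * r \<le> 2 ^ j * r" using r by (intro mult_right_mono) auto
      then show ?thesis by (simp add: b_def)
    qed
    define \<eta> where "\<eta> x = (1 / real J) * (\<Sum>j<J. annulus_cut (b j) x)" for x :: 'a
    have \<eta>C: "C_k k \<eta>" for k
      unfolding \<eta>_def[abs_def] by (intro C_k_cmult C_k_sum C_k_annulus_cut)
    have a01: "0 \<le> annulus_cut t x" "annulus_cut t x \<le> 1" for t and x :: 'a
      by (simp_all add: annulus_cut_def step_nonneg step_le_1)
    have \<eta>01: "0 \<le> \<eta> x \<and> \<eta> x \<le> 1" for x
    proof
      show "0 \<le> \<eta> x" unfolding \<eta>_def by (intro mult_nonneg_nonneg sum_nonneg a01) simp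
      have "(\<Sum>j<J. annulus_cut (b j) x) \<le> (\<Sum>j<J. 1)" by (intro sum_mono a01)
      then show "\<eta> x \<le> 1" using J by (simp add: \<eta>_def)
    qed
    have \<eta>0: "\<eta> x = 0" if "norm x \<le> r" for x
    proof -
      have "annulus_cut (b j) x = 0" for j
      proof -
        have "r \<le> b j" using r by (simp add: b_def mult_le_cancel_right1)
        then show ?thesis unfolding annulus_cut_def using that by (intro step_0 annulus_cut_arg(1) b) simp
      qed
      then show ?thesis by (simp add: \<eta>_def)
    qed
    have out: "2 * b j \<le> norm x" if "2 ^ J * r \<le> norm x" "j < J" for x :: 'a and j
      using bb[OF that(2)] that(1) by (simp add: b_def[of J])
    have \<eta>1: "\<eta> x = 1" if "2 ^ J * r \<le> norm x" for x
    proof -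
      have "annulus_cut (b j) x = 1" if "j < J" for j
        unfolding annulus_cut_def by (intro step_1 annulus_cut_arg(2) b out) fact+
      then show ?thesis using J by (simp add: \<eta>_def)
    qed
    have ad: "annulus_cut t differentiable (at x)" for t and x :: 'a
      by (rule C_1_differentiable[OF C_k_annulus_cut])
    have sd: "(\<lambda>x. \<Sum>j<J. annulus_cut (b j) x) differentiable (at x)" for x :: 'a
      by (rule C_1_differentiable) (intro C_k_sum C_k_annulus_cut)
    have gr: "gradient \<eta> x = (1 / real J) *\<^sub>R (\<Sum>j<J. gradient (annulus_cut (b j)) x)" for x
      unfolding \<eta>_def[abs_def] gradient_cmult[OF sd] by (simp add: gradient_sum[OF ad])
    have g0: "gradient \<eta> x = 0" if "2 ^ J * r \<le> norm x" for x
    proof -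
      have "(\<Sum>j<J. gradient (annulus_cut (b j)) x) = 0"
        by (intro sum.neutral ballI S(3)[OF b] disjI2 out[OF that]) simp
      then show ?thesis by (simp add: gr)
    qed
    \<comment> \<open>Since \<open>2 * b i \<le> b j\<close> for \<open>i < j\<close>, at most one
      of the gradients is nonzero at \<open>x\<close>, and squaring the sum creates no mixed terms.
      Each annulus is then enlarged to a full ball.\<close>
    have gsq: "(norm (gradient \<eta> x))\<^sup>2 \<le> (\<Sum>j<J. (S / b j)\<^sup>2 / (real J)\<^sup>2 * indicator (ball 0 (2 * b j)) x)" for x
    proof (cases "\<exists>i<J. b i < norm x \<and> norm x < 2 * b i")
      case False
      have "(\<Sum>j<J. gradient (annulus_cut (b j)) x) = 0"
      proof (intro sum.neutral ballI S(3)[OF b])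
        fix j assume "j \<in> {..<J}"
        then have "\<not> (b j < norm x \<and> norm x < 2 * b j)" using False by blast
        then show "norm x \<le> b j \<or> 2 * b j \<le> norm x" by linarith
      qed
      then show ?thesis by (simp add: gr sum_nonneg)
    next
      case True
      then obtain i where i: "i < J" "b i < norm x" "norm x < 2 * b i" by blast
      have "gradient (annulus_cut (b j)) x = 0" if "j \<noteq> i" for j
      proof (rule S(3)[OF b])
        show "norm x \<le> b j \<or> 2 * b j \<le> norm x"
          using bb[of i j] bb[of j i] i that by (cases "i < j") auto
      qed
      then have "(\<Sum>j<J. gradient (annulus_cut (b j)) x) = gradient (annulus_cut (b i)) x"
        using i(1) by (subst sum.remove[of _ i]) auto
      then have "norm (gradient \<eta> x) = norm (gradient (annulus_cut (b i)) x) / real J"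
        by (simp add: gr)
      also have "\<dots> \<le> (S / b i) / real J" by (rule divide_right_mono[OF S(2)[OF b]]) simp
      finally have "norm (gradient \<eta> x) \<le> (S / b i) / real J" .
      then have "(norm (gradient \<eta> x))\<^sup>2 \<le> ((S / b i) / real J)\<^sup>2" by (intro power_mono) auto
      also have "\<dots> = (S / b i)\<^sup>2 / (real J)\<^sup>2 * indicator (ball 0 (2 * b i)) x"
        using i(3) by (simp add: power_divide power_mult_distrib)
      also have "\<dots> \<le> (\<Sum>j<J. (S / b j)\<^sup>2 / (real J)\<^sup>2 * indicator (ball 0 (2 * b j)) x)"
        using i(1) by (intro member_le_sum) auto
      finally show ?thesis .
    qed
    have int: "integrable lborel (\<lambda>x::'a. (S / b j)\<^sup>2 / (real J)\<^sup>2 * indicator (ball 0 (2 * b j)) x)" for j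
      using emeasure_bounded_finite[OF bounded_ball[of "0::'a" "2 * b j"]]
      by (intro integrable_mult_right integrable_real_indicator) auto
    have "(\<integral>\<^sup>+x. ennreal ((norm (gradient \<eta> x))\<^sup>2) \<partial>lborel)
      \<le> (\<integral>\<^sup>+x. ennreal (\<Sum>j<J. (S / b j)\<^sup>2 / (real J)\<^sup>2 * indicator (ball (0::'a) (2 * b j)) x) \<partial>lborel)"
      by (intro nn_integral_mono ennreal_leI gsq)
    also have "\<dots> = ennreal (\<integral>x. (\<Sum>j<J. (S / b j)\<^sup>2 / (real J)\<^sup>2 * indicator (ball (0::'a) (2 * b j)) x) \<partial>lborel)"
      by (intro nn_integral_eq_integral Bochner_Integration.integrable_sum int AE_I2 sum_nonneg) auto
    also have "(\<integral>x. (\<Sum>j<J. (S / b j)\<^sup>2 / (real J)\<^sup>2 * indicator (ball (0::'a) (2 * b j)) x) \<partial>lborel)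
        = (\<Sum>j<J. (S / b j)\<^sup>2 / (real J)\<^sup>2 * measure lborel (ball (0::'a) (2 * b j)))"
      by (subst Bochner_Integration.integral_sum[OF int]) simp
    also have "\<dots> = (\<Sum>j<J. C / (real J)\<^sup>2 * (b j ^ DIM('a) / (b j)\<^sup>2))"
    proof (rule sum.cong[OF refl])
      fix j
      have "measure lborel (ball (0::'a) (2 * b j)) = \<omega> * (2 ^ DIM('a) * b j ^ DIM('a))"
        using vol[of "2 * b j"] b[of j] by (simp add: power_mult_distrib)
      then show "(S / b j)\<^sup>2 / (real J)\<^sup>2 * measure lborel (ball (0::'a) (2 * b j)) = C / (real J)\<^sup>2 * (b j ^ DIM('a) / (b j)\<^sup>2)"
        by (simp add: C_def power_divide mult_ac)
    qed
    also have "\<dots> = C / (real J)\<^sup>2 * (\<Sum>j<J. b j ^ DIM('a) / (b j)\<^sup>2)" by (simp add: sum_distrib_left)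
    finally have int_le: "(\<integral>\<^sup>+x. ennreal ((norm (gradient \<eta> x))\<^sup>2) \<partial>lborel)
      \<le> ennreal (C / (real J)\<^sup>2 * (\<Sum>j<J. (2 ^ j * r) ^ DIM('a) / (2 ^ j * r)\<^sup>2))"
      by (simp only: b_def)
    have gz: "x \<notin> cball 0 (2 ^ J * r) \<Longrightarrow> gradient \<eta> x = 0" for x by (rule g0) simp
    have Bex: "\<exists>B. \<forall>x. norm (gradient \<eta> x) \<le> B"
    proof (rule compact_support_bounded[OF continuous_gradient[OF \<eta>C] compact_cball gz])
      fix B assume "\<And>x. norm (gradient \<eta> x) \<le> B"
      then show ?thesis by (intro exI[of _ B] allI)
    qed
    show "\<exists>\<eta>::'a \<Rightarrow> real. (\<forall>k. C_k k \<eta>) \<and> (\<forall>x. 0 \<le> \<eta> x \<and> \<eta> x \<le> 1) \<and>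
      (\<forall>x. norm x \<le> r \<longrightarrow> \<eta> x = 0) \<and> (\<forall>x. 2 ^ J * r \<le> norm x \<longrightarrow> \<eta> x = 1 \<and> gradient \<eta> x = 0) \<and>
      (\<exists>B. \<forall>x. norm (gradient \<eta> x) \<le> B) \<and>
      (\<integral>\<^sup>+x. ennreal ((norm (gradient \<eta> x))\<^sup>2) \<partial>lborel)
        \<le> ennreal (C / (real J)\<^sup>2 * (\<Sum>j<J. (2 ^ j * r) ^ DIM('a) / (2 ^ j * r)\<^sup>2))"
    proof (intro exI[of _ \<eta>] conjI allI impI)
      show "C_k k \<eta>" for k by (rule \<eta>C)
      show "0 \<le> \<eta> x" "\<eta> x \<le> 1" for x using \<eta>01[of x] by auto
      show "norm x \<le> r \<Longrightarrow> \<eta> x = 0" for x by (rule \<eta>0)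
      show "2 ^ J * r \<le> norm x \<Longrightarrow> \<eta> x = 1" for x by (rule \<eta>1)
      show "2 ^ J * r \<le> norm x \<Longrightarrow> gradient \<eta> x = 0" for x by (rule g0)
      show "\<exists>B. \<forall>x. norm (gradient \<eta> x) \<le> B" by (rule Bex)
    qed (rule int_le)
  qed
qed

subsection \<open>The asymptotic bound\<close>

lemma weighted_integrable:
  fixes u :: "'a::euclidean_space \<Rightarrow> real"
  assumes "l2 (lebesgue_on \<Omega>) u" "q \<in> borel_measurable borel" "\<And>x. 0 \<le> q x" "\<And>x. q x \<le> B"
  shows "integrable (lebesgue_on \<Omega>) (\<lambda>x. (u x)\<^sup>2 * q (x - x0))"
proof (rule Bochner_Integration.integrable_bound[OF integrable_mult_left[OF l2_integrable_sq[OF assms(1)], of B]])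
  note [measurable] = assms(2)
  have m: "(\<lambda>x. q (x - x0)) \<in> borel_measurable (lebesgue_on \<Omega>)" by (intro borel_measurable_lebesgue_on) measurable
  show "(\<lambda>x. (u x)\<^sup>2 * q (x - x0)) \<in> borel_measurable (lebesgue_on \<Omega>)"
    using l2_measurable[OF assms(1)] m by measurable
  have "B \<ge> 0" by (rule order_trans[OF assms(3,4)])
  then show "AE x in lebesgue_on \<Omega>. norm ((u x)\<^sup>2 * q (x - x0)) \<le> norm ((norm (u x))\<^sup>2 * B)"
    using assms(3,4) by (intro AE_I2) (auto simp: abs_mult intro!: mult_left_mono)
qed

text \<open>\<open>C\<close> is independent of \<open>s\<close>, and only the range of radii shrinks
  with \<open>s\<close>; letting \<open>s\<close> tend to 0 is what makes both limits
  vanish.\<close>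

lemma alpha_asymptotic_bound:
  fixes \<Omega> :: "'a::euclidean_space set"
  assumes \<Omega>: "open \<Omega>" "bounded \<Omega>" "\<Omega> \<noteq> {}"
  obtains C where "C > 0" "\<And>s. s > 0 \<Longrightarrow> \<exists>R>0. \<forall>r>0. \<forall>J\<ge>1::nat. 2 ^ J * r \<le> R \<longrightarrow>
    rayleigh \<Omega> \<le> alpha \<Omega> (bump_energy TYPE('a) / r\<^sup>2) \<and>
    alpha \<Omega> (bump_energy TYPE('a) / r\<^sup>2) \<le> rayleigh \<Omega>
      + 84 * s\<^sup>2 * (C / (real J)\<^sup>2 * (\<Sum>j<J. (2 ^ j * r) ^ DIM('a) / (2 ^ j * r)\<^sup>2))"
proof -
  let ?M = "lebesgue_on \<Omega>"
  obtain C where C: "C > 0"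
    "\<forall>r>0. \<forall>J\<ge>1. \<exists>\<eta>::'a \<Rightarrow> real. (\<forall>k. C_k k \<eta>) \<and> (\<forall>x. 0 \<le> \<eta> x \<and> \<eta> x \<le> 1) \<and>
      (\<forall>x. norm x \<le> r \<longrightarrow> \<eta> x = 0) \<and> (\<forall>x. 2 ^ J * r \<le> norm x \<longrightarrow> \<eta> x = 1 \<and> gradient \<eta> x = 0) \<and>
      (\<exists>B. \<forall>x. norm (gradient \<eta> x) \<le> B) \<and>
      (\<integral>\<^sup>+x. ennreal ((norm (gradient \<eta> x))\<^sup>2) \<partial>lborel)
        \<le> ennreal (C / (real J)\<^sup>2 * (\<Sum>j<J. (2 ^ j * r) ^ DIM('a) / (2 ^ j * r)\<^sup>2))"
    using cutoff_exists[where 'a='a] by (elim exE conjE) (rule that)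
  obtain u g where u: "hlim \<Omega> u g" "n2 ?M u = 1" "(n2 ?M g)\<^sup>2 = rayleigh \<Omega>" "\<forall>x. u x \<ge> 0"
    by (rule nonneg_minimizer_exists[OF \<Omega>])
  note lu = hlim_l2(1)[OF u(1)]
  define \<omega> where "\<omega> = measure lborel (ball (0::'a) 1)"
  have \<omega>: "\<omega> > 0" using content_ball_pos[of 1 "0::'a"] by (simp add: \<omega>_def)
  show ?thesis
  proof (rule that[OF C(1)])
    fix s :: real assume s: "s > 0"
    obtain K where K: "compact K" "K \<subseteq> \<Omega>" "measure lborel K > 0" "\<forall>x\<in>K. \<bar>u x\<bar> < s"
      by (rule small_values_compact[OF \<Omega> u(1) s])
    obtain d where d: "d > 0" "(\<Union>x\<in>K. ball x d) \<subseteq> \<Omega>"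
      by (rule compact_subset_open_imp_ball_epsilon_subset[OF K(1) \<Omega>(1) K(2)])
    define G where "G = n2 ?M g + 1"
    have G: "G > 0" using n2_nonneg[of ?M g] unfolding G_def by linarith
    \<comment> \<open>\<open>d\<close> keeps the bump inside \<open>\<Omega>\<close>, the quotient
      by \<open>G\<close> is the hypothesis of \<open>good_centre\<close>, and the last bound,
      combined with \<open>R \<le> 1\<close>, limits to 1/2 the mass of \<open>u\<close> in the ball
      of radius \<open>R\<close> about the centre.\<close>
    define R where "R = min (min 1 d) (min (s * sqrt (measure lborel K) / G) (1 / (84 * s\<^sup>2 * \<omega>)))"
    have R: "R > 0" "R \<le> 1" "R \<le> d" "R \<le> s * sqrt (measure lborel K) / G" "R \<le> 1 / (84 * s\<^sup>2 * \<omega>)"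
      using s d(1) G K(3) \<omega> by (auto simp: R_def)
    have RG: "R * (n2 ?M g + 1) \<le> s * sqrt (measure lborel K)"
      using R(4) G by (simp add: G_def[symmetric] pos_le_divide_eq)
    define V where "V = measure lborel (ball (0::'a) R)"
    have V: "V > 0" using content_ball_pos[OF R(1), of "0::'a"] by (simp add: V_def)
    have VR: "42 * s\<^sup>2 * V \<le> 1 / 2"
    proof -
      have "V = \<omega> * R ^ DIM('a)"
        using content_ball[of R "0::'a"] content_ball[of 1 "0::'a"] R(1) by (simp add: \<omega>_def V_def)
      also have "R ^ DIM('a) \<le> R ^ 1" using R(1,2) by (intro power_decreasing) (auto simp: DIM_positive Suc_leI)
      finally have "V \<le> \<omega> * R" using \<omega> by simp
      also have "\<dots> \<le> \<omega> * (1 / (84 * s\<^sup>2 * \<omega>))" using \<omega> R(5) by (intro mult_left_mono) auto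
      finally have "V \<le> 1 / (84 * s\<^sup>2)" using \<omega> by simp
      then show ?thesis using s by (simp add: field_simps)
    qed
    show "\<exists>R>0. \<forall>r>0. \<forall>J\<ge>1::nat. 2 ^ J * r \<le> R \<longrightarrow>
      rayleigh \<Omega> \<le> alpha \<Omega> (bump_energy TYPE('a) / r\<^sup>2) \<and>
      alpha \<Omega> (bump_energy TYPE('a) / r\<^sup>2) \<le> rayleigh \<Omega>
        + 84 * s\<^sup>2 * (C / (real J)\<^sup>2 * (\<Sum>j<J. (2 ^ j * r) ^ DIM('a) / (2 ^ j * r)\<^sup>2))"
    proof (intro exI[of _ R] conjI[OF R(1)] allI impI)
      fix r :: real and J :: nat assume r: "r > 0" and J: "J \<ge> 1" and rR: "2 ^ J * r \<le> R"
      define c0 where "c0 = C / (real J)\<^sup>2 * (\<Sum>j<J. (2 ^ j * r) ^ DIM('a) / (2 ^ j * r)\<^sup>2)"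
      have c0: "c0 > 0"
      proof -
        have "(\<Sum>j<J. (2 ^ j * r) ^ DIM('a) / (2 ^ j * r)\<^sup>2) > 0" using J r by (intro sum_pos) (auto simp: lessThan_empty_iff)
        then show ?thesis using C(1) J by (simp add: c0_def)
      qed
      obtain \<eta>0 :: "'a \<Rightarrow> real" and B where c: "\<forall>k. C_k k \<eta>0" "\<forall>x. 0 \<le> \<eta>0 x \<and> \<eta>0 x \<le> 1"
        "\<forall>x. norm x \<le> r \<longrightarrow> \<eta>0 x = 0" "\<forall>x. 2 ^ J * r \<le> norm x \<longrightarrow> \<eta>0 x = 1 \<and> gradient \<eta>0 x = 0"
        "\<forall>x. norm (gradient \<eta>0 x) \<le> B"
        and cI: "(\<integral>\<^sup>+x. ennreal ((norm (gradient \<eta>0 x))\<^sup>2) \<partial>lborel) \<le> ennreal c0"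
        using C(2)[rule_format, OF r J, folded c0_def] by (elim exE conjE) (rule that)
      have \<eta>0: "\<And>k. C_k k \<eta>0" "\<And>x. 0 \<le> \<eta>0 x" "\<And>x. \<eta>0 x \<le> 1"
        "\<And>x. norm x \<le> r \<Longrightarrow> \<eta>0 x = 0" "\<And>x. 2 ^ J * r \<le> norm x \<Longrightarrow> \<eta>0 x = 1"
        "\<And>x. 2 ^ J * r \<le> norm x \<Longrightarrow> gradient \<eta>0 x = 0" "\<And>x. norm (gradient \<eta>0 x) \<le> B"
        using c by simp_all
      have g0m [measurable]: "gradient \<eta>0 \<in> borel_measurable borel"
        by (rule borel_measurable_continuous_onI[OF continuous_gradient[OF \<eta>0(1)]])
      have gB: "(norm (gradient \<eta>0 x))\<^sup>2 \<le> B\<^sup>2" for x by (intro power_mono \<eta>0(7)) simp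
      define q where "q x = (norm (gradient \<eta>0 x))\<^sup>2" for x
      have qm [measurable]: "q \<in> borel_measurable borel" unfolding q_def[abs_def] by measurable
      have q0: "0 \<le> q x" "q x \<le> B\<^sup>2" for x using gB by (auto simp: q_def)
      define i where "i x = (indicator (ball (0::'a) R) x :: real)" for x
      have im [measurable]: "i \<in> borel_measurable borel" unfolding i_def[abs_def] by (intro borel_measurable_indicator) simp
      have i01: "0 \<le> i x" "i x \<le> 1" for x by (auto simp: i_def indicator_def)
      \<comment> \<open>Both summands have integral at most 1, so \<open>good_centre\<close> is used
        with \<open>c = 2\<close> and yields \<open>42 * s\<^sup>2\<close>. A single centre thereby
        bounds the energy error by \<open>42 * s\<^sup>2 * c0\<close> and the mass in the ball by
        \<open>42 * s\<^sup>2 * V\<close>.\<close>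
      define k where "k x = q x / c0 + i x / V" for x
      have km: "k \<in> borel_measurable borel" unfolding k_def[abs_def] by measurable
      have k0: "0 \<le> k x" for x using q0 i01 c0 V by (simp add: k_def)
      have kB: "k x \<le> B\<^sup>2 / c0 + 1 / V" for x
        unfolding k_def using q0 i01 c0 V by (intro add_mono divide_right_mono) auto
      have kR: "k x = 0" if "norm x \<ge> R" for x
        using that rR \<eta>0(6)[of x] by (simp add: k_def q_def i_def)
      have kI: "(\<integral>\<^sup>+x. ennreal (k x) \<partial>lborel) \<le> ennreal 2"
      proof -
        have "(\<integral>\<^sup>+x. ennreal (k x) \<partial>lborel) = (\<integral>\<^sup>+x. ennreal (1 / c0) * ennreal (q x) + ennreal (1 / V) * ennreal (i x) \<partial>lborel)"
          using q0 i01 c0 V by (intro nn_integral_cong) (simp add: k_def flip: ennreal_mult ennreal_plus)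
        also have "\<dots> = ennreal (1 / c0) * (\<integral>\<^sup>+x. ennreal (q x) \<partial>lborel) + ennreal (1 / V) * (\<integral>\<^sup>+x. ennreal (i x) \<partial>lborel)"
          by (subst nn_integral_add) (auto simp: nn_integral_cmult)
        also have "\<dots> \<le> ennreal (1 / c0) * ennreal c0 + ennreal (1 / V) * ennreal V"
        proof (intro add_mono mult_left_mono)
          show "(\<integral>\<^sup>+x. ennreal (q x) \<partial>lborel) \<le> ennreal c0" using cI by (simp add: q_def)
          have "(\<integral>\<^sup>+x. ennreal (i x) \<partial>lborel) = emeasure lborel (ball (0::'a) R)"
            by (simp add: i_def ennreal_indicator)
          also have "\<dots> = ennreal V"
            unfolding V_def using emeasure_bounded_finite[OF bounded_ball[of "0::'a" R]]
            by (intro emeasure_eq_ennreal_measure) auto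
          finally show "(\<integral>\<^sup>+x. ennreal (i x) \<partial>lborel) \<le> ennreal V" by simp
        qed auto
        also have "\<dots> = ennreal 2" using c0 V by (simp flip: ennreal_mult ennreal_plus)
        finally show ?thesis .
      qed
      obtain x0 where x0: "x0 \<in> K" "(\<integral>x. (u x)\<^sup>2 * k (x - x0) \<partial>?M) \<le> 21 * 2 * s\<^sup>2"
        by (rule good_centre[OF \<Omega>(1) u(1) K(1-3) K(4)[rule_format] s RG R(1) km k0 kB kR kI zero_less_numeral])
      note Ik = weighted_integrable[OF lu km k0 kB, of x0]
      note Iq = weighted_integrable[OF lu qm q0, of x0] and Ii = weighted_integrable[OF lu im i01, of x0]
      have bq: "(\<integral>x. (u x)\<^sup>2 * q (x - x0) \<partial>?M) \<le> 42 * s\<^sup>2 * c0"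
      proof -
        have "(\<integral>x. (u x)\<^sup>2 * q (x - x0) \<partial>?M) \<le> (\<integral>x. c0 * ((u x)\<^sup>2 * k (x - x0)) \<partial>?M)"
        proof (rule integral_mono[OF Iq integrable_mult_right[OF Ik]])
          fix x
          have "q (x - x0) \<le> c0 * k (x - x0)" using c0 V i01(1)[of "x - x0"] by (simp add: k_def distrib_left)
          then have "(u x)\<^sup>2 * q (x - x0) \<le> (u x)\<^sup>2 * (c0 * k (x - x0))" by (intro mult_left_mono) auto
          then show "(u x)\<^sup>2 * q (x - x0) \<le> c0 * ((u x)\<^sup>2 * k (x - x0))" by (simp add: mult.left_commute)
        qed
        also have "\<dots> = c0 * (\<integral>x. (u x)\<^sup>2 * k (x - x0) \<partial>?M)" by simp
        also have "\<dots> \<le> c0 * (21 * 2 * s\<^sup>2)" using c0 x0(2) by (intro mult_left_mono) auto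
        finally show ?thesis by (simp add: mult_ac)
      qed
      have bi: "(\<integral>x. (u x)\<^sup>2 * i (x - x0) \<partial>?M) \<le> 1 / 2"
      proof -
        have "(\<integral>x. (u x)\<^sup>2 * i (x - x0) \<partial>?M) \<le> (\<integral>x. V * ((u x)\<^sup>2 * k (x - x0)) \<partial>?M)"
        proof (rule integral_mono[OF Ii integrable_mult_right[OF Ik]])
          fix x
          have "i (x - x0) \<le> V * k (x - x0)" using c0 V q0(1)[of "x - x0"] by (simp add: k_def distrib_left)
          then have "(u x)\<^sup>2 * i (x - x0) \<le> (u x)\<^sup>2 * (V * k (x - x0))" by (intro mult_left_mono) auto
          then show "(u x)\<^sup>2 * i (x - x0) \<le> V * ((u x)\<^sup>2 * k (x - x0))" by (simp add: mult.left_commute)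
        qed
        also have "\<dots> = V * (\<integral>x. (u x)\<^sup>2 * k (x - x0) \<partial>?M)" by simp
        also have "\<dots> \<le> V * (21 * 2 * s\<^sup>2)" using V x0(2) by (intro mult_left_mono) auto
        finally show ?thesis using VR by (simp add: mult_ac)
      qed
      define \<eta> where "\<eta> x = \<eta>0 (1 *\<^sub>R x + - x0)" for x
      have ge: "gradient \<eta> x = gradient \<eta>0 (x - x0)" for x
        using gradient_affine[where f=\<eta>0 and c=1 and x=x and a="- x0", OF C_1_differentiable[OF \<eta>0(1)]] by (simp add: \<eta>_def[abs_def])
      have \<eta>: "\<And>k. C_k k \<eta>" "\<And>x. 0 \<le> \<eta> x" "\<And>x. \<eta> x \<le> 1" "\<And>x. norm (gradient \<eta> x) \<le> B"
        using \<eta>0(2,3,7) C_k_affine[OF \<eta>0(1), of _ 1 "- x0"] unfolding ge by (simp_all add: \<eta>_def[abs_def])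
      have rle: "r \<le> R"
      proof -
        have "1 * r \<le> 2 ^ J * r" using r by (intro mult_right_mono) auto
        then show ?thesis using rR by simp
      qed
      have b1: "ball x0 r \<subseteq> \<Omega>" using d(2) x0(1) rle R(3) by fastforce
      have b2: "\<eta> x = 0" if "x \<in> ball x0 r" for x
        using that \<eta>0(4)[of "x - x0"] by (simp add: \<eta>_def dist_norm norm_minus_commute)
      \<comment> \<open>The cutoff is 1 outside the ball of radius \<open>R\<close> around
        \<open>x0\<close>, so the lost mass is at most that of \<open>u\<close> in this
        ball.\<close>
      have m: "1 / 2 \<le> (n2 ?M (\<lambda>x. \<eta> x * u x))\<^sup>2"
      proof -
        obtain h where "hlim \<Omega> (\<lambda>x. \<eta> x * u x) h" using ground_state_energy[OF \<Omega>(1) u(1-3) \<eta>] by blast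
        note l = l2_integrable_sq[OF hlim_l2(1)[OF this]]
        have "1 = (\<integral>x. (norm (u x))\<^sup>2 \<partial>?M)" using u(2) n2_power2[of ?M u] by simp
        also have "\<dots> \<le> (\<integral>x. (norm (\<eta> x * u x))\<^sup>2 + (u x)\<^sup>2 * i (x - x0) \<partial>?M)"
        proof (rule integral_mono[OF l2_integrable_sq[OF lu] Bochner_Integration.integrable_add[OF l Ii]])
          fix x
          show "(norm (u x))\<^sup>2 \<le> (norm (\<eta> x * u x))\<^sup>2 + (u x)\<^sup>2 * i (x - x0)"
          proof (cases "norm (x - x0) < R")
            case True then show ?thesis by (simp add: i_def)
          next
            case False
            then have "\<eta> x = 1" using rR \<eta>0(5)[of "x - x0"] by (simp add: \<eta>_def)
            then show ?thesis using i01(1)[of "x - x0"] by simp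
          qed
        qed
        also have "\<dots> = (n2 ?M (\<lambda>x. \<eta> x * u x))\<^sup>2 + (\<integral>x. (u x)\<^sup>2 * i (x - x0) \<partial>?M)"
          unfolding n2_power2 by (rule Bochner_Integration.integral_add[OF l Ii])
        finally show ?thesis using bi by simp
      qed
      \<comment> \<open>With \<open>m = 1/2\<close> the factor 42 doubles to 84.\<close>
      note ab = alpha_bounds[OF \<Omega> u(1-3) u(4)[rule_format] \<eta> r b1 b2 _ m]
      have "rayleigh \<Omega> \<le> alpha \<Omega> (bump_energy TYPE('a) / r\<^sup>2)" by (rule ab(1)) auto
      moreover have "alpha \<Omega> (bump_energy TYPE('a) / r\<^sup>2)
          \<le> rayleigh \<Omega> + (\<integral>x. (u x)\<^sup>2 * (norm (gradient \<eta> x))\<^sup>2 \<partial>?M) / (1 / 2)" by (rule ab(2)) auto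
      moreover have "(\<integral>x. (u x)\<^sup>2 * (norm (gradient \<eta> x))\<^sup>2 \<partial>?M) \<le> 42 * s\<^sup>2 * c0"
        using bq by (simp add: ge q_def)
      ultimately show "rayleigh \<Omega> \<le> alpha \<Omega> (bump_energy TYPE('a) / r\<^sup>2) \<and>
        alpha \<Omega> (bump_energy TYPE('a) / r\<^sup>2) \<le> rayleigh \<Omega>
          + 84 * s\<^sup>2 * (C / (real J)\<^sup>2 * (\<Sum>j<J. (2 ^ j * r) ^ DIM('a) / (2 ^ j * r)\<^sup>2))"
        unfolding c0_def[symmetric] by simp
    qed
  qed
qed

section \<open>The two limits\<close>

text \<open>A single annulus, \<open>J = 1\<close>, already has capacity of the order
  \<open>r^(N-2)\<close>, which is \<open>(L / \<beta>) powr p\<close> for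
  \<open>r = sqrt (L / \<beta>)\<close>; the factor \<open>\<beta> powr p\<close> cancels
  it.\<close>

lemma alpha_limit_ge_3:
  fixes \<Omega> :: "'a::euclidean_space set"
  assumes \<Omega>: "open \<Omega>" "bounded \<Omega>" "\<Omega> \<noteq> {}" and N: "DIM('a) \<ge> 3"
  shows "((\<lambda>\<beta>. \<beta> powr ((real DIM('a) - 2) / 2) * (alpha \<Omega> \<beta> - lambda1 \<Omega>)) \<longlongrightarrow> 0) at_top"
proof (rule tendstoI)
  fix e :: real assume e: "e > 0"
  define p where "p = (real DIM('a) - 2) / 2"
  define L where "L = bump_energy TYPE('a)"
  have L: "L > 0" by (simp add: L_def bump_energy_pos)
  obtain C where C: "C > 0" "\<And>s. s > 0 \<Longrightarrow> \<exists>R>0. \<forall>r>0. \<forall>J\<ge>1::nat. 2 ^ J * r \<le> R \<longrightarrow>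
    rayleigh \<Omega> \<le> alpha \<Omega> (L / r\<^sup>2) \<and>
    alpha \<Omega> (L / r\<^sup>2) \<le> rayleigh \<Omega> + 84 * s\<^sup>2 * (C / (real J)\<^sup>2 * (\<Sum>j<J. (2 ^ j * r) ^ DIM('a) / (2 ^ j * r)\<^sup>2))"
    unfolding L_def using alpha_asymptotic_bound[OF \<Omega>] by blast
  have LC: "84 * C * L powr p > 0" using C(1) L by simp
  \<comment> \<open>Makes the bound \<open>84 * s\<^sup>2 * C * L powr p\<close> left after the
    cancellation equal to \<open>e / 2\<close>.\<close>
  define s where "s = sqrt (e / 2 / (84 * C * L powr p))"
  have s: "s > 0" using e LC unfolding s_def by (intro real_sqrt_gt_zero divide_pos_pos) auto
  have s2: "84 * s\<^sup>2 * (C * L powr p) = e / 2"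
  proof -
    have "s\<^sup>2 = e / 2 / (84 * C * L powr p)" unfolding s_def using e LC by (intro real_sqrt_pow2 divide_nonneg_pos) auto
    then show ?thesis using C(1) L by (simp add: field_simps)
  qed
  obtain R where R: "R > 0" "\<And>r J. r > 0 \<Longrightarrow> J \<ge> (1::nat) \<Longrightarrow> 2 ^ J * r \<le> R \<Longrightarrow>
    rayleigh \<Omega> \<le> alpha \<Omega> (L / r\<^sup>2) \<and>
    alpha \<Omega> (L / r\<^sup>2) \<le> rayleigh \<Omega> + 84 * s\<^sup>2 * (C / (real J)\<^sup>2 * (\<Sum>j<J. (2 ^ j * r) ^ DIM('a) / (2 ^ j * r)\<^sup>2))"
    using C(2)[OF s] by blast
  \<comment> \<open>The second bound says that \<open>2 * r \<le> R\<close> for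
    \<open>r = sqrt (L / \<beta>)\<close>.\<close>
  have "\<forall>\<^sub>F \<beta> in at_top. \<beta> \<ge> max 1 (4 * L / R\<^sup>2)" by (rule eventually_ge_at_top)
  then show "\<forall>\<^sub>F \<beta> in at_top. dist (\<beta> powr ((real DIM('a) - 2) / 2) * (alpha \<Omega> \<beta> - lambda1 \<Omega>)) 0 < e"
  proof eventually_elim
    case (elim \<beta>)
    then have \<beta>: "\<beta> > 0" "4 * L / R\<^sup>2 \<le> \<beta>" by auto
    define r where "r = sqrt (L / \<beta>)"
    have r: "r > 0" "r\<^sup>2 = L / \<beta>" using L \<beta> by (auto simp: r_def)
    have "(2 * r)\<^sup>2 = 4 * (L / \<beta>)" by (simp only: power_mult_distrib r(2)) simp
    also have "\<dots> \<le> R\<^sup>2" using \<beta> R(1) by (simp add: field_simps)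
    finally have "(2 * r)\<^sup>2 \<le> R\<^sup>2" .
    then have rR: "2 ^ 1 * r \<le> R" using R(1) r(1) power2_le_imp_le[of "2 * r" R] by simp
    have Lr: "L / r\<^sup>2 = \<beta>" using r L \<beta>(1) by simp
    have rN: "r ^ DIM('a) / r\<^sup>2 = (L / \<beta>) powr p"
    proof -
      have "r ^ DIM('a) / r\<^sup>2 = r powr (real DIM('a) - 2)"
        using r(1) by (simp add: powr_diff powr_realpow)
      also have "\<dots> = ((L / \<beta>) powr (1 / 2)) powr (real DIM('a) - 2)"
        using L \<beta>(1) by (simp add: r_def powr_half_sqrt)
      also have "\<dots> = (L / \<beta>) powr p" by (simp add: powr_powr p_def)
      finally show ?thesis .
    qed
    have b: "rayleigh \<Omega> \<le> alpha \<Omega> \<beta>" "alpha \<Omega> \<beta> \<le> rayleigh \<Omega> + 84 * s\<^sup>2 * (C * (L / \<beta>) powr p)"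
      using R(2)[OF r(1) order_refl rR] unfolding Lr by (simp_all add: rN)
    have "\<beta> powr p * (alpha \<Omega> \<beta> - rayleigh \<Omega>) \<le> \<beta> powr p * (84 * s\<^sup>2 * (C * (L / \<beta>) powr p))"
      using b(2) by (intro mult_left_mono) auto
    also have "\<dots> = 84 * s\<^sup>2 * (C * (\<beta> powr p * (L / \<beta>) powr p))" by (simp add: mult_ac)
    also have "\<beta> powr p * (L / \<beta>) powr p = L powr p"
      using L \<beta>(1) by (simp add: powr_divide)
    also have "84 * s\<^sup>2 * (C * L powr p) < e" using s2 e by simp
    finally show ?case
      using b(1) by (simp add: lambda1_eq_rayleigh[OF \<Omega>] p_def dist_real_def abs_mult)
  qed
qed

text \<open>In dimension 2 every summand equals 1, so \<open>J\<close> annuli give a bound of order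
  \<open>1 / J\<close>. As many annuli are taken as fit between \<open>r\<close> and
  \<open>R\<close>, about \<open>log 2 (R / r)\<close>, and this number is comparable to
  \<open>ln \<beta>\<close>.\<close>

lemma alpha_limit_2:
  fixes \<Omega> :: "'a::euclidean_space set"
  assumes \<Omega>: "open \<Omega>" "bounded \<Omega>" "\<Omega> \<noteq> {}" and N: "DIM('a) = 2"
  shows "((\<lambda>\<beta>. ln \<beta> * (alpha \<Omega> \<beta> - lambda1 \<Omega>)) \<longlongrightarrow> 0) at_top"
proof (rule tendstoI)
  fix e :: real assume e: "e > 0"
  define L where "L = bump_energy TYPE('a)"
  have L: "L > 0" by (simp add: L_def bump_energy_pos)
  obtain C where C: "C > 0" "\<And>s. s > 0 \<Longrightarrow> \<exists>R>0. \<forall>r>0. \<forall>J\<ge>1::nat. 2 ^ J * r \<le> R \<longrightarrow>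
    rayleigh \<Omega> \<le> alpha \<Omega> (L / r\<^sup>2) \<and>
    alpha \<Omega> (L / r\<^sup>2) \<le> rayleigh \<Omega> + 84 * s\<^sup>2 * (C / (real J)\<^sup>2 * (\<Sum>j<J. (2 ^ j * r) ^ DIM('a) / (2 ^ j * r)\<^sup>2))"
    unfolding L_def using alpha_asymptotic_bound[OF \<Omega>] by blast
  \<comment> \<open>336 is 4 times 84; the 4 comes from
    \<open>ln \<beta> \<le> 4 * real J\<close>.\<close>
  define s where "s = sqrt (e / 2 / (336 * C))"
  have s: "s > 0" using e C(1) unfolding s_def by (intro real_sqrt_gt_zero divide_pos_pos) auto
  have s2: "4 * (84 * s\<^sup>2 * C) = e / 2"
  proof -
    have "s\<^sup>2 = e / 2 / (336 * C)" unfolding s_def using e C(1) by (intro real_sqrt_pow2 divide_nonneg_pos) auto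
    then show ?thesis using C(1) by (simp add: field_simps)
  qed
  obtain R where R: "R > 0" "\<And>r J. r > 0 \<Longrightarrow> J \<ge> (1::nat) \<Longrightarrow> 2 ^ J * r \<le> R \<Longrightarrow>
    rayleigh \<Omega> \<le> alpha \<Omega> (L / r\<^sup>2) \<and>
    alpha \<Omega> (L / r\<^sup>2) \<le> rayleigh \<Omega> + 84 * s\<^sup>2 * (C / (real J)\<^sup>2 * (\<Sum>j<J. (2 ^ j * r) ^ DIM('a) / (2 ^ j * r)\<^sup>2))"
    using C(2)[OF s] by blast
  \<comment> \<open>For \<open>r = sqrt (L / \<beta>)\<close> one has
    \<open>log 2 (R / r) = D + ln \<beta> / 2 / ln 2\<close>. Since \<open>ln 2 \<le> 1\<close>, the
    threshold \<open>4 - 4 * D\<close> gives \<open>ln \<beta> \<le> 4 * (t - 1)\<close>, where the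
    1 allows for rounding \<open>t\<close> down to \<open>J\<close>.\<close>
  define D where "D = (ln R - ln L / 2) / ln 2"
  define A where "A = max 1 (4 - 4 * D)"
  have "\<forall>\<^sub>F \<beta> in at_top. \<beta> \<ge> exp A" by (rule eventually_ge_at_top)
  then show "\<forall>\<^sub>F \<beta> in at_top. dist (ln \<beta> * (alpha \<Omega> \<beta> - lambda1 \<Omega>)) 0 < e"
  proof eventually_elim
    case (elim \<beta>)
    then have \<beta>: "\<beta> > 0" using exp_gt_zero[of A] by linarith
    then have "A \<le> ln \<beta>" using elim by (simp add: ln_ge_iff)
    then have lb: "1 \<le> ln \<beta>" "4 - 4 * D \<le> ln \<beta>" by (auto simp: A_def)
    define r where "r = sqrt (L / \<beta>)"
    have r: "r > 0" "r\<^sup>2 = L / \<beta>" using L \<beta> by (auto simp: r_def)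
    have Lr: "L / r\<^sup>2 = \<beta>" using r L \<beta>(1) by simp
    define t where "t = log 2 (R / r)"
    have t: "t = D + ln \<beta> / 2 / ln 2"
    proof -
      have lr: "ln r = (ln L - ln \<beta>) / 2" using L \<beta> by (simp add: r_def ln_sqrt ln_div)
      have "t = (ln R - ln r) / ln 2" using R(1) r(1) by (simp add: t_def log_def ln_div)
      also have "ln R - ln r = (ln R - ln L / 2) + ln \<beta> / 2" by (simp add: lr field_simps)
      finally show ?thesis by (simp only: D_def add_divide_distrib)
    qed
    have "ln \<beta> / 2 * ln 2 \<le> ln \<beta> / 2 * 1" using ln2_le_25_over_36 lb by (intro mult_left_mono) auto
    then have "ln \<beta> / 2 \<le> ln \<beta> / 2 / ln 2" by (simp add: pos_le_divide_eq)
    then have t2: "4 * (t - 1) \<ge> ln \<beta>" using lb(2) unfolding t by simp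
    define J where "J = nat \<lfloor>t\<rfloor>"
    have "t \<ge> 1" using t2 lb(1) by simp
    then have J: "real J \<le> t" "t - 1 \<le> real J" unfolding J_def by linarith+
    have J4: "ln \<beta> \<le> 4 * real J" using t2 J(2) by simp
    then have J1: "J \<ge> 1" using lb(1) by (cases J) auto
    have rR: "2 ^ J * r \<le> R"
    proof -
      have "2 ^ J = 2 powr real J" by (simp add: powr_realpow)
      also have "\<dots> \<le> 2 powr t" using J(1) by (intro powr_mono) auto
      also have "\<dots> = R / r" unfolding t_def using R(1) r(1) by simp
      finally show ?thesis using r(1) by (simp add: pos_le_divide_eq)
    qed
    have "(\<Sum>j<J. (2 ^ j * r) ^ DIM('a) / (2 ^ j * r)\<^sup>2) = (\<Sum>j<J. 1)"
      using r(1) by (intro sum.cong) (auto simp: N)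
    then have b: "rayleigh \<Omega> \<le> alpha \<Omega> \<beta>" "alpha \<Omega> \<beta> \<le> rayleigh \<Omega> + 84 * s\<^sup>2 * (C / real J)"
      using R(2)[OF r(1) J1 rR] J1 unfolding Lr by (simp_all add: power2_eq_square)
    have "ln \<beta> * (alpha \<Omega> \<beta> - rayleigh \<Omega>) \<le> (4 * real J) * (84 * s\<^sup>2 * (C / real J))"
      using b lb(1) J4 by (intro mult_mono) auto
    also have "\<dots> = 4 * (84 * s\<^sup>2 * C)" using J1 by simp
    also have "\<dots> < e" using s2 e by simp
    finally show ?case
      using b(1) lb(1) by (simp add: lambda1_eq_rayleigh[OF \<Omega>] dist_real_def abs_mult)
  qed
qed

theorem proposition3p3:
  fixes \<Omega> :: "(real ^ 'n) set"
  assumes "open \<Omega>" and "connected \<Omega>" and "bounded \<Omega>" and "\<Omega> \<noteq> {}"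
  shows "(CARD('n) \<ge> 3 \<longrightarrow>
            ((\<lambda>\<beta>. \<beta> powr ((real CARD('n) - 2) / 2) * (alpha \<Omega> \<beta> - lambda1 \<Omega>)) \<longlongrightarrow> 0) at_top) \<and>
         (CARD('n) = 2 \<longrightarrow>
            ((\<lambda>\<beta>. ln \<beta> * (alpha \<Omega> \<beta> - lambda1 \<Omega>)) \<longlongrightarrow> 0) at_top)"
  using alpha_limit_ge_3[OF assms(1,3,4)] alpha_limit_2[OF assms(1,3,4)] by simp

end
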